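(* Suppose assumptions (A1) and (A2) hold for some $K,\Lambda\ge 2$ and $\mathfrak p\ge 1$. Then there exist a universal constant $c_0>1$ and a constant $c_{\mathfrak p}>1$ depending only on $\mathfrak p$ such that for every $t\ge 1$ and every $x\ge 1$, with $\mathbb P^{(0)}$-probability at least $1-c_0\,n\,t\,e^{-x}$, $$\|\mu^{(t)}-\mathrm u_\ast^{(t)}\|\le \big(K\Lambda L_\ast^{(0)}(1\vee\|\eta_{[0:t)}\|_\infty)\,x\big)^{c_{\mathfrak p}}\Big(1+\max_{s\in[1:t-1]} \big(n^{1/2}\|\mathrm u_\ast^{(s)}\|_\infty\vee\|\mathrm u_X^{(s)}\|\big)\Big)^{c_{\mathfrak p}}\Big\{\phi^{-1/2}\,\mathfrak M^{(t-1)}_{\mu^{(\cdot)},\mathrm u_X^{(\cdot)}}(X)+n^{-1/2}\,\mathscr M^{(t-1),X}_{\mathrm u_X^{(\cdot)},\mathrm u_\ast^{(\cdot)}}\Big\}.$$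
   Context: Standing setup. Let $m,n\ge 16$ be integers and $\phi\equiv m/n$. Let $X\in\mathbb R^{m\times n}$ be a random matrix with rows $X_1,\dots,X_m\in\mathbb R^n$; let $\mu_\ast\in\mathbb R^n$ (signal), $\xi=(\xi_1,\dots,\xi_m)$ (errors), a model function $\mathcal F:\mathbb R^2\to\mathbb R$, and responses $Y_i=\mathcal F(\langle X_i,\mu_\ast\rangle,\xi_i)$. Let $\mathsf L:\mathbb R^2\to\mathbb R$ be a loss, and $\partial_1\mathsf L$ its partial derivative in its first argument. Gradient descent: given $\mu^{(0)}\in\mathbb R^n$ and step sizes $\eta_0,\eta_1,\ldots>0$, $\mu^{(t)}=\mu^{(t-1)}-\frac{\eta_{t-1}}{m}X^\top\partial_1\mathsf L(X\mu^{(t-1)},Y)$ for $t\ge1$ (functions applied componentwise). $X$ is independent of $(\mu^{(0)},\mu_\ast,\xi)$, and $\mathbb E^{(0)},\mathbb P^{(0)}$ denote expectation/probability conditional on $(\mu^{(0)},\mu_\ast,\xi)$. Define $\mathfrak S(x_0,z_0,\xi_0)\equiv\partial_1\mathsf L(x_0,\mathcal F(z_0,\xi_0))$; $\partial_1\mathfrak S,\partial_2\mathfrak S$ denote partial derivatives in the first two arguments and $\partial_\alpha$, $\alpha\in\mathbb Z_{\ge0}^2$, mixed partials in these arguments. Let $U\sim\mathrm{Unif}[0,1]$, $\pi_m\sim\mathrm{Unif}\{1,\dots,m\}$, $\mathsf Z_n\sim\mathcal N(0,I_n)$ be independent of each other and of everything else, and let $\mathsf Z$ denote an $m\times n$ matrix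 with i.i.d. $\mathcal N(0,1)$ entries. Write $[a:b]=\{a,\dots,b\}$, $L_\ast^{(0)}\equiv1+n^{1/2}\|\mu^{(0)}\|_\infty+n^{1/2}\|\mu_\ast\|_\infty$, $\|\eta_{[0:t)}\|_\infty=\max_{0\le s<t}\eta_s$. A map $f:\mathbb R^k\to\mathbb R$ is $\Lambda$-pseudo-Lipschitz of order $\mathfrak p$ if $|f(x)-f(y)|\le\Lambda(1+\|x\|+\|y\|)^{\mathfrak p-1}\|x-y\|$ for all $x,y$. Assumptions. (A1) The $X_{ij}$ are independent with $\mathbb EX_{ij}=0$, $\mathrm{Var}(X_{ij})=1$, $\max_{i,j}\|X_{ij}\|_{\psi_2}\le K$ (sub-gaussian Orlicz norm). (A2) For all $i\in[m]$ and $\alpha\in\mathbb Z_{\ge0}^2$ with $|\alpha|\le4$, $(x,z)\mapsto\partial_\alpha\mathfrak S(x,z,\xi_i)$ is $\Lambda$-pseudo-Lipschitz of order $\mathfrak p$ and $|\partial_\alpha\mathfrak S(0,0,\xi_i)|\le\Lambda$. Matrices. For $\mathrm u,\mathrm v\in\mathbb R^n$: $M_{\mathrm u,\mathrm v}(X)\equiv\mathbb E_{U,\pi_m}\,\partial_1\mathfrak S(\langle X_{\pi_m},U\mathrm u+(1-U)\mathrm v\rangle,\langle X_{\pi_m},\mu_\ast\rangle,\xi_{\pi_m})X_{\pi_m}X_{\pi_m}^\top$ (expectation over $U,\pi_m$ only), and for $W\in\{X,\mathsf Z\}$, $\mathbb M^W_{\mathrm u,\mathrm v}\equiv\mathbb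 E^{(0)}\partial_1\mathfrak S(\langle W_{\pi_m},U\mathrm u+(1-U)\mathrm v\rangle,\langle W_{\pi_m},\mu_\ast\rangle,\xi_{\pi_m})W_{\pi_m}W_{\pi_m}^\top$ (expectation over $W,U,\pi_m$; $\mathrm u,\mathrm v$ treated as fixed). For sequences $\{\mathrm u^{(s)}\},\{\mathrm v^{(s)}\}\subset\mathbb R^n$: $\mathscr M^{(t),X}_{\mathrm u^{(\cdot)},\mathrm v^{(\cdot)}}\equiv1+\max_{\tau\in[0:t]}\sum_{s\in[0:\tau]}\prod_{r\in[s:\tau]}\|I_n-\eta_r\mathbb M^X_{\mathrm u^{(r)},\mathrm v^{(r)}}\|_{op}$ and $\mathfrak M^{(t)}_{\mathrm u^{(\cdot)},\mathrm v^{(\cdot)}}(X)\equiv1+\max_{\tau\in[0:t]}\sum_{s\in[0:\tau]}\prod_{r\in[s:\tau]}\|I_n-\eta_rM_{\mathrm u^{(r)},\mathrm v^{(r)}}(X)\|_{op}$. Iterates. Theoretical gradient descent: $\mathrm u_X^{(0)}=\mu^{(0)}$, $\mathrm u_X^{(t)}=\mathrm u_X^{(t-1)}-\frac{\eta_{t-1}}{m}\mathbb E^{(0)}X^\top\mathfrak S(X\mathrm u_X^{(t-1)},X\mu_\ast,\xi)$. State evolution: $\mathrm u_\ast^{(0)}=\mu^{(0)}$, $\mathrm u_\ast^{(t)}=(1-\eta_{t-1}\tau_\ast^{(t-1)})\mathrm u_\ast^{(t-1)}+\eta_{t-1}\delta_\ast^{(t-1)}\mu_\ast$, where $\tau_\ast^{(t-1)}=\mathbb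 E^{(0)}\partial_1\mathfrak S(\langle\mathsf Z_n,\mathrm u_\ast^{(t-1)}\rangle,\langle\mathsf Z_n,\mu_\ast\rangle,\xi_{\pi_m})$ and $\delta_\ast^{(t-1)}=-\mathbb E^{(0)}\partial_2\mathfrak S(\langle\mathsf Z_n,\mathrm u_\ast^{(t-1)}\rangle,\langle\mathsf Z_n,\mu_\ast\rangle,\xi_{\pi_m})$. *)

theory Defs
  imports "HOL-Probability.Probability"
begin

section \<open>Vectors in R^n represented as nat => real (only indices < n matter)\<close>

definition vinner :: "nat \<Rightarrow> (nat \<Rightarrow> real) \<Rightarrow> (nat \<Rightarrow> real) \<Rightarrow> real" where
  "vinner n u v = (\<Sum>j<n. u j * v j)"

definition vnorm :: "nat \<Rightarrow> (nat \<Rightarrow> real) \<Rightarrow> real" where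
  "vnorm n u = sqrt (\<Sum>j<n. (u j)\<^sup>2)"

definition vnorm_inf :: "nat \<Rightarrow> (nat \<Rightarrow> real) \<Rightarrow> real" where
  "vnorm_inf n u = Max ((\<lambda>j. \<bar>u j\<bar>) ` {..<n})"

definition opnorm :: "nat \<Rightarrow> (nat \<Rightarrow> nat \<Rightarrow> real) \<Rightarrow> real" where
  "opnorm n A = Sup {vnorm n (\<lambda>j. \<Sum>k<n. A j k * v k) | v. vnorm n v \<le> 1}"

definition id_minus :: "real \<Rightarrow> (nat \<Rightarrow> nat \<Rightarrow> real) \<Rightarrow> (nat \<Rightarrow> nat \<Rightarrow> real)" where
  "id_minus e A = (\<lambda>j k. (if j = k then 1 else 0) - e * A j k)"

definition psi2_norm :: "real measure \<Rightarrow> ereal" where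
  "psi2_norm D = Inf {ereal s | s. s > 0 \<and> (\<integral>\<^sup>+ y. ennreal (exp (y\<^sup>2 / s\<^sup>2)) \<partial>D) \<le> 2}"

definition D1 :: "(real \<Rightarrow> real \<Rightarrow> real) \<Rightarrow> real \<Rightarrow> real \<Rightarrow> real" where
  "D1 g = (\<lambda>x z. deriv (\<lambda>x'. g x' z) x)"

definition D2 :: "(real \<Rightarrow> real \<Rightarrow> real) \<Rightarrow> real \<Rightarrow> real \<Rightarrow> real" where
  "D2 g = (\<lambda>x z. deriv (\<lambda>z'. g x z') z)"

definition pd :: "(real \<Rightarrow> real \<Rightarrow> real) \<Rightarrow> nat \<Rightarrow> nat \<Rightarrow> real \<Rightarrow> real \<Rightarrow> real" where
  "pd g a b = (D1 ^^ a) ((D2 ^^ b) g)"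

definition partials_exist :: "nat \<Rightarrow> (real \<Rightarrow> real \<Rightarrow> real) \<Rightarrow> bool" where
  "partials_exist k g \<longleftrightarrow>
     (\<forall>b<k. \<forall>x z. (\<lambda>z'. pd g 0 b x z') differentiable (at z)) \<and>
     (\<forall>a b. a + b < k \<longrightarrow> (\<forall>x z. (\<lambda>x'. pd g a b x' z) differentiable (at x)))"

definition pseudo_lipschitz :: "real \<Rightarrow> real \<Rightarrow> (real \<times> real \<Rightarrow> real) \<Rightarrow> bool" where
  "pseudo_lipschitz \<Lambda> p f \<longleftrightarrow>
     (\<forall>u v. \<bar>f u - f v\<bar> \<le> \<Lambda> * (1 + norm u + norm v) powr (p - 1) * norm (u - v))"

definition frakS :: "(real \<Rightarrow> real \<Rightarrow> real) \<Rightarrow> (real \<Rightarrow> real \<Rightarrow> real) \<Rightarrow> real \<Rightarrow> real \<Rightarrow> real \<Rightarrow> real" where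
  "frakS L F x0 z0 xi0 = deriv (\<lambda>a. L a (F z0 xi0)) x0"

text \<open>Random matrix: a sample point w of the product space; X_ij = w (i,j); row i.\<close>
definition row :: "(nat \<times> nat \<Rightarrow> real) \<Rightarrow> nat \<Rightarrow> nat \<Rightarrow> real" where
  "row w i = (\<lambda>j. w (i, j))"

definition XLaw :: "nat \<Rightarrow> nat \<Rightarrow> (nat \<Rightarrow> nat \<Rightarrow> real measure) \<Rightarrow> (nat \<times> nat \<Rightarrow> real) measure" where
  "XLaw m n D = PiM ({..<m} \<times> {..<n}) (\<lambda>(i,j). D i j)"

definition GaussLaw :: "nat \<Rightarrow> (nat \<Rightarrow> real) measure" where
  "GaussLaw n = PiM {..<n} (\<lambda>_. density lborel std_normal_density)"

primrec gd :: "(real \<Rightarrow> real \<Rightarrow> real \<Rightarrow> real) \<Rightarrow> nat \<Rightarrow> nat \<Rightarrow> (nat \<Rightarrow> real)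
    \<Rightarrow> (nat \<Rightarrow> real) \<Rightarrow> (nat \<Rightarrow> real) \<Rightarrow> (nat \<Rightarrow> real) \<Rightarrow> (nat \<times> nat \<Rightarrow> real) \<Rightarrow> nat \<Rightarrow> nat \<Rightarrow> real" where
  "gd S m n xi mu0 mus eta w 0 = mu0"
| "gd S m n xi mu0 mus eta w (Suc t) =
     (\<lambda>j. gd S m n xi mu0 mus eta w t j - eta t / real m *
        (\<Sum>i<m. w (i, j) * S (vinner n (row w i) (gd S m n xi mu0 mus eta w t))
                               (vinner n (row w i) mus) (xi i)))"

primrec theo_gd :: "(real \<Rightarrow> real \<Rightarrow> real \<Rightarrow> real) \<Rightarrow> nat \<Rightarrow> nat \<Rightarrow> (nat \<times> nat \<Rightarrow> real) measure
    \<Rightarrow> (nat \<Rightarrow> real) \<Rightarrow> (nat \<Rightarrow> real) \<Rightarrow> (nat \<Rightarrow> real) \<Rightarrow> (nat \<Rightarrow> real) \<Rightarrow> nat \<Rightarrow> nat \<Rightarrow> real" where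
  "theo_gd S m n P xi mu0 mus eta 0 = mu0"
| "theo_gd S m n P xi mu0 mus eta (Suc t) =
     (\<lambda>j. theo_gd S m n P xi mu0 mus eta t j - eta t / real m *
        (\<Sum>i<m. \<integral>w. w (i, j) * S (vinner n (row w i) (theo_gd S m n P xi mu0 mus eta t))
                                   (vinner n (row w i) mus) (xi i) \<partial>P))"

primrec state_evo :: "(real \<Rightarrow> real \<Rightarrow> real \<Rightarrow> real) \<Rightarrow> nat \<Rightarrow> nat
    \<Rightarrow> (nat \<Rightarrow> real) \<Rightarrow> (nat \<Rightarrow> real) \<Rightarrow> (nat \<Rightarrow> real) \<Rightarrow> (nat \<Rightarrow> real) \<Rightarrow> nat \<Rightarrow> nat \<Rightarrow> real" where
  "state_evo S m n xi mu0 mus eta 0 = mu0"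
| "state_evo S m n xi mu0 mus eta (Suc t) =
     (let u = state_evo S m n xi mu0 mus eta t;
          tau = (1 / real m) * (\<Sum>i<m. \<integral>z. pd (\<lambda>a b. S a b (xi i)) 1 0 (vinner n z u) (vinner n z mus) \<partial>GaussLaw n);
          delta = - (1 / real m) * (\<Sum>i<m. \<integral>z. pd (\<lambda>a b. S a b (xi i)) 0 1 (vinner n z u) (vinner n z mus) \<partial>GaussLaw n)
      in (\<lambda>j. (1 - eta t * tau) * u j + eta t * delta * mus j))"

text \<open>M_{u,v}(X): expectation over U and pi_m only (entries (j,k)).\<close>
definition Mmat :: "(real \<Rightarrow> real \<Rightarrow> real \<Rightarrow> real) \<Rightarrow> nat \<Rightarrow> nat \<Rightarrow> (nat \<Rightarrow> real) \<Rightarrow> (nat \<Rightarrow> real)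
    \<Rightarrow> (nat \<Rightarrow> real) \<Rightarrow> (nat \<Rightarrow> real) \<Rightarrow> (nat \<times> nat \<Rightarrow> real) \<Rightarrow> nat \<Rightarrow> nat \<Rightarrow> real" where
  "Mmat S m n xi mus u v w = (\<lambda>j k. (1 / real m) * (\<Sum>i<m.
      (LBINT U:{0..1}. pd (\<lambda>a b. S a b (xi i)) 1 0
          (vinner n (row w i) (\<lambda>l. U * u l + (1 - U) * v l)) (vinner n (row w i) mus))
      * w (i, j) * w (i, k)))"

definition MmatE :: "(real \<Rightarrow> real \<Rightarrow> real \<Rightarrow> real) \<Rightarrow> nat \<Rightarrow> nat \<Rightarrow> (nat \<times> nat \<Rightarrow> real) measure
    \<Rightarrow> (nat \<Rightarrow> real) \<Rightarrow> (nat \<Rightarrow> real) \<Rightarrow> (nat \<Rightarrow> real) \<Rightarrow> (nat \<Rightarrow> real) \<Rightarrow> nat \<Rightarrow> nat \<Rightarrow> real" where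
  "MmatE S m n P xi mus u v = (\<lambda>j k. \<integral>w. Mmat S m n xi mus u v w j k \<partial>P)"

definition Mfun :: "nat \<Rightarrow> (nat \<Rightarrow> real) \<Rightarrow> (nat \<Rightarrow> nat \<Rightarrow> nat \<Rightarrow> real) \<Rightarrow> nat \<Rightarrow> real" where
  "Mfun n eta A t = 1 + Max ((\<lambda>\<tau>. \<Sum>s\<in>{0..\<tau>}. \<Prod>r\<in>{s..\<tau>}. opnorm n (id_minus (eta r) (A r))) ` {0..t})"

end

(* Gradient descent minus the theoretical iteration, and the theoretical iteration minus the state
   evolution, both satisfy linear recursions: the difference of the gradients is the averaged
   Hessian M (respectively its expectation) applied to the difference of the iterates. The two
   inhomogeneities are then estimated coordinatewise. The first is a normalised sum of independent
   centred variables, one per row, whose moments of order about x are controlled by the generating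
   function bound e^r - r <= e^(r^2). The second is of order 1/n: expanding in the single entry X_j
   around 0 gives E X_j S = u_j E d1 S + mu_j E d2 S up to a quadratic error, because X_j has mean 0
   and variance 1, and Lindeberg replacement then turns the entries into Gaussians at the price of
   n third-order errors of size n^(-3/2), with a further factor n^(-1/2) from u_j and mu_j.
   No Gaussian integration by parts is needed, since the state evolution is already written in
   terms of the derivatives of S. *)

theory Submission
  imports Defs
begin

subsection \<open>Finite-dimensional norms and perturbed linear recursions\<close>

text \<open>The noise is evaluated at the theoretical iterates, which are deterministic; this is
  what keeps the row contributions independent. All dependence of the actual iterates on the data
  stays inside the random matrices, whose norms are part of the bound. A row contribution is
  controlled only by a polynomial of degree \<open>P + 1\<close> in sub-Gaussian variables, so
  exponential moments need not exist; one high moment is used instead, and a union bound over the n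
  t pairs of coordinate and time produces the factor n t. Returning from coordinates to the
  Euclidean norm costs sqrt n, which turns m^(-1/2) into phi^(-1/2) and 1/n into n^(-1/2). The bias
  is evaluated at the state evolution and needs coordinates of order n^(-1/2) there, whereas the
  noise needs only the length of the theoretical iterates; hence the different norms of the two
  sequences in the bound. Since K and Lambda are at least 2, constants that depend on p alone can be
  absorbed as powers of K Lambda, so that only the exponent depends on p.\<close>

lemma vnorm_L2: "vnorm n u = L2_set u {..<n}"
  by (simp add: vnorm_def L2_set_def)

lemma vnorm_nonneg [simp]: "0 \<le> vnorm n u"
  by (simp add: vnorm_def sum_nonneg)

lemma vnorm_triangle: "vnorm n (\<lambda>j. u j + v j) \<le> vnorm n u + vnorm n v"
  unfolding vnorm_L2 by (rule L2_set_triangle_ineq)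

lemma vnorm_scale: "vnorm n (\<lambda>j. c * u j) = \<bar>c\<bar> * vnorm n u"
  by (simp add: vnorm_def power_mult_distrib sum_distrib_left[symmetric] real_sqrt_mult)

lemma vnorm_diff: "vnorm n (\<lambda>j. u j - v j) \<le> vnorm n u + vnorm n v"
  using vnorm_triangle[of n u "\<lambda>j. (-1) * v j"] vnorm_scale[of n "-1" v] by simp

lemma vnorm_cong: "(\<And>j. j < n \<Longrightarrow> u j = v j) \<Longrightarrow> vnorm n u = vnorm n v"
  by (simp add: vnorm_def)

lemma component_le_vnorm: "k < n \<Longrightarrow> \<bar>u k\<bar> \<le> vnorm n u"
  using member_le_L2_set[of "{..<n}" k u] member_le_L2_set[of "{..<n}" k "\<lambda>j. - u j"]
  by (simp add: vnorm_L2 L2_set_def abs_le_iff)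

lemma vnorm_le_sqrt_mult:
  assumes "\<And>j. j < n \<Longrightarrow> \<bar>u j\<bar> \<le> c" "0 \<le> c"
  shows "vnorm n u \<le> sqrt (real n) * c"
proof -
  have "(\<Sum>j<n. (u j)\<^sup>2) \<le> (\<Sum>j<n. c\<^sup>2)"
    using assms by (intro sum_mono) (metis abs_ge_zero lessThan_iff power2_abs power_mono)
  then have "vnorm n u \<le> sqrt (real n * c\<^sup>2)" unfolding vnorm_def by simp
  then show ?thesis using assms by (simp add: real_sqrt_mult)
qed

lemma component_le_vnorm_inf: "k < n \<Longrightarrow> \<bar>u k\<bar> \<le> vnorm_inf n u"
  unfolding vnorm_inf_def by (intro Max_ge) auto

lemma vnorm_inf_nonneg: "0 < n \<Longrightarrow> 0 \<le> vnorm_inf n u"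
  using component_le_vnorm_inf[of 0 n u] by linarith

lemma vnorm_le_vnorm_inf: "0 < n \<Longrightarrow> vnorm n u \<le> sqrt (real n) * vnorm_inf n u"
  by (intro vnorm_le_sqrt_mult component_le_vnorm_inf vnorm_inf_nonneg)

lemma abs_sum_mult_le_vnorm: "\<bar>\<Sum>k<n. a k * v k\<bar> \<le> (\<Sum>k<n. \<bar>a k\<bar>) * vnorm n v"
proof -
  have "\<bar>\<Sum>k<n. a k * v k\<bar> \<le> (\<Sum>k<n. \<bar>a k\<bar> * vnorm n v)"
    by (rule order_trans[OF sum_abs]) (auto intro!: sum_mono mult_left_mono component_le_vnorm simp: abs_mult)
  then show ?thesis by (simp add: sum_distrib_right)
qed

lemma vnorm_le_sum_abs: "vnorm n u \<le> (\<Sum>j<n. \<bar>u j\<bar>)"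
  unfolding vnorm_L2 by (rule L2_set_le_sum_abs)

text \<open>A crude entrywise bound is enough for its uses: boundedness of the set under the
  supremum in \<open>opnorm\<close>, vectors of norm zero, and Lipschitz dependence on the
  entries.\<close>

lemma vnorm_matrix_le: "vnorm n (\<lambda>j. \<Sum>k<n. A j k * v k) \<le> (\<Sum>j<n. \<Sum>k<n. \<bar>A j k\<bar>) * vnorm n v"
proof -
  have "(\<Sum>j<n. \<bar>\<Sum>k<n. A j k * v k\<bar>) \<le> (\<Sum>j<n. (\<Sum>k<n. \<bar>A j k\<bar>) * vnorm n v)"
    by (intro sum_mono abs_sum_mult_le_vnorm)
  then show ?thesis
    using vnorm_le_sum_abs[of n "\<lambda>j. \<Sum>k<n. A j k * v k"] by (simp only: sum_distrib_right)
qed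

section \<open>The operator norm as a continuous function of the entries\<close>

lemma opnorm_bdd: "bdd_above {vnorm n (\<lambda>j. \<Sum>k<n. A j k * v k) | v. vnorm n v \<le> 1}"
proof (rule bdd_aboveI)
  fix x assume "x \<in> {vnorm n (\<lambda>j. \<Sum>k<n. A j k * v k) | v. vnorm n v \<le> 1}"
  then obtain v where v: "x = vnorm n (\<lambda>j. \<Sum>k<n. A j k * v k)" "vnorm n v \<le> 1" by auto
  have "(\<Sum>j<n. \<Sum>k<n. \<bar>A j k\<bar>) * vnorm n v \<le> (\<Sum>j<n. \<Sum>k<n. \<bar>A j k\<bar>) * 1"
    using v by (intro mult_left_mono) (auto simp: sum_nonneg)
  then show "x \<le> (\<Sum>j<n. \<Sum>k<n. \<bar>A j k\<bar>)" using vnorm_matrix_le[of n A v] v by simp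
qed

lemma vnorm_zero: "vnorm n (\<lambda>_. 0) = 0" by (simp add: vnorm_def)

lemma opnorm_upper: "vnorm n v \<le> 1 \<Longrightarrow> vnorm n (\<lambda>j. \<Sum>k<n. A j k * v k) \<le> opnorm n A"
  unfolding opnorm_def by (intro cSup_upper opnorm_bdd) auto

lemma opnorm_least:
  assumes "\<And>v. vnorm n v \<le> 1 \<Longrightarrow> vnorm n (\<lambda>j. \<Sum>k<n. A j k * v k) \<le> c"
  shows "opnorm n A \<le> c"
  unfolding opnorm_def
  by (rule cSup_least) (use assms in \<open>auto intro!: exI[of _ "\<lambda>_. 0"] simp: vnorm_zero\<close>)

lemma opnorm_nonneg: "0 \<le> opnorm n A"
  using opnorm_upper[of n "\<lambda>_. 0" A] by (simp add: vnorm_zero)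

lemma opnorm_bound: "vnorm n (\<lambda>j. \<Sum>k<n. A j k * v k) \<le> opnorm n A * vnorm n v"
proof (cases "vnorm n v = 0")
  case True
  then show ?thesis using vnorm_matrix_le[of n A v] by simp
next
  case False
  define c where "c = vnorm n v"
  have c: "c > 0" using False vnorm_nonneg[of n v] unfolding c_def by linarith
  have 1: "vnorm n (\<lambda>j. (1/c) * v j) \<le> 1" using c by (subst vnorm_scale) (simp flip: c_def)
  have "(\<lambda>j. \<Sum>k<n. A j k * ((1/c) * v k)) = (\<lambda>j. (1/c) * (\<Sum>k<n. A j k * v k))"
    by (simp add: sum_distrib_left mult_ac)
  then have "(1/c) * vnorm n (\<lambda>j. \<Sum>k<n. A j k * v k) \<le> opnorm n A"
    using opnorm_upper[OF 1, of A] c by (simp add: vnorm_scale del: times_divide_eq_left)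
  then show ?thesis using c by (simp add: c_def field_simps)
qed

lemma opnorm_lipschitz: "\<bar>opnorm n A - opnorm n B\<bar> \<le> (\<Sum>j<n. \<Sum>k<n. \<bar>A j k - B j k\<bar>)"
proof -
  have *: "opnorm n A \<le> opnorm n B + (\<Sum>j<n. \<Sum>k<n. \<bar>A j k - B j k\<bar>)" for A B
  proof (rule opnorm_least)
    fix v assume v: "vnorm n v \<le> 1"
    have eq: "(\<lambda>j. \<Sum>k<n. A j k * v k) = (\<lambda>j. (\<Sum>k<n. B j k * v k) + (\<Sum>k<n. (A j k - B j k) * v k))"
      by (simp add: sum.distrib[symmetric] algebra_simps)
    have "vnorm n (\<lambda>j. \<Sum>k<n. (A j k - B j k) * v k) \<le> (\<Sum>j<n. \<Sum>k<n. \<bar>A j k - B j k\<bar>) * 1"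
      by (rule order_trans[OF vnorm_matrix_le]) (intro mult_left_mono v sum_nonneg abs_ge_zero)
    then show "vnorm n (\<lambda>j. \<Sum>k<n. A j k * v k) \<le> opnorm n B + (\<Sum>j<n. \<Sum>k<n. \<bar>A j k - B j k\<bar>)"
      unfolding eq
      using vnorm_triangle[of n "\<lambda>j. \<Sum>k<n. B j k * v k" "\<lambda>j. \<Sum>k<n. (A j k - B j k) * v k"]
        opnorm_upper[OF v, of B] by linarith
  qed
  have "(\<Sum>j<n. \<Sum>k<n. \<bar>A j k - B j k\<bar>) = (\<Sum>j<n. \<Sum>k<n. \<bar>B j k - A j k\<bar>)"
    by (simp add: abs_minus_commute)
  then show ?thesis using *[of A B] *[of B A] by linarith
qed

text \<open>A supremum over uncountably many vectors is not measurable for free; continuity in the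
  entries is what \<open>measurable_opnorm\<close> rests on.\<close>

lemma continuous_on_opnorm: "continuous_on UNIV (opnorm n)"
  unfolding continuous_on_def
proof
  fix A :: "nat \<Rightarrow> nat \<Rightarrow> real"
  have c: "continuous_on UNIV (\<lambda>B :: nat \<Rightarrow> nat \<Rightarrow> real. B j k)" for j k
  proof -
    have "continuous_on UNIV (\<lambda>B :: nat \<Rightarrow> nat \<Rightarrow> real. B j)"
      by (rule continuous_on_product_coordinates)
    then show ?thesis
      by (rule continuous_on_compose2[where g = "\<lambda>z. z k" and t = UNIV, rotated]) auto
  qed
  have "continuous_on UNIV (\<lambda>B. \<Sum>j<n. \<Sum>k<n. \<bar>B j k - A j k\<bar>)"
    by (intro continuous_intros c)
  then have "((\<lambda>B. \<Sum>j<n. \<Sum>k<n. \<bar>B j k - A j k\<bar>) \<longlongrightarrow> (\<Sum>j<n. \<Sum>k<n. \<bar>A j k - A j k\<bar>)) (at A)"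
    unfolding continuous_on_def by (rule bspec) simp
  then have "((\<lambda>B. \<Sum>j<n. \<Sum>k<n. \<bar>B j k - A j k\<bar>) \<longlongrightarrow> 0) (at A)" by simp
  then have "((\<lambda>B. opnorm n B - opnorm n A) \<longlongrightarrow> 0) (at A)"
    by (rule Lim_null_comparison[rotated]) (use opnorm_lipschitz in auto)
  then show "(opnorm n \<longlongrightarrow> opnorm n A) (at A within UNIV)"
    by (simp add: LIM_zero_iff)
qed

lemma opnorm_cong:
  assumes "\<And>j k. j < n \<Longrightarrow> k < n \<Longrightarrow> A j k = B j k"
  shows "opnorm n A = opnorm n B"
proof -
  have "vnorm n (\<lambda>j. \<Sum>k<n. A j k * v k) = vnorm n (\<lambda>j. \<Sum>k<n. B j k * v k)" for v
    using assms by (intro vnorm_cong) simp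
  then show ?thesis by (simp add: opnorm_def)
qed

lemma measurable_opnorm:
  assumes "\<And>j k. j < n \<Longrightarrow> k < n \<Longrightarrow> (\<lambda>w. A w j k) \<in> borel_measurable M"
  shows "(\<lambda>w. opnorm n (A w)) \<in> borel_measurable M"
proof -
  \<comment> \<open>Entries outside the n by n block are set to 0: measurability into the function
    space is checked at every pair of indices, while the assumption covers the block only.\<close>
  let ?A = "\<lambda>w j k. if j < n \<and> k < n then A w j k else 0"
  have "(\<lambda>w. ?A w j k) \<in> borel_measurable M" for j k
    using assms by (cases "j < n \<and> k < n") auto
  then have "?A \<in> borel_measurable M"
    by (intro measurable_coordinatewise_then_product)
  then have "(\<lambda>w. opnorm n (?A w)) \<in> borel_measurable M"
    by (rule borel_measurable_continuous_on[OF continuous_on_opnorm])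
  also have "(\<lambda>w. opnorm n (?A w)) = (\<lambda>w. opnorm n (A w))"
    by (intro ext opnorm_cong) simp
  finally show ?thesis .
qed

lemma sum_id_minus: "j < n \<Longrightarrow> (\<Sum>k<n. id_minus e A j k * x k) = x j - e * (\<Sum>k<n. A j k * x k)"
proof -
  assume j: "j < n"
  have "id_minus e A j k * x k = (if k = j then x k else 0) - e * (A j k * x k)" for k
    by (simp add: id_minus_def algebra_simps)
  then show ?thesis using j by (simp add: sum_subtractf sum_distrib_left)
qed

text \<open>Unrolling the recursion weights the error made at time s by the operator norms of all
  later times. The most recent error carries the empty product, which is the summand 1 in
  \<open>Mfun\<close>; the other products run over final segments of times and occur in the sum
  under the maximum.\<close>

lemma linear_recursion_bound:
  fixes \<Delta> e :: "nat \<Rightarrow> nat \<Rightarrow> real"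
  assumes init: "\<And>j. j < n \<Longrightarrow> \<Delta> 0 j = 0"
    and step: "\<And>r j. r < t \<Longrightarrow> j < n \<Longrightarrow>
      \<Delta> (Suc r) j = (\<Sum>k<n. id_minus (\<eta> r) (A r) j k * \<Delta> r k) - \<eta> r * e r j"
    and eta: "\<And>r. r < t \<Longrightarrow> 0 \<le> \<eta> r \<and> \<eta> r \<le> h"
    and err: "\<And>r. r < t \<Longrightarrow> vnorm n (e r) \<le> E"
    and t: "1 \<le> t"
  shows "vnorm n (\<Delta> t) \<le> h * E * Mfun n \<eta> A (t - 1)"
proof -
  define f where "f r = opnorm n (id_minus (\<eta> r) (A r))" for r
  have f0: "0 \<le> f r" for r unfolding f_def by (rule opnorm_nonneg)
  have E0: "0 \<le> E" using err[of 0] t vnorm_nonneg[of n "e 0"] by linarith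
  have h0: "0 \<le> h" using eta[of 0] t by linarith
  have main: "r \<le> t \<Longrightarrow> vnorm n (\<Delta> r) \<le> h * E * (\<Sum>s<r. \<Prod>q\<in>{Suc s..<r}. f q)" for r
  proof (induction r)
    case 0
    then show ?case using init by (simp add: vnorm_def)
  next
    case (Suc r)
    then have r: "r < t" by simp
    have "vnorm n (\<Delta> (Suc r)) = vnorm n (\<lambda>j. (\<Sum>k<n. id_minus (\<eta> r) (A r) j k * \<Delta> r k) - \<eta> r * e r j)"
      by (intro vnorm_cong step r)
    also have "\<dots> \<le> vnorm n (\<lambda>j. \<Sum>k<n. id_minus (\<eta> r) (A r) j k * \<Delta> r k) + vnorm n (\<lambda>j. \<eta> r * e r j)"
      by (rule vnorm_diff)
    also have "\<dots> \<le> f r * vnorm n (\<Delta> r) + \<eta> r * vnorm n (e r)"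
      using eta[OF r] by (simp add: vnorm_scale f_def opnorm_bound)
    also have "\<dots> \<le> f r * (h * E * (\<Sum>s<r. \<Prod>q\<in>{Suc s..<r}. f q)) + h * E"
      using Suc r eta[OF r] err[OF r] f0 E0 h0 by (intro add_mono mult_left_mono mult_mono) auto
    also have "f r * (h * E * (\<Sum>s<r. \<Prod>q\<in>{Suc s..<r}. f q)) = h * E * (\<Sum>s<r. \<Prod>q\<in>{Suc s..<Suc r}. f q)"
      by (simp add: sum_distrib_left prod.atLeastLessThan_Suc mult_ac)
    finally show ?case by (simp add: algebra_simps)
  qed
  obtain \<tau> where \<tau>: "t = Suc \<tau>" using t by (cases t) auto
  have "(\<Sum>s<t. \<Prod>q\<in>{Suc s..<t}. f q) = (\<Sum>s<\<tau>. \<Prod>q\<in>{Suc s..\<tau>}. f q) + 1"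
    by (simp add: \<tau> atLeastLessThanSuc_atLeastAtMost)
  \<comment> \<open>After the shift from s to s + 1 the products start at 1 or later; the product
    starting at 0 is then added, being nonnegative.\<close>
  also have "(\<Sum>s<\<tau>. \<Prod>q\<in>{Suc s..\<tau>}. f q) = (\<Sum>s\<in>{Suc 0..\<tau>}. \<Prod>q\<in>{s..\<tau>}. f q)"
  proof -
    have "Suc ` {..<\<tau>} = {Suc 0..\<tau>}"
      by (simp add: lessThan_atLeast0 image_Suc_atLeastLessThan atLeastLessThanSuc_atLeastAtMost)
    then show ?thesis by (subst sum.reindex[of Suc "{..<\<tau>}", symmetric, unfolded o_def, simplified]) auto
  qed
  also have "\<dots> \<le> (\<Sum>s\<in>{0..\<tau>}. \<Prod>q\<in>{s..\<tau>}. f q)"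
    by (intro sum_mono2) (auto intro!: prod_nonneg f0)
  also have "\<dots> \<le> Max ((\<lambda>\<tau>. \<Sum>s\<in>{0..\<tau>}. \<Prod>r\<in>{s..\<tau>}. f r) ` {0..\<tau>})"
    by (intro Max_ge) auto
  finally have "(\<Sum>s<t. \<Prod>q\<in>{Suc s..<t}. f q) \<le> Mfun n \<eta> A (t - 1)"
    by (simp add: Mfun_def f_def \<tau>)
  then have "h * E * (\<Sum>s<t. \<Prod>q\<in>{Suc s..<t}. f q) \<le> h * E * Mfun n \<eta> A (t - 1)"
    using h0 E0 by (intro mult_left_mono) auto
  then show ?thesis using main[of t] by linarith
qed

lemma Mfun_ge_1: "1 \<le> Mfun n \<eta> A t"
proof -
  have "(\<Sum>s\<in>{0..t}. \<Prod>r\<in>{s..t}. opnorm n (id_minus (\<eta> r) (A r)))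
      \<le> Max ((\<lambda>\<tau>. \<Sum>s\<in>{0..\<tau>}. \<Prod>r\<in>{s..\<tau>}. opnorm n (id_minus (\<eta> r) (A r))) ` {0..t})"
    by (intro Max_ge) auto
  moreover have "0 \<le> (\<Sum>s\<in>{0..t}. \<Prod>r\<in>{s..t}. opnorm n (id_minus (\<eta> r) (A r)))"
    by (intro sum_nonneg prod_nonneg opnorm_nonneg)
  ultimately show ?thesis unfolding Mfun_def by linarith
qed

lemma measurable_Mfun:
  assumes "\<And>r j k. j < n \<Longrightarrow> k < n \<Longrightarrow> (\<lambda>w. A w r j k) \<in> borel_measurable M"
  shows "(\<lambda>w. Mfun n \<eta> (A w) t) \<in> borel_measurable M"
proof -
  have [measurable]: "(\<lambda>w. opnorm n (id_minus (\<eta> r) (A w r))) \<in> borel_measurable M" for r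
    unfolding id_minus_def by (intro measurable_opnorm borel_measurable_diff borel_measurable_times assms) auto
  show ?thesis unfolding Mfun_def by measurable
qed

subsection \<open>Families of mixed partial derivatives\<close>

text \<open>The symmetric interval covers positive, negative and zero increments at once; this is
  Maclaurin's formula of order one.\<close>

lemma signed_mvt:
  fixes f f' :: "real \<Rightarrow> real"
  assumes "\<And>t. \<bar>t\<bar> \<le> \<bar>h\<bar> \<Longrightarrow> (f has_real_derivative f' t) (at t)"
  obtains t where "\<bar>t\<bar> \<le> \<bar>h\<bar>" "f h - f 0 = h * f' t"
proof -
  have "\<exists>t. \<bar>t\<bar> \<le> \<bar>h\<bar> \<and> f h = (\<Sum>m<1. (if m = 0 then f else f') 0 / fact m * h ^ m)
      + (if (1::nat) = 0 then f else f') t / fact 1 * h ^ 1"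
    by (rule Maclaurin_bi_le) (use assms in auto)
  then show ?thesis using that by (auto simp: mult.commute)
qed

text \<open>Only \<open>\<partial>\<^sub>1\<partial>\<^sub>2 g\<close> is assumed to exist: the double difference quotient is a value of
  \<open>\<partial>\<^sub>1\<partial>\<^sub>2 g\<close> by two applications of the mean value theorem.\<close>

lemma peano_schwarz:
  fixes g g1 g2 g12 :: "real \<Rightarrow> real \<Rightarrow> real"
  assumes d1: "\<And>x z. ((\<lambda>x. g x z) has_real_derivative g1 x z) (at x)"
    and d2: "\<And>x z. ((\<lambda>z. g x z) has_real_derivative g2 x z) (at z)"
    and d12: "\<And>x z. ((\<lambda>x. g2 x z) has_real_derivative g12 x z) (at x)"
    and cont: "continuous_on UNIV (\<lambda>y. g12 (fst y) (snd y))"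
  shows "((\<lambda>z. g1 x z) has_real_derivative g12 x z) (at z)"
  unfolding has_field_derivative_def[symmetric] DERIV_def LIM_eq
proof (intro allI impI)
  fix r :: real assume r: "r > 0"
  have "continuous (at (x, z)) (\<lambda>y. g12 (fst y) (snd y))"
    using cont by (simp add: continuous_on_eq_continuous_at)
  then obtain d where d: "d > 0"
    and dd: "\<And>y. dist y (x, z) < d \<Longrightarrow> \<bar>g12 (fst y) (snd y) - g12 x z\<bar> < r / 2"
    unfolding continuous_at_eps_delta using r
    by (metis dist_real_def fst_conv half_gt_zero snd_conv)
  have near: "\<bar>g12 (x + a) (z + b) - g12 x z\<bar> < r / 2" if "\<bar>a\<bar> < d / 2" "\<bar>b\<bar> < d / 2" for a b
  proof -
    have "dist (x + a, z + b) (x, z) \<le> \<bar>a\<bar> + \<bar>b\<bar>"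
      by (simp add: dist_Pair_Pair dist_real_def sqrt_sum_squares_le_sum_abs)
    then show ?thesis using dd[of "(x + a, z + b)"] that by simp
  qed
  show "\<exists>s>0. \<forall>k. k \<noteq> 0 \<and> norm (k - 0) < s \<longrightarrow>
      norm ((g1 x (z + k) - g1 x z) / k - g12 x z) < r"
  proof (intro exI[of _ "d / 2"] conjI allI impI)
    fix k :: real assume k: "k \<noteq> 0 \<and> norm (k - 0) < d / 2"
    have est: "\<bar>((g (x + h) (z + k) - g x (z + k)) / h - (g (x + h) z - g x z) / h) / k - g12 x z\<bar> \<le> r / 2"
      if h: "h \<noteq> 0" "\<bar>h\<bar> < d / 2" for h
    proof -
      obtain t where t: "\<bar>t\<bar> \<le> \<bar>k\<bar>"
        "(g (x + h) (z + k) - g x (z + k)) - (g (x + h) (z + 0) - g x (z + 0))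
          = k * (g2 (x + h) (z + t) - g2 x (z + t))"
        by (rule signed_mvt[of k "\<lambda>k. g (x + h) (z + k) - g x (z + k)"
              "\<lambda>k. g2 (x + h) (z + k) - g2 x (z + k)"])
           (auto intro!: DERIV_diff DERIV_shift[THEN iffD1] d2 simp: add.commute[of z])
      obtain u where u: "\<bar>u\<bar> \<le> \<bar>h\<bar>" "g2 (x + h) (z + t) - g2 (x + 0) (z + t) = h * g12 (x + u) (z + t)"
        by (rule signed_mvt[of h "\<lambda>h. g2 (x + h) (z + t)" "\<lambda>h. g12 (x + h) (z + t)"])
           (auto intro!: DERIV_shift[THEN iffD1] d12 simp: add.commute[of x])
      have "((g (x + h) (z + k) - g x (z + k)) / h - (g (x + h) z - g x z) / h) / k = g12 (x + u) (z + t)"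
        using t u h k by (simp add: diff_divide_distrib[symmetric])
      then show ?thesis using near[of u t] t u h k by auto
    qed
    \<comment> \<open>With k fixed, letting h tend to 0 turns the inner quotients into values of
      \<open>g1\<close>. Limits preserve only the weak inequality, so the estimate was made with r /
      2.\<close>
    have lim: "((\<lambda>h. \<bar>((g (x + h) (z + k) - g x (z + k)) / h - (g (x + h) z - g x z) / h) / k - g12 x z\<bar>)
        \<longlongrightarrow> \<bar>(g1 x (z + k) - g1 x z) / k - g12 x z\<bar>) (at 0)"
      using d1[of "z + k" x] d1[of z x] k unfolding DERIV_def by (intro tendsto_intros) auto
    have "\<bar>(g1 x (z + k) - g1 x z) / k - g12 x z\<bar> \<le> r / 2"
    proof (rule tendsto_upperbound[OF lim])
      show "\<forall>\<^sub>F h in at 0. \<bar>((g (x + h) (z + k) - g x (z + k)) / h - (g (x + h) z - g x z) / h) / k - g12 x z\<bar> \<le> r / 2"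
        unfolding eventually_at by (rule exI[of _ "d / 2"]) (use d est in auto)
    qed simp
    then show "norm ((g1 x (z + k) - g1 x z) / k - g12 x z) < r" using r by simp
  qed (use d in auto)
qed

text \<open>Existence of partial derivatives alone gives no chain rule; continuity of
  \<open>g2\<close> upgrades them to a total derivative, which is then composed with the
  line.\<close>

lemma DERIV_along_line:
  fixes g g1 g2 :: "real \<Rightarrow> real \<Rightarrow> real"
  assumes d1: "\<And>x z. ((\<lambda>x. g x z) has_real_derivative g1 x z) (at x)"
    and d2: "\<And>x z. ((\<lambda>z. g x z) has_real_derivative g2 x z) (at z)"
    and cont: "continuous_on UNIV (\<lambda>y. g2 (fst y) (snd y))"
  shows "((\<lambda>t. g (x + t * \<alpha>) (z + t * \<beta>)) has_real_derivative
     \<alpha> * g1 (x + t * \<alpha>) (z + t * \<beta>) + \<beta> * g2 (x + t * \<alpha>) (z + t * \<beta>)) (at t)"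
proof -
  have fy: "((\<lambda>y. g x y) has_derivative blinfun_apply (blinfun_mult_right (g2 x y))) (at y within UNIV)" for x y
    using d2[of x y] by (simp add: has_field_derivative_def)
  have c: "continuous (at (x, y) within UNIV \<times> UNIV) (\<lambda>(x, y). blinfun_mult_right (g2 x y))" for x y
  proof -
    have "continuous_on UNIV (\<lambda>y. blinfun_mult_right (g2 (fst y) (snd y)))"
      by (intro bounded_linear.continuous_on[OF bounded_linear_blinfun_mult_right] cont)
    then show ?thesis by (simp add: continuous_on_eq_continuous_at case_prod_beta')
  qed
  have tot: "((\<lambda>(x, y). g x y) has_derivative (\<lambda>(tx, ty). g1 x y * tx + g2 x y * ty)) (at (x, y))" for x y
    using has_derivative_partialsI[OF d1[of y x, unfolded has_field_derivative_def] fy c] by simp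
  have "((\<lambda>t. (x + t * \<alpha>, z + t * \<beta>)) has_derivative (\<lambda>h. (h * \<alpha>, h * \<beta>))) (at t)"
    by (auto intro!: derivative_eq_intros)
  from has_derivative_eq_rhs[OF has_derivative_compose[OF this tot],
      of "(*) (\<alpha> * g1 (x + t * \<alpha>) (z + t * \<beta>) + \<beta> * g2 (x + t * \<alpha>) (z + t * \<beta>))"]
  show ?thesis unfolding has_field_derivative_def by (simp add: fun_eq_iff algebra_simps)
qed

section \<open>Directional derivatives and Taylor expansions\<close>

lemma sum_lessThan_2: "(\<Sum>m<(2::nat). F m) = (F 0 + F 1 :: real)"
  by (simp add: eval_nat_numeral)

lemma sum_lessThan_3: "(\<Sum>m<(3::nat). F m) = (F 0 + F 1 + F 2 :: real)"
  by (simp add: eval_nat_numeral)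

text \<open>The k-th power of the operator \<alpha> d1 + \<beta> d2 applied to \<open>f a b\<close>,
  written as a shift of indices so that the definition itself differentiates nothing;
  \<open>dir_deriv_deriv\<close> supplies the link to derivatives along a line.\<close>

primrec dir_deriv :: "(nat \<Rightarrow> nat \<Rightarrow> real \<Rightarrow> real \<Rightarrow> real) \<Rightarrow> real \<Rightarrow> real \<Rightarrow> nat \<Rightarrow> nat \<Rightarrow> nat
    \<Rightarrow> real \<Rightarrow> real \<Rightarrow> real" where
  "dir_deriv f \<alpha> \<beta> 0 a b = f a b"
| "dir_deriv f \<alpha> \<beta> (Suc k) a b = (\<lambda>x z. \<alpha> * dir_deriv f \<alpha> \<beta> k (Suc a) b x z + \<beta> * dir_deriv f \<alpha> \<beta> k a (Suc b) x z)"

text \<open>Total order 4 is what a third-order expansion of a first derivative consumes. The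
  natural number \<open>P\<close> as growth exponent keeps all majorants polynomial.\<close>

locale smooth_family =
  fixes f :: "nat \<Rightarrow> nat \<Rightarrow> real \<Rightarrow> real \<Rightarrow> real" and B :: real and P :: nat
  assumes cont: "a + b \<le> 4 \<Longrightarrow> continuous_on UNIV (\<lambda>y. f a b (fst y) (snd y))"
    and growth: "a + b \<le> 4 \<Longrightarrow> \<bar>f a b x z\<bar> \<le> B * (1 + \<bar>x\<bar> + \<bar>z\<bar>) ^ P"
    and deriv1: "a + b < 4 \<Longrightarrow> ((\<lambda>x. f a b x z) has_real_derivative f (Suc a) b x z) (at x)"
    and deriv2: "a + b < 4 \<Longrightarrow> ((\<lambda>z. f a b x z) has_real_derivative f a (Suc b) x z) (at z)"
begin

lemma B_nonneg: "0 \<le> B"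
  using growth[of 0 0 0 0] by simp

lemma dir_deriv_continuous: "k + a + b \<le> 4 \<Longrightarrow> continuous_on UNIV (\<lambda>y. dir_deriv f \<alpha> \<beta> k a b (fst y) (snd y))"
  by (induction k arbitrary: a b) (auto intro!: continuous_intros cont)

lemma dir_deriv_growth:
  "k + a + b \<le> 4 \<Longrightarrow> \<bar>dir_deriv f \<alpha> \<beta> k a b x z\<bar> \<le> (\<bar>\<alpha>\<bar> + \<bar>\<beta>\<bar>) ^ k * (B * (1 + \<bar>x\<bar> + \<bar>z\<bar>) ^ P)"
proof (induction k arbitrary: a b)
  case (Suc k)
  let ?c = "(\<bar>\<alpha>\<bar> + \<bar>\<beta>\<bar>) ^ k * (B * (1 + \<bar>x\<bar> + \<bar>z\<bar>) ^ P)"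
  have "\<bar>dir_deriv f \<alpha> \<beta> (Suc k) a b x z\<bar> \<le> \<bar>\<alpha>\<bar> * \<bar>dir_deriv f \<alpha> \<beta> k (Suc a) b x z\<bar> + \<bar>\<beta>\<bar> * \<bar>dir_deriv f \<alpha> \<beta> k a (Suc b) x z\<bar>"
    by (simp only: dir_deriv.simps abs_triangle_ineq abs_mult[symmetric])
  also have "\<dots> \<le> \<bar>\<alpha>\<bar> * ?c + \<bar>\<beta>\<bar> * ?c"
    using Suc by (intro add_mono mult_left_mono) auto
  finally show ?case by (simp add: algebra_simps)
qed (auto simp: growth)

lemma dir_deriv_deriv:
  "k + a + b < 4 \<Longrightarrow> ((\<lambda>t. dir_deriv f \<alpha> \<beta> k a b (x + t * \<alpha>) (z + t * \<beta>)) has_real_derivative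
     dir_deriv f \<alpha> \<beta> (Suc k) a b (x + t * \<alpha>) (z + t * \<beta>)) (at t)"
proof (induction k arbitrary: a b)
  case 0
  show ?case
    unfolding dir_deriv.simps
    by (rule DERIV_along_line[OF deriv1 deriv2 cont]) (use 0 in auto)
next
  case (Suc k)
  show ?case
    unfolding dir_deriv.simps(2)[of f \<alpha> \<beta> k a b] dir_deriv.simps(2)[of f \<alpha> \<beta> "Suc k" a b]
    by (intro DERIV_add DERIV_cmult Suc.IH) (use Suc.prems in auto)
qed

lemma dir_deriv_measurable:
  assumes "k + a + b \<le> 4" "g \<in> borel_measurable M" "h \<in> borel_measurable M"
  shows "(\<lambda>w. dir_deriv f \<alpha> \<beta> k a b (g w) (h w)) \<in> borel_measurable M"
  by (rule borel_measurable_continuous_Pair[OF assms(2,3) dir_deriv_continuous[OF assms(1)]])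

lemma f_measurable:
  assumes "a + b \<le> 4" "g \<in> borel_measurable M" "h \<in> borel_measurable M"
  shows "(\<lambda>w. f a b (g w) (h w)) \<in> borel_measurable M"
  by (rule borel_measurable_continuous_Pair[OF assms(2,3) cont[OF assms(1)]])

text \<open>Taylor expansion along \<open>(\<alpha>, \<beta>)\<close>, arranged so that the terms \<open>h * c\<close> and
  \<open>(h\<^sup>2 - 1) * c\<close> are centred for a standardised \<open>h\<close>.\<close>

lemma stein_expansion:
  assumes R: "\<And>t. \<bar>t\<bar> \<le> \<bar>h\<bar> \<Longrightarrow> 1 + \<bar>x + t * \<alpha>\<bar> + \<bar>z + t * \<beta>\<bar> \<le> R"
  shows "\<bar>h * f 0 0 (x + h * \<alpha>) (z + h * \<beta>) - dir_deriv f \<alpha> \<beta> 1 0 0 (x + h * \<alpha>) (z + h * \<beta>)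
      - h * f 0 0 x z - (h\<^sup>2 - 1) * dir_deriv f \<alpha> \<beta> 1 0 0 x z\<bar>
    \<le> (\<bar>h\<bar> ^ 3 + \<bar>h\<bar>) * ((\<bar>\<alpha>\<bar> + \<bar>\<beta>\<bar>)\<^sup>2 * (B * R ^ P))"
proof -
  let ?G = "\<lambda>k t. dir_deriv f \<alpha> \<beta> k 0 0 (x + t * \<alpha>) (z + t * \<beta>)"
  let ?c = "(\<bar>\<alpha>\<bar> + \<bar>\<beta>\<bar>)\<^sup>2 * (B * R ^ P)"
  have bd: "\<bar>?G 2 t\<bar> \<le> ?c" if "\<bar>t\<bar> \<le> \<bar>h\<bar>" for t
    by (rule order_trans[OF dir_deriv_growth]) (use R[OF that] B_nonneg in \<open>auto intro!: mult_left_mono power_mono\<close>)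
  have "\<exists>t. \<bar>t\<bar> \<le> \<bar>h\<bar> \<and> ?G 0 h = (\<Sum>m<2. ?G m 0 / fact m * h ^ m) + ?G 2 t / fact 2 * h ^ 2"
    by (rule Maclaurin_bi_le) (auto intro!: dir_deriv_deriv simp del: dir_deriv.simps)
  then obtain t1 where t1: "\<bar>t1\<bar> \<le> \<bar>h\<bar>" "?G 0 h = ?G 0 0 + ?G 1 0 * h + ?G 2 t1 / 2 * h\<^sup>2"
    by (auto simp del: dir_deriv.simps simp: sum_lessThan_2)
  have "(?G 1 has_real_derivative ?G 2 t) (at t)" for t
    using dir_deriv_deriv[of 1 0 0 \<alpha> \<beta> x z t] by (simp add: numeral_2_eq_2 del: dir_deriv.simps)
  then obtain t2 where t2: "\<bar>t2\<bar> \<le> \<bar>h\<bar>" "?G 1 h - ?G 1 0 = h * ?G 2 t2"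
    by (rule signed_mvt[of h "?G 1" "?G 2"])
  \<comment> \<open>The first expansion multiplied by h contributes
    \<open>h\<^sup>2 * ?G 1 0\<close>, and the value \<open>?G 1 0\<close> inside
    \<open>?G 1 h\<close> turns its coefficient into \<open>h\<^sup>2 - 1\<close>. Only second-order
    remainders survive.\<close>
  have "h * ?G 0 h - ?G 1 h - h * ?G 0 0 - (h\<^sup>2 - 1) * ?G 1 0 = h ^ 3 / 2 * ?G 2 t1 - h * ?G 2 t2"
    using t1(2) t2(2) by (simp add: algebra_simps power2_eq_square power3_eq_cube del: dir_deriv.simps)
  also have "\<bar>\<dots>\<bar> \<le> \<bar>h ^ 3 / 2\<bar> * \<bar>?G 2 t1\<bar> + \<bar>h\<bar> * \<bar>?G 2 t2\<bar>"
    by (simp only: abs_triangle_ineq4 abs_mult[symmetric])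
  also have "\<dots> \<le> \<bar>h\<bar> ^ 3 * ?c + \<bar>h\<bar> * ?c"
    by (intro add_mono mult_mono bd t1 t2) (auto simp: power_abs)
  finally show ?thesis by (simp add: algebra_simps)
qed

text \<open>The Taylor polynomial is regrouped into a part free of h and two parts that are centred
  for every standardised h. Hence any two standardised laws of h give the same expectation up to the
  cubic remainder.\<close>

lemma lindeberg_expansion:
  assumes ab: "a + b \<le> 1"
    and R: "\<And>t. \<bar>t\<bar> \<le> \<bar>h\<bar> \<Longrightarrow> 1 + \<bar>x + t * \<alpha>\<bar> + \<bar>z + t * \<beta>\<bar> \<le> R"
  shows "\<bar>f a b (x + h * \<alpha>) (z + h * \<beta>) - (f a b x z + dir_deriv f \<alpha> \<beta> 2 a b x z / 2)
      - h * dir_deriv f \<alpha> \<beta> 1 a b x z - (h\<^sup>2 - 1) * (dir_deriv f \<alpha> \<beta> 2 a b x z / 2)\<bar>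
    \<le> \<bar>h\<bar> ^ 3 * ((\<bar>\<alpha>\<bar> + \<bar>\<beta>\<bar>) ^ 3 * (B * R ^ P))"
proof -
  let ?G = "\<lambda>k t. dir_deriv f \<alpha> \<beta> k a b (x + t * \<alpha>) (z + t * \<beta>)"
  let ?c = "(\<bar>\<alpha>\<bar> + \<bar>\<beta>\<bar>) ^ 3 * (B * R ^ P)"
  have bd: "\<bar>?G 3 t\<bar> \<le> ?c" if "\<bar>t\<bar> \<le> \<bar>h\<bar>" for t
    by (rule order_trans[OF dir_deriv_growth]) (use R[OF that] B_nonneg ab in \<open>auto intro!: mult_left_mono power_mono\<close>)
  have "\<exists>t. \<bar>t\<bar> \<le> \<bar>h\<bar> \<and> ?G 0 h = (\<Sum>m<3. ?G m 0 / fact m * h ^ m) + ?G 3 t / fact 3 * h ^ 3"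
    by (rule Maclaurin_bi_le) (use ab in \<open>auto intro!: dir_deriv_deriv simp del: dir_deriv.simps\<close>)
  then obtain t1 where t1: "\<bar>t1\<bar> \<le> \<bar>h\<bar>"
      "?G 0 h = ?G 0 0 + ?G 1 0 * h + ?G 2 0 / 2 * h\<^sup>2 + ?G 3 t1 / 6 * h ^ 3"
    by (auto simp del: dir_deriv.simps simp: sum_lessThan_3 fact_numeral)
  have "?G 0 h - (?G 0 0 + ?G 2 0 / 2) - h * ?G 1 0 - (h\<^sup>2 - 1) * (?G 2 0 / 2) = h ^ 3 * (?G 3 t1 / 6)"
    using t1(2) by (simp add: field_simps del: dir_deriv.simps)
  also have "\<bar>\<dots>\<bar> = \<bar>h\<bar> ^ 3 * (\<bar>?G 3 t1\<bar> / 6)" by (simp add: abs_mult power_abs del: dir_deriv.simps)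
  also have "\<dots> \<le> \<bar>h\<bar> ^ 3 * ?c"
    by (intro mult_left_mono) (use bd[OF t1(1)] in auto)
  finally show ?thesis by simp
qed

end

subsection \<open>Standardised sub-Gaussian product laws\<close>

text \<open>In place of the infimum defining the Orlicz norm, \<open>s\<close> is a scale at which
  the exponential square moment is actually at most 2; one \<open>s\<close> can then serve the
  entries and the Gaussian law together.\<close>

definition subg :: "real \<Rightarrow> real measure \<Rightarrow> bool" where
  "subg s D \<longleftrightarrow> prob_space D \<and> sets D = sets borel \<and>
     integrable D (\<lambda>y. y) \<and> integral\<^sup>L D (\<lambda>y. y) = 0 \<and>
     integrable D (\<lambda>y. y\<^sup>2) \<and> integral\<^sup>L D (\<lambda>y. y\<^sup>2) = 1 \<and>
     integrable D (\<lambda>y. exp (y\<^sup>2 / s\<^sup>2)) \<and> integral\<^sup>L D (\<lambda>y. exp (y\<^sup>2 / s\<^sup>2)) \<le> 2"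

text \<open>Keeping the linear term separate lets it integrate to zero against a centred law. Near 0
  the quadratic Taylor bound decides; beyond -1 and 1 a comparison of y with its square is
  enough.\<close>

lemma exp_le_add_exp_square: "exp (y::real) \<le> y + exp (y\<^sup>2)"
proof -
  have sq: "1 + y\<^sup>2 \<le> exp (y\<^sup>2)" by (rule exp_ge_add_one_self)
  consider "y \<le> -1" | "-1 \<le> y" "y \<le> 0" | "0 \<le> y" "y \<le> 1" | "1 \<le> y" by linarith
  then show ?thesis
  proof cases
    case 1
    then have "0 \<le> y * (y + 1)" by (intro mult_nonpos_nonpos) auto
    then have "0 \<le> y + y\<^sup>2" by (simp add: power2_eq_square algebra_simps)
    then show ?thesis using sq 1 by (smt (verit) exp_le_one_iff)
  next
    case 2
    have "exp y \<le> 1 + y + y\<^sup>2"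
    proof -
      \<comment> \<open>For negative arguments the upper quadratic bound is obtained by inverting
        the lower Taylor bound of exp at -y.\<close>
      define z where "z = - y"
      have "1 + z + z\<^sup>2 / 2 \<le> exp z"
        using exp_lower_Taylor_quadratic[of z] 2 by (simp add: z_def)
      then have "exp y * (1 + z + z\<^sup>2 / 2) \<le> 1"
        by (metis exp_minus exp_gt_zero less_eq_real_def mult_left_mono right_inverse z_def
            add.inverse_inverse exp_not_eq_zero)
      moreover have "1 \<le> (1 - z + z\<^sup>2) * (1 + z + z\<^sup>2 / 2)"
      proof -
        have "(1 - z + z\<^sup>2) * (1 + z + z\<^sup>2 / 2) = 1 + z\<^sup>2 / 2 + z ^ 3 / 2 + z ^ 4 / 2"
          by (simp add: field_simps power2_eq_square power3_eq_cube power4_eq_xxxx)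
        moreover have "0 \<le> z ^ 3" "0 \<le> z ^ 4" using 2 by (auto simp: z_def intro: zero_le_power)
        ultimately show ?thesis using zero_le_power2[of z] by linarith
      qed
      moreover have "0 < 1 + z + z\<^sup>2 / 2" using 2 by (simp add: z_def add_pos_nonneg)
      ultimately have "exp y \<le> 1 - z + z\<^sup>2"
        by (meson mult_le_cancel_right_pos order_trans)
      then show ?thesis by (simp add: z_def)
    qed
    then show ?thesis using sq by linarith
  next
    case 3
    then show ?thesis using exp_bound[of y] sq by linarith
  next
    case 4
    then have "y \<le> y\<^sup>2" by (simp add: power2_eq_square)
    then have "exp y \<le> exp (y\<^sup>2)" by simp
    then show ?thesis using 4 by linarith
  qed
qed

lemma exp_average2: "exp ((a + b) / 2 :: real) \<le> (exp a + exp b) / 2"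
  using convex_onD[OF exp_convex, of "1/2" b a] by (simp add: field_simps)

text \<open>Convexity separates the four summands of the weight \<open>V\<close> introduced later,
  although they are functions of the same random vector and are not independent.\<close>

lemma exp_average4: "exp ((a + b + c + d) / 4 :: real) \<le> (exp a + exp b + exp c + exp d) / 4"
proof -
  have "exp (((a + b) / 2 + (c + d) / 2) / 2) \<le> (exp ((a + b) / 2) + exp ((c + d) / 2)) / 2"
    by (rule exp_average2)
  also have "\<dots> \<le> ((exp a + exp b) / 2 + (exp c + exp d) / 2) / 2"
    by (intro divide_right_mono add_mono exp_average2) simp
  also have "\<dots> = (exp a + exp b + exp c + exp d) / 4" by (simp add: field_simps)
  also have "((a + b) / 2 + (c + d) / 2) / 2 = (a + b + c + d) / 4" by (simp add: field_simps)
  finally show ?thesis .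
qed

lemma power_le_fact_exp:
  assumes "0 \<le> (x::real)" shows "x ^ q \<le> fact q * exp x"
proof -
  have "(\<Sum>n\<in>{q}. x ^ n /\<^sub>R fact n) \<le> (\<Sum>n. x ^ n /\<^sub>R fact n)"
    using assms by (intro sum_le_suminf summable_exp_generic) auto
  then show ?thesis by (simp add: exp_def field_simps)
qed

text \<open>With \<theta> = (a s)^2 in [0,1], the number (a y)^2 is the fraction \<theta> of y^2 /
  s^2, so convexity bounds its exponential by (1 - \<theta>) + \<theta> exp (y^2 / s^2). The
  integral is at most 1 + \<theta>, hence at most exp \<theta>.\<close>

lemma subg_mgf:
  assumes D: "subg s D" and s: "0 < s" and a: "\<bar>a\<bar> * s \<le> 1"
  shows "integrable D (\<lambda>y. exp (a * y))" "integral\<^sup>L D (\<lambda>y. exp (a * y)) \<le> exp ((a * s)\<^sup>2)"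
proof -
  interpret prob_space D using D by (simp add: subg_def)
  have [measurable_cong]: "sets D = sets borel" using D by (simp add: subg_def)
  define \<theta> where "\<theta> = (a * s)\<^sup>2"
  have "\<bar>a * s\<bar> \<le> 1" using a s by (simp add: abs_mult)
  then have th: "0 \<le> \<theta>" "\<theta> \<le> 1" by (simp_all only: \<theta>_def abs_square_le_1 zero_le_power2)
  let ?g = "\<lambda>y. a * y + ((1 - \<theta>) + \<theta> * exp (y\<^sup>2 / s\<^sup>2))"
  have int: "integrable D ?g" and val: "integral\<^sup>L D ?g = (1 - \<theta>) + \<theta> * integral\<^sup>L D (\<lambda>y. exp (y\<^sup>2 / s\<^sup>2))"
    using D by (auto simp: subg_def prob_space)
  have le: "exp (a * y) \<le> ?g y" for y
  proof -
    have "exp ((1 - \<theta>) * 0 + \<theta> * (y\<^sup>2 / s\<^sup>2)) \<le> (1 - \<theta>) * exp 0 + \<theta> * exp (y\<^sup>2 / s\<^sup>2)"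
      using convex_onD[OF exp_convex, of \<theta> 0 "y\<^sup>2 / s\<^sup>2"] th by simp
    moreover have "\<theta> * (y\<^sup>2 / s\<^sup>2) = (a * y)\<^sup>2"
      using s by (simp add: \<theta>_def power_mult_distrib)
    ultimately show ?thesis using exp_le_add_exp_square[of "a * y"] by simp
  qed
  show i: "integrable D (\<lambda>y. exp (a * y))"
    by (rule Bochner_Integration.integrable_bound[OF int]) (auto intro!: AE_I2 intro: order_trans[OF le])
  have "integral\<^sup>L D (\<lambda>y. exp (a * y)) \<le> integral\<^sup>L D ?g"
    by (intro integral_mono i int le)
  also have "\<dots> \<le> (1 - \<theta>) + \<theta> * 2"
    unfolding val using D th by (intro add_left_mono mult_left_mono) (auto simp: subg_def)
  also have "\<dots> \<le> exp \<theta>" using exp_ge_add_one_self[of \<theta>] by linarith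
  finally show "integral\<^sup>L D (\<lambda>y. exp (a * y)) \<le> exp ((a * s)\<^sup>2)" by (simp add: \<theta>_def)
qed

text \<open>The law is constrained at every index, not just below n, because
  \<open>product_prob_space\<close> quantifies over the whole index type.\<close>

locale subg_product =
  fixes n :: nat and s :: real and D :: "nat \<Rightarrow> real measure"
  assumes s_ge_1: "1 \<le> s" and subgD: "\<And>j. subg s (D j)"
begin

sublocale product_prob_space D "{..<n}"
  using subgD by (intro product_prob_spaceI) (simp add: subg_def)

abbreviation "Q \<equiv> Pi\<^sub>M {..<n} D"

lemma sets_D [measurable_cong]: "sets (D j) = sets borel"
  using subgD by (simp add: subg_def)

lemma prob_space_D: "prob_space (D j)"
  using subgD by (simp add: subg_def)

lemma measurable_component [measurable]: "k < n \<Longrightarrow> (\<lambda>z. z k) \<in> borel_measurable Q"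
  using measurable_component_singleton[of k "{..<n}" D] by (simp add: measurable_cong_sets[OF refl sets_D])

lemma measurable_vinner [measurable]: "(\<lambda>z. vinner n z u) \<in> borel_measurable Q"
  unfolding vinner_def by measurable

text \<open>Independence factorises the exponential moment, and the exponents (c u_j s)^2 of the
  factors add up to (c s |u|)^2, which is at most 1. Each factor is admissible in
  \<open>subg_mgf\<close> since a coordinate is at most the norm.\<close>

lemma exp_vinner:
  assumes u: "vnorm n u \<le> N" and N: "1 \<le> N" and c: "\<bar>c\<bar> \<le> 1 / (s * N)"
  shows "integrable Q (\<lambda>z. exp (c * vinner n z u))" "(\<integral>z. exp (c * vinner n z u) \<partial>Q) \<le> exp 1"
proof -
  have cs: "\<bar>c\<bar> * s * N \<le> 1" using c s_ge_1 N by (simp add: field_simps)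
  have k: "\<bar>c * u j\<bar> * s \<le> 1" if "j < n" for j
  proof -
    have "\<bar>c\<bar> * s * \<bar>u j\<bar> \<le> \<bar>c\<bar> * s * N"
      using component_le_vnorm[OF that, of u] u s_ge_1 by (intro mult_left_mono) auto
    then show ?thesis using cs by (simp add: abs_mult mult_ac)
  qed
  have eq: "exp (c * vinner n z u) = (\<Prod>j<n. exp (c * u j * z j))" for z
    by (simp add: vinner_def sum_distrib_left exp_sum mult_ac)
  have i: "integrable (D j) (\<lambda>y. exp (c * u j * y))"
      and v: "integral\<^sup>L (D j) (\<lambda>y. exp (c * u j * y)) \<le> exp ((c * u j * s)\<^sup>2)" if "j < n" for j
    using subg_mgf[OF subgD, of "c * u j" j] k[OF that] s_ge_1 by auto
  show "integrable Q (\<lambda>z. exp (c * vinner n z u))"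
    unfolding eq by (rule product_integrable_prod) (auto intro: i)
  have "(\<integral>z. exp (c * vinner n z u) \<partial>Q) = (\<Prod>j<n. integral\<^sup>L (D j) (\<lambda>y. exp (c * u j * y)))"
    unfolding eq by (rule product_integral_prod) (auto intro: i)
  also have "\<dots> \<le> (\<Prod>j<n. exp ((c * u j * s)\<^sup>2))"
    by (intro prod_mono) (auto intro: v)
  also have "\<dots> = exp ((c * s * vnorm n u)\<^sup>2)"
    by (simp add: exp_sum[symmetric] vnorm_def power_mult_distrib sum_nonneg sum_distrib_left mult_ac)
  also have "\<dots> \<le> exp 1"
  proof -
    have "\<bar>c * s * vnorm n u\<bar> \<le> \<bar>c\<bar> * s * N"
      using u s_ge_1 by (simp add: abs_mult mult_left_mono)
    then have "\<bar>c * s * vnorm n u\<bar> \<le> 1" using cs by linarith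
    then show ?thesis by (simp add: abs_square_le_1)
  qed
  finally show "(\<integral>z. exp (c * vinner n z u) \<partial>Q) \<le> exp 1" .
qed

lemma exp_abs_vinner:
  assumes u: "vnorm n u \<le> N" and N: "1 \<le> N"
  shows "integrable Q (\<lambda>z. exp (\<bar>vinner n z u\<bar> / (s * N)))" "(\<integral>z. exp (\<bar>vinner n z u\<bar> / (s * N)) \<partial>Q) \<le> 6"
proof -
  let ?c = "1 / (s * N)"
  have p: "0 < ?c" using s_ge_1 N by simp
  note a = exp_vinner[OF u N, of ?c] and b = exp_vinner[OF u N, of "- ?c"]
  have le: "exp (\<bar>vinner n z u\<bar> / (s * N)) \<le> exp (?c * vinner n z u) + exp (- ?c * vinner n z u)" for z
    by (cases "0 \<le> vinner n z u") (auto simp: add_increasing add_increasing2)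
  have int: "integrable Q (\<lambda>z. exp (?c * vinner n z u) + exp (- ?c * vinner n z u))"
    using a b p by (intro Bochner_Integration.integrable_add) auto
  show i: "integrable Q (\<lambda>z. exp (\<bar>vinner n z u\<bar> / (s * N)))"
    by (rule Bochner_Integration.integrable_bound[OF int]) (use le in \<open>auto intro!: AE_I2 intro: order_trans\<close>)
  have "(\<integral>z. exp (\<bar>vinner n z u\<bar> / (s * N)) \<partial>Q) \<le> (\<integral>z. exp (?c * vinner n z u) + exp (- ?c * vinner n z u) \<partial>Q)"
    by (intro integral_mono i int le)
  also have "\<dots> = (\<integral>z. exp (?c * vinner n z u) \<partial>Q) + (\<integral>z. exp (- ?c * vinner n z u) \<partial>Q)"
    using a b p by (intro Bochner_Integration.integral_add) auto
  also have "\<dots> \<le> exp 1 + exp 1" using a b p by (intro add_mono) auto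
  also have "\<dots> \<le> 6" using exp_le by linarith
  finally show "(\<integral>z. exp (\<bar>vinner n z u\<bar> / (s * N)) \<partial>Q) \<le> 6" .
qed

text \<open>A single weight for all integrands: each is dominated by a power of \<open>V\<close>, or
  of a sum of two such weights, so that integrability and size reduce to
  \<open>V_moment\<close>.\<close>

definition V :: "nat \<Rightarrow> (nat \<Rightarrow> real) \<Rightarrow> (nat \<Rightarrow> real) \<Rightarrow> (nat \<Rightarrow> real) \<Rightarrow> real" where
  "V k u v z = 1 + \<bar>z k\<bar> + \<bar>vinner n z u\<bar> + \<bar>vinner n z v\<bar>"

lemma V_ge_1: "1 \<le> V k u v z" by (simp add: V_def)

lemma vinner_unit: "k < n \<Longrightarrow> vinner n z (\<lambda>j. if j = k then 1 else 0) = z k"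
  by (simp add: vinner_def if_distrib cong: if_cong)

lemma vnorm_unit: "k < n \<Longrightarrow> vnorm n (\<lambda>j. if j = k then 1 else 0) = 1"
  by (simp add: vnorm_def if_distrib[of "\<lambda>x. x\<^sup>2"] cong: if_cong)

text \<open>The inequality x^q <= q! exp x is applied to x = V / (4 c). This x is at most the mean
  of four terms whose exponentials are integrable; the coordinate \<open>z k\<close> counts as the
  inner product with a unit vector.\<close>

lemma V_moment:
  assumes k: "k < n" and u: "vnorm n u \<le> N" and v: "vnorm n v \<le> N" and N: "1 \<le> N"
  shows "integrable Q (\<lambda>z. V k u v z ^ q)" "(\<integral>z. V k u v z ^ q \<partial>Q) \<le> 6 * fact q * (4 * s * N) ^ q"
proof -
  define c where "c = s * N"
  have c: "1 \<le> c" using s_ge_1 N mult_mono[of 1 s 1 N] by (simp add: c_def)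
  have e: "vnorm n (\<lambda>j. if j = k then 1 else 0) \<le> N" using vnorm_unit[OF k] N by simp
  let ?g = "\<lambda>z. (exp 1 + exp (\<bar>z k\<bar> / c) + exp (\<bar>vinner n z u\<bar> / c) + exp (\<bar>vinner n z v\<bar> / c)) / 4"
  note A = exp_abs_vinner[OF e N, unfolded vinner_unit[OF k], folded c_def]
    and Bu = exp_abs_vinner[OF u N, folded c_def] and Bv = exp_abs_vinner[OF v N, folded c_def]
  have gi: "integrable Q ?g" using A Bu Bv by auto
  have "integral\<^sup>L Q ?g = (exp 1 + (\<integral>z. exp (\<bar>z k\<bar> / c) \<partial>Q) + (\<integral>z. exp (\<bar>vinner n z u\<bar> / c) \<partial>Q)
      + (\<integral>z. exp (\<bar>vinner n z v\<bar> / c) \<partial>Q)) / 4"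
    using A Bu Bv by (simp add: P.prob_space)
  also have "\<dots> \<le> 6" using A Bu Bv exp_le by (simp add: field_simps)
  finally have g6: "integral\<^sup>L Q ?g \<le> 6" .
  have le: "V k u v z ^ q \<le> fact q * (4 * c) ^ q * ?g z" for z
  proof -
    have "(V k u v z / (4 * c)) ^ q \<le> fact q * exp (V k u v z / (4 * c))"
      using V_ge_1[of k u v z] c by (intro power_le_fact_exp) auto
    also have "V k u v z / (4 * c) \<le> (1 + \<bar>z k\<bar> / c + \<bar>vinner n z u\<bar> / c + \<bar>vinner n z v\<bar> / c) / 4"
      using c by (simp add: V_def field_simps)
    then have "exp (V k u v z / (4 * c)) \<le> ?g z"
      by (intro order_trans[OF _ exp_average4]) simp
    then have "fact q * exp (V k u v z / (4 * c)) \<le> fact q * ?g z" by (rule mult_left_mono) simp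
    finally have "V k u v z ^ q / (4 * c) ^ q \<le> fact q * ?g z" by (simp add: power_divide)
    moreover have "0 < (4 * c) ^ q" using c by simp
    ultimately show ?thesis by (simp add: pos_divide_le_eq mult_ac)
  qed
  have gi': "integrable Q (\<lambda>z. fact q * (4 * c) ^ q * ?g z)" using gi by (rule integrable_mult_right)
  show i: "integrable Q (\<lambda>z. V k u v z ^ q)"
  proof (rule Bochner_Integration.integrable_bound[OF gi'])
    show "(\<lambda>z. V k u v z ^ q) \<in> borel_measurable Q" unfolding V_def using k by measurable
    show "AE z in Q. norm (V k u v z ^ q) \<le> norm (fact q * (4 * c) ^ q * ?g z)"
      using le V_ge_1[of k u v] by (intro AE_I2) (smt (verit) real_norm_def zero_le_power)
  qed
  have "(\<integral>z. V k u v z ^ q \<partial>Q) \<le> (\<integral>z. fact q * (4 * c) ^ q * ?g z \<partial>Q)"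
    by (rule integral_mono[OF i gi' le])
  also have "\<dots> = fact q * (4 * c) ^ q * integral\<^sup>L Q ?g" by (rule integral_mult_right_zero)
  also have "\<dots> \<le> fact q * (4 * c) ^ q * 6"
    using g6 c by (intro mult_left_mono) auto
  finally show "(\<integral>z. V k u v z ^ q \<partial>Q) \<le> 6 * fact q * (4 * s * N) ^ q" by (simp add: c_def mult_ac)
qed

lemma V_dominated:
  assumes "k < n" "vnorm n u \<le> N" "vnorm n v \<le> N" "1 \<le> N"
    and F: "F \<in> borel_measurable Q" and le: "\<And>z. \<bar>F z\<bar> \<le> c * V k u v z ^ q"
  shows "integrable Q F" "\<bar>integral\<^sup>L Q F\<bar> \<le> c * (6 * fact q * (4 * s * N) ^ q)"
proof -
  note V = V_moment[OF assms(1-4), of q]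
  \<comment> \<open>At the zero vector the weight equals 1, so the pointwise bound itself forces c
    to be nonnegative.\<close>
  have c: "0 \<le> c"
  proof -
    have "0 \<le> c * V k u v (\<lambda>_. 0) ^ q" using le[of "\<lambda>_. 0"] by linarith
    then show ?thesis using V_ge_1[of k u v "\<lambda>_. 0"] by (simp add: V_def vinner_def)
  qed
  have cV: "integrable Q (\<lambda>z. c * V k u v z ^ q)" using V(1) by (rule integrable_mult_right)
  show i: "integrable Q F"
    by (rule Bochner_Integration.integrable_bound[OF cV F])
      (use le in \<open>auto intro!: AE_I2 intro: order_trans[OF _ abs_ge_self]\<close>)
  have "\<bar>integral\<^sup>L Q F\<bar> \<le> (\<integral>z. \<bar>F z\<bar> \<partial>Q)"
    using integral_norm_bound[of Q F] by simp
  also have "\<dots> \<le> (\<integral>z. c * V k u v z ^ q \<partial>Q)"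
    using i by (intro integral_mono cV le) auto
  also have "\<dots> = c * (\<integral>z. V k u v z ^ q \<partial>Q)" by (rule integral_mult_right_zero)
  also have "\<dots> \<le> c * (6 * fact q * (4 * s * N) ^ q)" by (rule mult_left_mono[OF V(2) c])
  finally show "\<bar>integral\<^sup>L Q F\<bar> \<le> c * (6 * fact q * (4 * s * N) ^ q)" .
qed

lemma integral_coordinate_factor:
  fixes G :: "(nat \<Rightarrow> real) \<Rightarrow> real"
  assumes k: "k < n" and int: "integrable Q (\<lambda>z. \<phi> (z k) * G z)"
    and G: "\<And>z y. G (z(k := y)) = G z"
  shows "(\<integral>z. \<phi> (z k) * G z \<partial>Q) = integral\<^sup>L (D k) \<phi> * integral\<^sup>L (Pi\<^sub>M ({..<n} - {k}) D) G"
proof -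
  have ins: "{..<n} = insert k ({..<n} - {k})" using k by auto
  have "(\<integral>z. \<phi> (z k) * G z \<partial>Q) =
      (\<integral>x. (\<integral>y. \<phi> ((x(k := y)) k) * G (x(k := y)) \<partial>D k) \<partial>Pi\<^sub>M ({..<n} - {k}) D)"
    using product_integral_insert[of "{..<n} - {k}" k "\<lambda>z. \<phi> (z k) * G z"] int
    by (simp only: ins[symmetric]) simp
  then show ?thesis by (simp add: G)
qed

lemma integral_coordinate_centred:
  fixes G :: "(nat \<Rightarrow> real) \<Rightarrow> real"
  assumes k: "k < n" and int: "integrable Q (\<lambda>z. \<phi> (z k) * G z)"
    and G: "\<And>z y. G (z(k := y)) = G z" and "integral\<^sup>L (D k) \<phi> = 0"
  shows "(\<integral>z. \<phi> (z k) * G z \<partial>Q) = 0"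
  using integral_coordinate_factor[OF k int G] assms by simp

text \<open>The right-hand side does not mention the law of coordinate k, so product laws that
  differ only in that coordinate share it.\<close>

lemma integral_not_coordinate:
  fixes G :: "(nat \<Rightarrow> real) \<Rightarrow> real"
  assumes k: "k < n" and int: "integrable Q G" and G: "\<And>z y. G (z(k := y)) = G z"
  shows "integral\<^sup>L Q G = integral\<^sup>L (Pi\<^sub>M ({..<n} - {k}) D) G"
  using integral_coordinate_factor[OF k, of "\<lambda>_. 1" G] int G prob_space.prob_space[OF prob_space_D[of k]]
  by simp

end

subsection \<open>Approximate Stein identity and Lindeberg replacement\<close>

text \<open>The inner product without its k-th term. As a difference it is measurable at once, and
  \<open>rest_update\<close> shows that it ignores the k-th coordinate.\<close>

definition rest :: "nat \<Rightarrow> nat \<Rightarrow> (nat \<Rightarrow> real) \<Rightarrow> (nat \<Rightarrow> real) \<Rightarrow> real" where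
  "rest n k u z = vinner n z u - z k * u k"

lemma rest_update: "k < n \<Longrightarrow> rest n k u (z(k := y)) = rest n k u z"
  unfolding rest_def vinner_def
  by (subst (1 2) sum.remove[of "{..<n}" k]) (auto intro!: sum.cong)

lemma vinner_rest: "vinner n z u = rest n k u z + z k * u k"
  by (simp add: rest_def)

locale subg_smooth = subg_product n s D + smooth_family f B P
  for n :: nat and s :: real and D :: "nat \<Rightarrow> real measure"
  and f :: "nat \<Rightarrow> nat \<Rightarrow> real \<Rightarrow> real \<Rightarrow> real" and B :: real and P :: nat +
  fixes k :: nat and u v :: "nat \<Rightarrow> real" and N :: real
  assumes k: "k < n" and u: "vnorm n u \<le> N" and v: "vnorm n v \<le> N" and N: "1 \<le> N"
begin

abbreviation "\<delta> \<equiv> \<bar>u k\<bar> + \<bar>v k\<bar>"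
abbreviation "W \<equiv> V k u v"

lemma measurable_rest [measurable]: "rest n k u \<in> borel_measurable Q" "rest n k v \<in> borel_measurable Q"
  unfolding rest_def using k by measurable

text \<open>One majorant for the whole segment between \<plusminus>\<open>z k\<close>, which
  contains both the point with the coordinate removed (t = 0) and the full point (t =
  \<open>z k\<close>). Removing and reinserting a term costs 2 N |\<open>z k\<close>| for each of
  the two vectors, whence the factor 4 N.\<close>

lemma line_bound:
  assumes t: "\<bar>t\<bar> \<le> \<bar>z k\<bar>"
  shows "1 + \<bar>rest n k u z + t * u k\<bar> + \<bar>rest n k v z + t * v k\<bar> \<le> 4 * N * W z"
proof -
  have *: "\<bar>rest n k w z + t * w k\<bar> \<le> \<bar>vinner n z w\<bar> + 2 * (N * \<bar>z k\<bar>)" if "vnorm n w \<le> N" for w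
  proof -
    have w: "\<bar>w k\<bar> \<le> N" using component_le_vnorm[OF k, of w] that by simp
    have "\<bar>t * w k\<bar> \<le> \<bar>z k\<bar> * N" "\<bar>z k * w k\<bar> \<le> \<bar>z k\<bar> * N"
      unfolding abs_mult using t w by (auto intro!: mult_mono)
    then show ?thesis unfolding rest_def by (simp add: mult.commute[of N])
  qed
  have "1 + \<bar>vinner n z u\<bar> + \<bar>vinner n z v\<bar> \<le> N * (1 + \<bar>vinner n z u\<bar> + \<bar>vinner n z v\<bar>)"
    using N mult_right_mono[of 1 N "1 + \<bar>vinner n z u\<bar> + \<bar>vinner n z v\<bar>"] by simp
  also have "\<dots> \<le> 4 * N * (1 + \<bar>vinner n z u\<bar> + \<bar>vinner n z v\<bar>)"
    using N by (intro mult_right_mono) auto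
  finally show ?thesis using *[OF u] *[OF v] by (simp add: V_def algebra_simps)
qed

lemma line_bound_rest: "1 + \<bar>rest n k u z\<bar> + \<bar>rest n k v z\<bar> \<le> 4 * N * W z"
  using line_bound[of 0 z] by simp

lemma line_bound_vinner: "1 + \<bar>vinner n z u\<bar> + \<bar>vinner n z v\<bar> \<le> 4 * N * W z"
  using line_bound[of "z k" z] by (simp add: vinner_rest[symmetric])

lemma dir_deriv_W:
  assumes "r + a + b \<le> 4" "1 + \<bar>x\<bar> + \<bar>y\<bar> \<le> 4 * N * W z"
  shows "\<bar>dir_deriv f (u k) (v k) r a b x y\<bar> \<le> \<delta> ^ r * (B * (4 * N) ^ P) * W z ^ P"
proof -
  have "\<bar>dir_deriv f (u k) (v k) r a b x y\<bar> \<le> \<delta> ^ r * (B * (1 + \<bar>x\<bar> + \<bar>y\<bar>) ^ P)"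
    by (rule dir_deriv_growth[OF assms(1)])
  also have "\<dots> \<le> \<delta> ^ r * (B * (4 * N * W z) ^ P)"
    using assms(2) B_nonneg by (intro mult_left_mono power_mono) auto
  finally show ?thesis by (simp add: power_mult_distrib mult_ac)
qed

lemma polynomial_mult_W:
  assumes "\<bar>p\<bar> \<le> W z ^ q" "r + a + b \<le> 4" "1 + \<bar>x\<bar> + \<bar>y\<bar> \<le> 4 * N * W z"
  shows "\<bar>p * dir_deriv f (u k) (v k) r a b x y\<bar> \<le> \<delta> ^ r * (B * (4 * N) ^ P) * W z ^ (q + P)"
proof -
  have "\<bar>p * dir_deriv f (u k) (v k) r a b x y\<bar> \<le> W z ^ q * (\<delta> ^ r * (B * (4 * N) ^ P) * W z ^ P)"
    unfolding abs_mult using V_ge_1[of k u v z]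
    by (intro mult_mono assms dir_deriv_W) auto
  then show ?thesis by (simp add: power_add mult_ac)
qed

lemma coordinate_le_W: "\<bar>z k\<bar> \<le> W z ^ 1" "\<bar>(z k)\<^sup>2 - 1\<bar> \<le> W z ^ 2"
proof -
  show "\<bar>z k\<bar> \<le> W z ^ 1" by (simp add: V_def)
  have "\<bar>z k\<bar>\<^sup>2 \<le> (W z)\<^sup>2" by (intro power_mono) (auto simp: V_def)
  moreover have "1 \<le> (W z)\<^sup>2" using V_ge_1[of k u v z] by (simp add: one_le_power)
  ultimately show "\<bar>(z k)\<^sup>2 - 1\<bar> \<le> W z ^ 2" by (simp add: abs_le_iff) (smt (verit) zero_le_power2)
qed

lemma integrable_polynomial_mult:
  assumes p: "(\<lambda>z. p (z k)) \<in> borel_measurable Q" "\<And>z. \<bar>p (z k)\<bar> \<le> W z ^ q" and r: "r + a + b \<le> 4"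
  shows "integrable Q (\<lambda>z. p (z k) * dir_deriv f (u k) (v k) r a b (rest n k u z) (rest n k v z))"
    and "integrable Q (\<lambda>z. p (z k) * dir_deriv f (u k) (v k) r a b (vinner n z u) (vinner n z v))"
  by (rule V_dominated[OF k u v N _ polynomial_mult_W[OF p(2) r]],
      intro borel_measurable_times p(1) dir_deriv_measurable r measurable_rest measurable_vinner,
      rule line_bound_rest line_bound_vinner)+

lemma integrable_family:
  assumes r: "r + a + b \<le> 4"
  shows "integrable Q (\<lambda>z. dir_deriv f (u k) (v k) r a b (rest n k u z) (rest n k v z))"
    and "integrable Q (\<lambda>z. dir_deriv f (u k) (v k) r a b (vinner n z u) (vinner n z v))"
  using integrable_polynomial_mult[of "\<lambda>_. 1" 0 r a b] r by auto

lemma measurable_polynomials: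
  "(\<lambda>z. z k) \<in> borel_measurable Q" "(\<lambda>z. (z k)\<^sup>2 - 1) \<in> borel_measurable Q"
  using k by measurable

text \<open>The arguments \<open>rest\<close> do not see coordinate k, so the polynomial in
  \<open>z k\<close> integrates separately; mean 0 and variance 1 make both integrals
  vanish.\<close>

lemma centred_terms:
  assumes r: "r + a + b \<le> 4"
  shows "(\<integral>z. z k * dir_deriv f (u k) (v k) r a b (rest n k u z) (rest n k v z) \<partial>Q) = 0"
    and "(\<integral>z. ((z k)\<^sup>2 - 1) * dir_deriv f (u k) (v k) r a b (rest n k u z) (rest n k v z) \<partial>Q) = 0"
proof -
  show "(\<integral>z. z k * dir_deriv f (u k) (v k) r a b (rest n k u z) (rest n k v z) \<partial>Q) = 0"
    by (rule integral_coordinate_centred[OF k integrable_polynomial_mult(1)[OF measurable_polynomials(1) _ r, of 1]])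
      (use coordinate_le_W subgD[of k] in \<open>auto simp: rest_update[OF k] subg_def\<close>)
  show "(\<integral>z. ((z k)\<^sup>2 - 1) * dir_deriv f (u k) (v k) r a b (rest n k u z) (rest n k v z) \<partial>Q) = 0"
    by (rule integral_coordinate_centred[OF k
          integrable_polynomial_mult(1)[of "\<lambda>y. y\<^sup>2 - 1", OF measurable_polynomials(2) _ r, of 2]])
      (use coordinate_le_W subgD[of k] in \<open>auto simp: rest_update[OF k] subg_def prob_space.prob_space[OF prob_space_D]\<close>)
qed

text \<open>The degree \<open>P + 3\<close> combines growth of degree \<open>P\<close> with the
  cubic power of the entry in the Taylor remainders.\<close>

abbreviation "moment_const \<equiv> B * (4 * N) ^ P * (6 * fact (P + 3) * (4 * s * N) ^ (P + 3))"

lemma approximate_stein: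
  "\<bar>(\<integral>z. z k * f 0 0 (vinner n z u) (vinner n z v) \<partial>Q)
     - u k * (\<integral>z. f 1 0 (vinner n z u) (vinner n z v) \<partial>Q)
     - v k * (\<integral>z. f 0 1 (vinner n z u) (vinner n z v) \<partial>Q)\<bar> \<le> 2 * \<delta>\<^sup>2 * moment_const"
proof -
  let ?f = "\<lambda>a b z. f a b (vinner n z u) (vinner n z v)"
  let ?G = "\<lambda>r z. dir_deriv f (u k) (v k) r 0 0 (vinner n z u) (vinner n z v)"
  let ?H = "\<lambda>r z. dir_deriv f (u k) (v k) r 0 0 (rest n k u z) (rest n k v z)"
  let ?E = "\<lambda>z. z k * ?G 0 z - ?G 1 z - z k * ?H 0 z - ((z k)\<^sup>2 - 1) * ?H 1 z"
  have i1: "integrable Q (\<lambda>z. z k * ?G 0 z)" "integrable Q (\<lambda>z. z k * ?H 0 z)"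
    using integrable_polynomial_mult[OF measurable_polynomials(1), of 1 0 0 0] coordinate_le_W by auto
  have i2: "integrable Q (?G 1)" by (rule integrable_family) simp
  have i3: "integrable Q (\<lambda>z. ((z k)\<^sup>2 - 1) * ?H 1 z)"
    by (rule integrable_polynomial_mult(1)[of "\<lambda>y. y\<^sup>2 - 1", OF measurable_polynomials(2), of 2 1 0 0])
      (use coordinate_le_W in auto)
  have "?f a b = (\<lambda>z. dir_deriv f (u k) (v k) 0 a b (vinner n z u) (vinner n z v))" for a b by simp
  then have i4: "integrable Q (?f 1 0)" "integrable Q (?f 0 1)"
    using integrable_family(2)[of 0 1 0] integrable_family(2)[of 0 0 1] by auto
  have pt: "\<bar>?E z\<bar> \<le> 2 * \<delta>\<^sup>2 * (B * (4 * N) ^ P) * W z ^ (P + 3)" for z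
  proof -
    have "\<bar>?E z\<bar> \<le> (\<bar>z k\<bar> ^ 3 + \<bar>z k\<bar>) * (\<delta>\<^sup>2 * (B * (4 * N * W z) ^ P))"
      using stein_expansion[of "z k" "rest n k u z" "u k" "rest n k v z" "v k", OF line_bound]
      by (simp only: vinner_rest[of n z u k] vinner_rest[of n z v k] dir_deriv.simps)
    also have "\<dots> \<le> (2 * W z ^ 3) * (\<delta>\<^sup>2 * (B * (4 * N * W z) ^ P))"
    proof (rule mult_right_mono)
      have "\<bar>z k\<bar> ^ 3 \<le> W z ^ 3" by (intro power_mono) (auto simp: V_def)
      moreover have "\<bar>z k\<bar> \<le> W z ^ 3"
        using coordinate_le_W(1)[of z] power_increasing[of 1 3 "W z"] V_ge_1[of k u v z] by linarith
      ultimately show "\<bar>z k\<bar> ^ 3 + \<bar>z k\<bar> \<le> 2 * W z ^ 3" by linarith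
      show "0 \<le> \<delta>\<^sup>2 * (B * (4 * N * W z) ^ P)"
        using B_nonneg N V_ge_1[of k u v z] by simp
    qed
    finally show ?thesis by (simp add: power_mult_distrib power_add mult_ac)
  qed
  have "\<bar>integral\<^sup>L Q ?E\<bar> \<le> 2 * \<delta>\<^sup>2 * (B * (4 * N) ^ P) * (6 * fact (P + 3) * (4 * s * N) ^ (P + 3))"
    by (rule V_dominated(2)[OF k u v N _ pt])
      (intro borel_measurable_diff borel_measurable_integrable i1 i2 i3)
  also have "integral\<^sup>L Q ?E = (\<integral>z. z k * ?G 0 z \<partial>Q) - integral\<^sup>L Q (?G 1)"
    using i1 i2 i3 centred_terms[of 0 0 0] centred_terms[of 1 0 0]
    by (simp del: dir_deriv.simps)
  \<comment> \<open>The expansion subtracts the first derivative at the full inner products, so its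
    two parts are already the integrals in the claim and no further replacement is required.\<close>
  also have "integral\<^sup>L Q (?G 1) = u k * integral\<^sup>L Q (?f 1 0) + v k * integral\<^sup>L Q (?f 0 1)"
    using i4 by simp
  finally show ?thesis by (simp add: mult_ac diff_diff_eq)
qed

text \<open>The comparison value is an integral over the other coordinates only. Two laws that agree
  off coordinate k therefore share it, and the triangle inequality cancels it.\<close>

lemma lindeberg_step:
  assumes ab: "a + b \<le> 1"
  shows "\<bar>(\<integral>z. f a b (vinner n z u) (vinner n z v) \<partial>Q)
     - (\<integral>z. f a b (rest n k u z) (rest n k v z) + dir_deriv f (u k) (v k) 2 a b (rest n k u z) (rest n k v z) / 2
          \<partial>Pi\<^sub>M ({..<n} - {k}) D)\<bar> \<le> \<delta> ^ 3 * moment_const"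
proof -
  let ?f = "\<lambda>z. f a b (vinner n z u) (vinner n z v)"
  let ?H = "\<lambda>r z. dir_deriv f (u k) (v k) r a b (rest n k u z) (rest n k v z)"
  let ?L = "\<lambda>z. f a b (rest n k u z) (rest n k v z) + ?H 2 z / 2"
  let ?E = "\<lambda>z. ?f z - ?L z - z k * ?H 1 z - ((z k)\<^sup>2 - 1) * (?H 2 z / 2)"
  have i1: "integrable Q ?f" "integrable Q (\<lambda>z. f a b (rest n k u z) (rest n k v z))"
    using integrable_family[of 0 a b] ab by auto
  have i2: "integrable Q (?H 2)" by (rule integrable_family) (use ab in simp)
  have i3: "integrable Q (\<lambda>z. z k * ?H 1 z)"
    by (rule integrable_polynomial_mult(1)[of "\<lambda>y. y", OF measurable_polynomials(1), of 1])
      (use coordinate_le_W ab in auto)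
  have i4: "integrable Q (\<lambda>z. ((z k)\<^sup>2 - 1) * ?H 2 z)"
    by (rule integrable_polynomial_mult(1)[of "\<lambda>y. y\<^sup>2 - 1", OF measurable_polynomials(2), of 2])
      (use coordinate_le_W ab in auto)
  have iL: "integrable Q ?L" using i1 i2 by (simp del: dir_deriv.simps)
  have i5: "integrable Q (\<lambda>z. ((z k)\<^sup>2 - 1) * (?H 2 z / 2))"
    using i4 by (simp del: dir_deriv.simps)
  have pt: "\<bar>?E z\<bar> \<le> \<delta> ^ 3 * (B * (4 * N) ^ P) * W z ^ (P + 3)" for z
  proof -
    have "\<bar>?E z\<bar> \<le> \<bar>z k\<bar> ^ 3 * (\<delta> ^ 3 * (B * (4 * N * W z) ^ P))"
      using lindeberg_expansion[OF ab, of "z k" "rest n k u z" "u k" "rest n k v z" "v k", OF line_bound]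
      by (simp only: vinner_rest[of n z u k] vinner_rest[of n z v k])
    also have "\<dots> \<le> W z ^ 3 * (\<delta> ^ 3 * (B * (4 * N * W z) ^ P))"
    proof (rule mult_right_mono)
      show "\<bar>z k\<bar> ^ 3 \<le> W z ^ 3" by (intro power_mono) (auto simp: V_def)
      show "0 \<le> \<delta> ^ 3 * (B * (4 * N * W z) ^ P)"
        using B_nonneg N V_ge_1[of k u v z] by simp
    qed
    finally show ?thesis by (simp add: power_mult_distrib power_add mult_ac)
  qed
  have "\<bar>integral\<^sup>L Q ?E\<bar> \<le> \<delta> ^ 3 * (B * (4 * N) ^ P) * (6 * fact (P + 3) * (4 * s * N) ^ (P + 3))"
    by (rule V_dominated(2)[OF k u v N _ pt])
      (intro borel_measurable_diff borel_measurable_integrable i1 iL i3 i5)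
  also have "integral\<^sup>L Q ?E = integral\<^sup>L Q ?f - integral\<^sup>L Q ?L"
  proof -
    have "(\<integral>z. ((z k)\<^sup>2 - 1) * (?H 2 z / 2) \<partial>Q) = 0"
      using centred_terms(2)[of 2 a b] ab by (simp del: dir_deriv.simps)
    moreover have "(\<integral>z. z k * ?H 1 z \<partial>Q) = 0" using ab by (intro centred_terms(1)) simp
    ultimately show ?thesis using i1(1) iL i3 i5 by (simp del: dir_deriv.simps add: Bochner_Integration.integral_diff)
  qed
  also have "integral\<^sup>L Q ?L = integral\<^sup>L (Pi\<^sub>M ({..<n} - {k}) D) ?L"
    by (rule integral_not_coordinate[OF k iL]) (simp add: rest_update[OF k] del: dir_deriv.simps)
  finally show ?thesis by (simp add: mult_ac del: dir_deriv.simps)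
qed

end

text \<open>Hybrid laws take \<open>D'\<close> on the first k coordinates and \<open>D\<close> on
  the rest, and the differences of neighbours telescope. The factor 2 comes from using
  \<open>lindeberg_step\<close> once for each neighbour.\<close>

lemma lindeberg_replacement:
  assumes D: "\<And>j. subg s (D j)" and D': "\<And>j. subg s (D' j)" and s: "1 \<le> s"
    and f: "smooth_family f B P" and ab: "a + b \<le> 1"
    and u: "vnorm n u \<le> N" and v: "vnorm n v \<le> N" and N: "1 \<le> N"
  shows "\<bar>(\<integral>z. f a b (vinner n z u) (vinner n z v) \<partial>Pi\<^sub>M {..<n} D)
      - (\<integral>z. f a b (vinner n z u) (vinner n z v) \<partial>Pi\<^sub>M {..<n} D')\<bar>
    \<le> (\<Sum>k<n. 2 * (\<bar>u k\<bar> + \<bar>v k\<bar>) ^ 3 * (B * (4 * N) ^ P * (6 * fact (P + 3) * (4 * s * N) ^ (P + 3))))"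
proof -
  define H where "H k j = (if j < k then D' j else D j)" for k j
  define I where "I M = (\<integral>z. f a b (vinner n z u) (vinner n z v) \<partial>Pi\<^sub>M {..<n} M)" for M
  let ?c = "B * (4 * N) ^ P * (6 * fact (P + 3) * (4 * s * N) ^ (P + 3))"
  have H: "subg s (H k j)" for k j using D D' by (simp add: H_def)
  have step: "\<bar>I (H k) - I (H (Suc k))\<bar> \<le> 2 * (\<bar>u k\<bar> + \<bar>v k\<bar>) ^ 3 * ?c" if k: "k < n" for k
  proof -
    have loc: "subg_smooth n s (H i) f B P k u v N" for i
      using H s f k u v N by (simp add: subg_smooth_def subg_product_def subg_smooth_axioms_def)
    \<comment> \<open>Neighbouring hybrids differ at k only, so their comparison values
      coincide.\<close>
    have "Pi\<^sub>M ({..<n} - {k}) (H k) = Pi\<^sub>M ({..<n} - {k}) (H (Suc k))"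
      by (rule PiM_cong) (auto simp: H_def)
    then show ?thesis
      using subg_smooth.lindeberg_step[OF loc ab, of k] subg_smooth.lindeberg_step[OF loc ab, of "Suc k"]
      by (simp add: I_def del: dir_deriv.simps)
  qed
  have "\<bar>I (H 0) - I (H i)\<bar> \<le> (\<Sum>k<i. 2 * (\<bar>u k\<bar> + \<bar>v k\<bar>) ^ 3 * ?c)" if "i \<le> n" for i
    using that
  proof (induction i)
    case (Suc i)
    then show ?case using step[of i] by simp
  qed simp
  from this[of n] have "\<bar>I (H 0) - I (H n)\<bar> \<le> (\<Sum>k<n. 2 * (\<bar>u k\<bar> + \<bar>v k\<bar>) ^ 3 * ?c)" by simp
  moreover have "H 0 = D" by (simp add: H_def fun_eq_iff)
  \<comment> \<open>The last hybrid equals \<open>D'\<close> only below n, which is all that the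
    product measure reads.\<close>
  moreover have "I (H n) = I D'" unfolding I_def by (intro arg_cong2[of _ _ _ _ "integral\<^sup>L"] PiM_cong refl) (auto simp: H_def)
  ultimately show ?thesis unfolding I_def by simp
qed

subsection \<open>Moments and concentration of sums of independent centred variables\<close>

lemma exp_series_without_linear:
  assumes r: "0 \<le> (r::real)"
  shows "(\<Sum>l\<le>j. if l = 1 then 0 else r ^ l / fact l) \<le> exp r - r"
proof -
  \<comment> \<open>Passing to \<open>Suc j\<close> puts the index 1 in range even for j = 0, so
    that the linear term can be removed uniformly.\<close>
  have "(\<Sum>l\<le>j. if l = 1 then 0 else r ^ l / fact l) \<le> (\<Sum>l\<le>Suc j. if l = 1 then 0 else r ^ l / fact l)"
    using r by (intro sum_mono2) auto
  also have "\<dots> = (\<Sum>l\<le>Suc j. r ^ l / fact l) - r"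
    by (subst (1 2) sum.remove[of "{..Suc j}" 1]) (auto intro!: sum.cong)
  also have "(\<Sum>l\<le>Suc j. r ^ l / fact l) \<le> exp r"
  proof -
    have "(\<Sum>l\<in>{..Suc j}. r ^ l /\<^sub>R fact l) \<le> (\<Sum>l. r ^ l /\<^sub>R fact l)"
      using r by (intro sum_le_suminf summable_exp_generic) auto
    then show ?thesis by (simp add: exp_def field_simps)
  qed
  finally show ?thesis by simp
qed

text \<open>The bound is the coefficientwise majorant of the exponential generating function
  \<open>\<Prod>i. \<Sum>l. E (Z i ^ l) r ^ l / fact l\<close>, whose linear terms vanish by centring.\<close>

lemma (in prob_space) independent_sum_moments:
  fixes Z :: "'i \<Rightarrow> 'a \<Rightarrow> real"
  assumes "finite I" and "indep_vars (\<lambda>_. borel) Z I"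
    and "\<And>i. i \<in> I \<Longrightarrow> expectation (Z i) = 0"
    and "\<And>i l. i \<in> I \<Longrightarrow> l \<le> q \<Longrightarrow> integrable M (\<lambda>w. Z i w ^ l)"
    and "\<And>i l. i \<in> I \<Longrightarrow> l \<le> q \<Longrightarrow> \<bar>expectation (\<lambda>w. Z i w ^ l)\<bar> \<le> b ^ l"
    and b: "0 \<le> b" and r: "0 < r" and j: "j \<le> q"
  shows "integrable M (\<lambda>w. (\<Sum>i\<in>I. Z i w) ^ j) \<and>
    \<bar>expectation (\<lambda>w. (\<Sum>i\<in>I. Z i w) ^ j)\<bar> \<le> fact j * (b / r) ^ j * (exp r - r) ^ card I"
  using assms(1-5) j
\<comment> \<open>All orders j up to q travel through the induction, because adjoining one variable
  expands the power binomially into lower moments of the old sum.\<close>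
proof (induction I arbitrary: j rule: finite_induct)
  case empty
  then show ?case using b r by (cases "j = 0") (auto simp: prob_space power_0_left)
next
  case (insert i I)
  define S where "S w = (\<Sum>i\<in>I. Z i w)" for w
  define X where "X = (exp r - r) ^ card I"
  have er: "0 \<le> exp r - r" using exp_ge_add_one_self[of r] by linarith
  have X: "0 \<le> X" using er by (simp add: X_def)
  have IH: "integrable M (\<lambda>w. S w ^ l)" "\<bar>expectation (\<lambda>w. S w ^ l)\<bar> \<le> fact l * (b / r) ^ l * X"
    if "l \<le> q" for l
    using insert.IH[OF indep_vars_subset[OF insert.prems(1)], of l] insert.prems that
    by (auto simp: S_def X_def)
  have ind: "indep_var borel (Z i) borel S"
    using indep_vars_sum[OF insert.hyps insert.prems(1)] by (simp add: S_def[abs_def])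
  have prod_term: "integrable M (\<lambda>w. Z i w ^ l * S w ^ (j - l))"
      "expectation (\<lambda>w. Z i w ^ l * S w ^ (j - l)) = expectation (\<lambda>w. Z i w ^ l) * expectation (\<lambda>w. S w ^ (j - l))"
    if "l \<le> j" for l
  proof -
    have lq: "l \<le> q" "j - l \<le> q" using that insert.prems(5) by auto
    have "indep_var borel ((\<lambda>y. y ^ l) \<circ> Z i) borel ((\<lambda>y. y ^ (j - l)) \<circ> S)"
      by (rule indep_var_compose[OF ind]) auto
    then have *: "indep_var borel (\<lambda>w. Z i w ^ l) borel (\<lambda>w. S w ^ (j - l))" by (simp add: o_def)
    show "integrable M (\<lambda>w. Z i w ^ l * S w ^ (j - l))"
      by (rule indep_var_integrable[OF * _ IH(1)[OF lq(2)]]) (use insert.prems lq in auto)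
    show "expectation (\<lambda>w. Z i w ^ l * S w ^ (j - l)) = expectation (\<lambda>w. Z i w ^ l) * expectation (\<lambda>w. S w ^ (j - l))"
      by (rule indep_var_lebesgue_integral[OF * _ IH(1)[OF lq(2)]]) (use insert.prems lq in auto)
  qed
  have eq: "(\<Sum>i\<in>insert i I. Z i w) ^ j = (\<Sum>l\<le>j. real (j choose l) * (Z i w ^ l * S w ^ (j - l)))" for w
    using insert.hyps by (simp add: S_def binomial_ring mult.assoc)
  have int: "integrable M (\<lambda>w. (\<Sum>i\<in>insert i I. Z i w) ^ j)"
    unfolding eq by (intro Bochner_Integration.integrable_sum integrable_mult_right prod_term) auto
  have "expectation (\<lambda>w. (\<Sum>i\<in>insert i I. Z i w) ^ j)
      = (\<Sum>l\<le>j. real (j choose l) * (expectation (\<lambda>w. Z i w ^ l) * expectation (\<lambda>w. S w ^ (j - l))))"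
    unfolding eq by (subst Bochner_Integration.integral_sum) (auto intro!: integrable_mult_right sum.cong prod_term simp: prod_term(2))
  also have "\<bar>\<dots>\<bar> \<le> (\<Sum>l\<le>j. fact j * (b / r) ^ j * X * (if l = 1 then 0 else r ^ l / fact l))"
  proof (rule order_trans[OF sum_abs], rule sum_mono)
    fix l assume "l \<in> {..j}"
    then have l: "l \<le> j" by simp
    \<comment> \<open>Centring enters here: the term l = 1 disappears, so each new variable
      multiplies the bound by at most exp r - r instead of exp r.\<close>
    have m: "\<bar>expectation (\<lambda>w. Z i w ^ l)\<bar> \<le> (if l = 1 then 0 else b ^ l)"
      using insert.prems l by auto
    have "\<bar>real (j choose l) * (expectation (\<lambda>w. Z i w ^ l) * expectation (\<lambda>w. S w ^ (j - l)))\<bar>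
      \<le> real (j choose l) * ((if l = 1 then 0 else b ^ l) * (fact (j - l) * (b / r) ^ (j - l) * X))"
      unfolding abs_mult
      by (intro mult_mono m IH(2)) (use insert.prems(5) b r X in auto)
    also have "\<dots> = (fact l * fact (j - l) * real (j choose l)) * (if l = 1 then 0 else b ^ l / fact l) * (b / r) ^ (j - l) * X"
      by simp
    also have "fact l * fact (j - l) * real (j choose l) = fact j"
      using binomial_fact_lemma[OF l] by (metis of_nat_fact of_nat_mult)
    also have "fact j * (if l = 1 then 0 else b ^ l / fact l) * (b / r) ^ (j - l) * X
       = fact j * (b / r) ^ j * X * (if l = 1 then 0 else r ^ l / fact l)"
    proof -
      have "(b / r) ^ j = (b / r) ^ (j - l) * (b / r) ^ l" using l by (simp flip: power_add)
      then have "b ^ l * (b / r) ^ (j - l) = (b / r) ^ j * r ^ l" using r by (simp add: power_divide)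
      then show ?thesis by (simp add: mult_ac)
    qed
    finally show "\<bar>real (j choose l) * (expectation (\<lambda>w. Z i w ^ l) * expectation (\<lambda>w. S w ^ (j - l)))\<bar>
       \<le> fact j * (b / r) ^ j * X * (if l = 1 then 0 else r ^ l / fact l)" .
  qed
  also have "\<dots> = fact j * (b / r) ^ j * X * (\<Sum>l\<le>j. if l = 1 then 0 else r ^ l / fact l)"
    by (simp only: sum_distrib_left)
  also have "\<dots> \<le> fact j * (b / r) ^ j * X * (exp r - r)"
    using exp_series_without_linear[of r j] r b X by (intro mult_left_mono) auto
  finally show ?case using int insert.hyps by (simp add: X_def mult_ac)
qed

text \<open>With r = m^(-1/2) the factor (exp r - r)^m is at most exp (m r^2) = e, so the q-th
  moment is at most e T^q with T = q b sqrt m. Markov's inequality at exp 2 T leaves exp (1 - 2 q).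
  Evenness of q lets the power ignore the sign of the sum.\<close>

lemma (in prob_space) independent_sum_tail:
  fixes Z :: "'i \<Rightarrow> 'a \<Rightarrow> real"
  assumes I: "finite I" "I \<noteq> {}" and ind: "indep_vars (\<lambda>_. borel) Z I"
    and mean: "\<And>i. i \<in> I \<Longrightarrow> expectation (Z i) = 0"
    and int: "\<And>i l. i \<in> I \<Longrightarrow> l \<le> q \<Longrightarrow> integrable M (\<lambda>w. Z i w ^ l)"
    and mom: "\<And>i l. i \<in> I \<Longrightarrow> l \<le> q \<Longrightarrow> \<bar>expectation (\<lambda>w. Z i w ^ l)\<bar> \<le> b ^ l"
    and b: "0 < b" and q: "even q" "0 < q"
  shows "prob {w \<in> space M. exp 2 * real q * b * sqrt (card I) \<le> \<bar>\<Sum>i\<in>I. Z i w\<bar>} \<le> exp (- real q)"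
proof -
  define m where "m = card I"
  have m: "0 < m" using I by (simp add: m_def card_gt_0_iff)
  define r where "r = 1 / sqrt (real m)"
  have r: "0 < r" using m by (simp add: r_def)
  define T where "T = real q * b * sqrt (real m)"
  have T: "0 < T" using m q b by (simp add: T_def)
  let ?S = "\<lambda>w. \<Sum>i\<in>I. Z i w"
  note mm = independent_sum_moments[where q = q, OF I(1) ind mean int mom less_imp_le[OF b] r order_refl, folded m_def]
  have iS: "integrable M (\<lambda>w. ?S w ^ q)" using mm by blast
  have er: "0 \<le> exp r - r" using exp_ge_add_one_self[of r] by linarith
  have "(exp r - r) ^ m \<le> exp (r\<^sup>2) ^ m"
    using exp_le_add_exp_square[of r] exp_ge_add_one_self[of r] by (intro power_mono) linarith+
  also have "\<dots> = exp 1" using m by (simp add: exp_of_nat_mult[symmetric] r_def power_divide)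
  finally have X: "(exp r - r) ^ m \<le> exp 1" .
  have "expectation (\<lambda>w. ?S w ^ q) \<le> fact q * (b / r) ^ q * (exp r - r) ^ m" using mm by auto
  also have "\<dots> \<le> real q ^ q * (b / r) ^ q * exp 1"
    using X b r fact_le_power[of q, where 'a = real]
    by (intro mult_mono) (auto intro!: zero_le_power[OF er])
  also have "\<dots> = T ^ q * exp 1"
    using m by (simp add: T_def r_def power_mult_distrib[symmetric] mult.assoc)
  finally have E: "expectation (\<lambda>w. ?S w ^ q) \<le> T ^ q * exp 1" .
  have "{w \<in> space M. exp 2 * T \<le> \<bar>?S w\<bar>} = {w \<in> space M. (exp 2 * T) ^ q \<le> ?S w ^ q}"
  proof -
    have "exp 2 * T \<le> \<bar>y\<bar> \<longleftrightarrow> (exp 2 * T) ^ q \<le> y ^ q" for y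
      using power_mono_iff[of "exp 2 * T" "\<bar>y\<bar>" q] T q by (simp add: power_even_abs)
    then show ?thesis by simp
  qed
  then have "prob {w \<in> space M. exp 2 * T \<le> \<bar>?S w\<bar>} \<le> expectation (\<lambda>w. ?S w ^ q) / (exp 2 * T) ^ q"
    using integral_Markov_inequality_measure[OF iS, of "{}" "(exp 2 * T) ^ q"] T q
    by (simp add: zero_le_even_power)
  also have "\<dots> \<le> T ^ q * exp 1 / (exp 2 * T) ^ q"
    using T by (intro divide_right_mono E) auto
  also have "\<dots> = exp 1 / exp 2 ^ q" using T by (simp add: power_mult_distrib)
  also have "\<dots> = exp (1 - 2 * real q)"
    by (simp add: exp_diff exp_of_nat_mult[symmetric] mult.commute)
  also have "\<dots> \<le> exp (- real q)" using q by simp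
  finally show ?thesis by (simp add: T_def m_def mult.assoc)
qed

section \<open>Moments of the gradient contribution of one row\<close>

context subg_smooth
begin

abbreviation "row_term z \<equiv> z k * f 0 0 (vinner n z u) (vinner n z v)"
abbreviation "row_moment_const q \<equiv> B * (4 * s * N * (real (P + 1) * real q)) ^ (P + 1)"

text \<open>The row term has growth degree \<open>P + 1\<close>, so its l-th moment carries the
  factorial of (P + 1) l. Replacing this by ((P + 1) q)^((P + 1) l) gives the form b^l for all l <=
  q at once. Centring costs 24 = 2 * 2 * 6: a factor 2 from |y - c| <= 2 max, a factor 2 from adding
  two terms, and 6 from \<open>V_moment\<close>.\<close>

lemma row_term_moments:
  assumes l: "l \<le> q" and q: "0 < q"
  shows "integrable Q (\<lambda>z. (row_term z - integral\<^sup>L Q row_term) ^ l)"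
    and "\<bar>\<integral>z. (row_term z - integral\<^sup>L Q row_term) ^ l \<partial>Q\<bar> \<le> (24 * row_moment_const q) ^ l"
proof -
  let ?c = "integral\<^sup>L Q row_term"
  define b where "b = row_moment_const q"
  have b: "0 \<le> b" using B_nonneg s_ge_1 N by (simp add: b_def)
  have meas [measurable]: "row_term \<in> borel_measurable Q"
    using k by (intro borel_measurable_times f_measurable measurable_vinner) auto
  have pt: "\<bar>row_term z\<bar> \<le> B * W z ^ (P + 1)" for z
  proof -
    have "\<bar>f 0 0 (vinner n z u) (vinner n z v)\<bar> \<le> B * (1 + \<bar>vinner n z u\<bar> + \<bar>vinner n z v\<bar>) ^ P"
      by (rule growth) simp
    also have "\<dots> \<le> B * W z ^ P"
      using B_nonneg by (intro mult_left_mono power_mono) (auto simp: V_def)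
    finally have "\<bar>row_term z\<bar> \<le> W z * (B * W z ^ P)"
      unfolding abs_mult using coordinate_le_W(1)[of z] V_ge_1[of k u v z] by (intro mult_mono) auto
    then show ?thesis by (simp add: mult_ac)
  qed
  have abs_mom: "integrable Q (\<lambda>z. \<bar>row_term z\<bar> ^ l) \<and> (\<integral>z. \<bar>row_term z\<bar> ^ l \<partial>Q) \<le> 6 * b ^ l"
    if l: "l \<le> q" for l
  proof -
    have ptl: "\<bar>\<bar>row_term z\<bar> ^ l\<bar> \<le> B ^ l * W z ^ ((P + 1) * l)" for z
    proof -
      have "\<bar>row_term z\<bar> ^ l \<le> (B * W z ^ (P + 1)) ^ l" by (intro power_mono pt) simp
      also have "\<dots> = B ^ l * W z ^ ((P + 1) * l)" by (simp only: power_mult_distrib power_mult)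
      finally show ?thesis by simp
    qed
    note dom = V_dominated[OF k u v N _ ptl]
    have "fact ((P + 1) * l) \<le> real ((P + 1) * l) ^ ((P + 1) * l)"
      using fact_le_power[of "(P + 1) * l", where 'a = real] by simp
    also have "\<dots> \<le> (real (P + 1) * real q) ^ ((P + 1) * l)"
    proof (rule power_mono)
      have "(P + 1) * l \<le> (P + 1) * q" using l by (rule mult_le_mono2)
      then show "real ((P + 1) * l) \<le> real (P + 1) * real q"
        by (simp only: of_nat_mult[symmetric] of_nat_le_iff)
    qed simp
    finally have fct: "fact ((P + 1) * l) \<le> (real (P + 1) * real q) ^ ((P + 1) * l)" .
    have "(\<integral>z. \<bar>row_term z\<bar> ^ l \<partial>Q) \<le> B ^ l * (6 * fact ((P + 1) * l) * (4 * s * N) ^ ((P + 1) * l))"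
      using dom(2) by (auto simp: abs_le_iff)
    also have "\<dots> \<le> B ^ l * (6 * (real (P + 1) * real q) ^ ((P + 1) * l) * (4 * s * N) ^ ((P + 1) * l))"
      using fct B_nonneg s_ge_1 N by (intro mult_left_mono mult_right_mono) auto
    also have "\<dots> = 6 * b ^ l"
      unfolding b_def by (simp only: power_mult power_mult_distrib) (simp only: mult_ac)
    finally show ?thesis using dom(1) by auto
  qed
  have irow: "integrable Q row_term"
    using abs_mom[of 1] q integrable_abs_cancel[of Q row_term] meas by simp
  have c: "\<bar>?c\<bar> \<le> 6 * b"
  proof -
    have "\<bar>?c\<bar> \<le> (\<integral>z. \<bar>row_term z\<bar> \<partial>Q)" by (rule integral_abs_bound)
    also have "\<dots> \<le> 6 * b" using abs_mom[of 1] q by (simp only: power_one_right)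
    finally show ?thesis .
  qed
  have pow: "\<bar>(y - ?c) ^ l\<bar> \<le> 2 ^ l * (\<bar>y\<bar> ^ l + (6 * b) ^ l)" for y
  proof -
    have "\<bar>y - ?c\<bar> \<le> 2 * max \<bar>y\<bar> (6 * b)" using c by linarith
    then have "\<bar>y - ?c\<bar> ^ l \<le> (2 * max \<bar>y\<bar> (6 * b)) ^ l" by (intro power_mono) auto
    also have "\<dots> = 2 ^ l * max \<bar>y\<bar> (6 * b) ^ l" by (rule power_mult_distrib)
    also have "max \<bar>y\<bar> (6 * b) ^ l \<le> \<bar>y\<bar> ^ l + (6 * b) ^ l"
      using b by (simp add: max_def zero_le_power)
    finally show ?thesis by (simp add: power_abs)
  qed
  have gi: "integrable Q (\<lambda>z. 2 ^ l * (\<bar>row_term z\<bar> ^ l + (6 * b) ^ l))"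
    using abs_mom[OF l] by auto
  show i: "integrable Q (\<lambda>z. (row_term z - ?c) ^ l)"
    by (rule Bochner_Integration.integrable_bound[OF gi], measurable)
      (use pow in \<open>auto intro!: AE_I2 intro: order_trans[OF _ abs_ge_self]\<close>)
  show "\<bar>\<integral>z. (row_term z - ?c) ^ l \<partial>Q\<bar> \<le> (24 * row_moment_const q) ^ l"
  proof (cases "l = 0")
    case False
    have "\<bar>\<integral>z. (row_term z - ?c) ^ l \<partial>Q\<bar> \<le> (\<integral>z. \<bar>(row_term z - ?c) ^ l\<bar> \<partial>Q)"
      using integral_norm_bound[of Q "\<lambda>z. (row_term z - ?c) ^ l"] by simp
    also have "\<dots> \<le> (\<integral>z. 2 ^ l * (\<bar>row_term z\<bar> ^ l + (6 * b) ^ l) \<partial>Q)"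
      using i gi pow by (intro integral_mono) auto
    also have "\<dots> = 2 ^ l * ((\<integral>z. \<bar>row_term z\<bar> ^ l \<partial>Q) + (6 * b) ^ l)"
      using abs_mom[OF l] by (simp add: P.prob_space)
    also have "\<dots> \<le> 2 ^ l * (6 * b ^ l + (6 * b) ^ l)"
      using abs_mom[OF l] by (intro mult_left_mono add_right_mono) auto
    also have "\<dots> \<le> 2 ^ l * (2 ^ l * (6 * b) ^ l)"
    proof (intro mult_left_mono)
      have "(6::real) \<le> 6 ^ l" "(2::real) \<le> 2 ^ l" using False by (simp_all add: self_le_power)
      then have "6 * b ^ l \<le> (6 * b) ^ l" "2 * (6 * b) ^ l \<le> 2 ^ l * (6 * b) ^ l"
        using b by (auto simp: power_mult_distrib intro!: mult_right_mono)
      then show "6 * b ^ l + (6 * b) ^ l \<le> 2 ^ l * (6 * b) ^ l" by linarith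
    qed simp
    also have "\<dots> = (2 * (2 * (6 * b))) ^ l" by (simp only: power_mult_distrib)
    also have "2 * (2 * (6 * b)) = 24 * b" by simp
    finally show ?thesis unfolding b_def .
  qed (simp add: P.prob_space)
qed

end

subsection \<open>Verification of the hypotheses\<close>

lemma subgI:
  assumes "prob_space D" "sets D = sets borel" "integrable D (\<lambda>y. y)" "integral\<^sup>L D (\<lambda>y. y) = 0"
    "integrable D (\<lambda>y. y\<^sup>2)" "integral\<^sup>L D (\<lambda>y. y\<^sup>2) = 1"
    and nn: "(\<integral>\<^sup>+ y. ennreal (exp (y\<^sup>2 / r\<^sup>2)) \<partial>D) \<le> 2" and r: "0 < r" "r \<le> s"
  shows "subg s D"
proof -
  have [measurable_cong]: "sets D = sets borel" by fact
  have le: "exp (y\<^sup>2 / s\<^sup>2) \<le> exp (y\<^sup>2 / r\<^sup>2)" for y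
    using r by (auto intro!: divide_left_mono power_mono)
  have "(\<integral>\<^sup>+ y. ennreal (exp (y\<^sup>2 / s\<^sup>2)) \<partial>D) \<le> (\<integral>\<^sup>+ y. ennreal (exp (y\<^sup>2 / r\<^sup>2)) \<partial>D)"
    by (intro nn_integral_mono ennreal_leI le)
  then have 2: "(\<integral>\<^sup>+ y. ennreal (exp (y\<^sup>2 / s\<^sup>2)) \<partial>D) \<le> 2" using nn by simp
  have int: "integrable D (\<lambda>y. exp (y\<^sup>2 / s\<^sup>2))"
    by (rule integrableI_bounded) (use 2 in \<open>auto intro: le_less_trans\<close>)
  have "ennreal (integral\<^sup>L D (\<lambda>y. exp (y\<^sup>2 / s\<^sup>2))) \<le> ennreal 2"
    using nn_integral_eq_integral[OF int] 2 by simp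
  then have "integral\<^sup>L D (\<lambda>y. exp (y\<^sup>2 / s\<^sup>2)) \<le> 2" by (subst (asm) ennreal_le_iff) auto
  then show ?thesis using assms int by (simp add: subg_def)
qed

text \<open>The infimum in the Orlicz norm is not assumed to be attained; the factor 2 leaves room
  for an admissible scale strictly below 2 K.\<close>

lemma subg_of_psi2_norm:
  assumes "prob_space D" "sets D = sets borel" "integrable D (\<lambda>y. y)" "integral\<^sup>L D (\<lambda>y. y) = 0"
    "integrable D (\<lambda>y. y\<^sup>2)" "integral\<^sup>L D (\<lambda>y. y\<^sup>2) = 1"
    and psi: "psi2_norm D \<le> ereal K" and K: "0 < K"
  shows "subg (2 * K) D"
proof -
  have "psi2_norm D < ereal (2 * K)" using psi K by (metis ereal_less_eq(3) le_less_trans less_ereal.simps(1) mult_2 less_add_same_cancel1)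
  then obtain r where "0 < r" "r < 2 * K" "(\<integral>\<^sup>+ y. ennreal (exp (y\<^sup>2 / r\<^sup>2)) \<partial>D) \<le> 2"
    unfolding psi2_norm_def Inf_less_iff by auto
  then show ?thesis using assms by (intro subgI[where r = r]) auto
qed

lemma subg_std_normal:
  assumes "2 \<le> s" shows "subg s (density lborel std_normal_density)"
proof (rule subgI)
  show "prob_space (density lborel std_normal_density)" by (rule prob_space_normal_density) simp
  show "integrable (density lborel std_normal_density) (\<lambda>y. y)"
      "integral\<^sup>L (density lborel std_normal_density) (\<lambda>y. y) = 0"
    using integrable_std_normal_moment[of 1] integral_std_normal_moment_odd[of 0]
    by (simp_all add: integrable_density integral_density)
  show "integrable (density lborel std_normal_density) (\<lambda>y. y\<^sup>2)"
      "integral\<^sup>L (density lborel std_normal_density) (\<lambda>y. y\<^sup>2) = 1"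
    using integrable_std_normal_moment[of 2] integral_std_normal_moment_even[of 1]
    by (simp_all add: integrable_density integral_density)
  \<comment> \<open>At the scale sqrt (8/3) the tilted density is exactly twice the normal density
    with standard deviation 2, so the exponential square moment equals 2.\<close>
  have "std_normal_density y * exp (y\<^sup>2 / (sqrt (8 / 3))\<^sup>2) = 2 * normal_density 0 2 y" for y
  proof -
    have "- (y\<^sup>2 / 2) + y\<^sup>2 / (sqrt (8 / 3))\<^sup>2 = - (y\<^sup>2 / 8)" by (simp add: field_simps)
    then have "exp (- (y\<^sup>2 / 2)) * exp (y\<^sup>2 / (sqrt (8 / 3))\<^sup>2) = exp (- (y\<^sup>2 / 8))"
      by (metis exp_add)
    moreover have "sqrt 8 = 2 * sqrt 2" using real_sqrt_mult[of 4 2] by simp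
    ultimately show ?thesis by (simp add: normal_density_def real_sqrt_mult field_simps)
  qed
  then have "(\<integral>\<^sup>+ y. ennreal (exp (y\<^sup>2 / (sqrt (8 / 3))\<^sup>2)) \<partial>density lborel std_normal_density)
      = (\<integral>\<^sup>+ y. ennreal (2 * normal_density 0 2 y) \<partial>lborel)"
    by (subst nn_integral_density) (auto simp flip: ennreal_mult')
  also have "\<dots> = ennreal (\<integral>y. 2 * normal_density 0 2 y \<partial>lborel)"
    by (rule nn_integral_eq_integral) auto
  also have "\<dots> = 2" by simp
  finally show "(\<integral>\<^sup>+ y. ennreal (exp (y\<^sup>2 / (sqrt (8 / 3))\<^sup>2)) \<partial>density lborel std_normal_density) \<le> 2"
    by simp
  show "sqrt (8 / 3) \<le> s" using assms power_mono[of 2 s 2] by (intro real_le_lsqrt) auto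
qed auto

lemma pseudo_lipschitz_continuous:
  assumes "pseudo_lipschitz \<Lambda> p f" shows "continuous_on UNIV f"
  unfolding continuous_on_def
proof
  fix v :: "real \<times> real"
  have "((\<lambda>u. \<Lambda> * (1 + norm u + norm v) powr (p - 1) * norm (u - v))
      \<longlongrightarrow> \<Lambda> * (1 + norm v + norm v) powr (p - 1) * norm (v - v)) (at v)"
    by (intro tendsto_intros) (smt (verit) norm_ge_zero)
  then have "((\<lambda>u. \<Lambda> * (1 + norm u + norm v) powr (p - 1) * norm (u - v)) \<longlongrightarrow> 0) (at v)" by simp
  moreover have "\<forall>\<^sub>F u in at v. norm (f u - f v) \<le> \<Lambda> * (1 + norm u + norm v) powr (p - 1) * norm (u - v)"
    using assms unfolding pseudo_lipschitz_def real_norm_def[symmetric] by (intro always_eventually allI) blast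
  ultimately have "((\<lambda>u. f u - f v) \<longlongrightarrow> 0) (at v)" by (rule Lim_null_comparison[rotated])
  then show "(f \<longlongrightarrow> f v) (at v within UNIV)" by (simp add: LIM_zero_iff)
qed

lemma pseudo_lipschitz_growth:
  assumes f: "pseudo_lipschitz \<Lambda> p (\<lambda>(y, z). g y z)" and g0: "\<bar>g 0 0\<bar> \<le> \<Lambda>"
    and p: "1 \<le> p" "p \<le> real P" and \<Lambda>: "0 \<le> \<Lambda>"
  shows "\<bar>g x z\<bar> \<le> 2 * \<Lambda> * (1 + \<bar>x\<bar> + \<bar>z\<bar>) ^ P"
proof -
  define X where "X = 1 + \<bar>x\<bar> + \<bar>z\<bar>"
  have X: "1 \<le> X" by (simp add: X_def)
  have nx: "norm (x, z) \<le> \<bar>x\<bar> + \<bar>z\<bar>" by (simp add: norm_Pair sqrt_sum_squares_le_sum_abs)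
  have "\<bar>g x z - g 0 0\<bar> \<le> \<Lambda> * (1 + norm (x, z) + norm (0::real, 0::real)) powr (p - 1) * norm ((x, z) - (0, 0))"
    using f[unfolded pseudo_lipschitz_def, rule_format, of "(x, z)" "(0, 0)"] by (simp only: prod.case)
  also have "\<dots> = \<Lambda> * ((1 + norm (x, z)) powr (p - 1) * norm (x, z))" by simp
  also have "\<dots> \<le> \<Lambda> * (X powr (p - 1) * X)"
    using nx p \<Lambda> by (intro mult_left_mono mult_mono powr_mono2) (auto simp: X_def)
  also have "X powr (p - 1) * X = X powr p" using X by (simp add: powr_diff)
  also have "\<Lambda> * X powr p \<le> \<Lambda> * X ^ P"
    using X p \<Lambda> powr_mono[of p "real P" X] by (intro mult_left_mono) (auto simp: powr_realpow)
  finally have "\<bar>g x z - g 0 0\<bar> \<le> \<Lambda> * X ^ P" .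
  moreover have "\<Lambda> * 1 \<le> \<Lambda> * X ^ P" using X \<Lambda> by (intro mult_left_mono one_le_power)
  ultimately show ?thesis using g0 unfolding X_def by linarith
qed

lemma smooth_family_pd:
  assumes ex: "partials_exist 4 g" and p: "1 \<le> p" "p \<le> real P" and \<Lambda>: "0 \<le> \<Lambda>"
    and lip: "\<And>a b. a + b \<le> 4 \<Longrightarrow> pseudo_lipschitz \<Lambda> p (\<lambda>(y, z). pd g a b y z) \<and> \<bar>pd g a b 0 0\<bar> \<le> \<Lambda>"
  shows "smooth_family (pd g) (2 * \<Lambda>) P"
proof
  have cont: "continuous_on UNIV (\<lambda>y. pd g a b (fst y) (snd y))" if "a + b \<le> 4" for a b
    using pseudo_lipschitz_continuous[of \<Lambda> p "\<lambda>(y, z). pd g a b y z"] lip[OF that] by (simp add: case_prod_beta')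
  have d1: "((\<lambda>x. pd g a b x z) has_real_derivative pd g (Suc a) b x z) (at x)" if "a + b < 4" for a b x z
    using ex that by (simp add: partials_exist_def pd_def D1_def DERIV_deriv_iff_real_differentiable)
  \<comment> \<open>\<open>pd\<close> applies the derivatives in the second argument first, so for a
    > 0 a further one would have to pass under \<open>D1\<close>. Each passage is an application of
    \<open>peano_schwarz\<close>.\<close>
  have d2: "((\<lambda>z. pd g a b x z) has_real_derivative pd g a (Suc b) x z) (at z)" if "a + b < 4" for a b x z
    using that
  proof (induction a arbitrary: x z)
    case 0
    then show ?case
      using ex by (simp add: partials_exist_def pd_def D2_def DERIV_deriv_iff_real_differentiable)
  next
    case (Suc a)
    show ?case
      by (rule peano_schwarz[of "pd g a b" "pd g (Suc a) b" "pd g a (Suc b)" "pd g (Suc a) (Suc b)"])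
        (use Suc in \<open>auto intro: d1 cont\<close>)
  qed
  fix a b x z
  show "a + b \<le> 4 \<Longrightarrow> continuous_on UNIV (\<lambda>y. pd g a b (fst y) (snd y))" by (rule cont)
  show "a + b \<le> 4 \<Longrightarrow> \<bar>pd g a b x z\<bar> \<le> 2 * \<Lambda> * (1 + \<bar>x\<bar> + \<bar>z\<bar>) ^ P"
    using lip p \<Lambda> by (intro pseudo_lipschitz_growth[where p = p]) auto
  show "a + b < 4 \<Longrightarrow> ((\<lambda>x. pd g a b x z) has_real_derivative pd g (Suc a) b x z) (at x)" by (rule d1)
  show "a + b < 4 \<Longrightarrow> ((\<lambda>z. pd g a b x z) has_real_derivative pd g a (Suc b) x z) (at z)" by (rule d2)
qed

subsection \<open>The averaged derivative\<close>

definition avg_deriv :: "(nat \<Rightarrow> nat \<Rightarrow> real \<Rightarrow> real \<Rightarrow> real) \<Rightarrow> real \<Rightarrow> real \<Rightarrow> real \<Rightarrow> real" where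
  "avg_deriv f a b z = (LBINT U:{0..1}. f 1 0 (U * a + (1 - U) * b) z)"

context smooth_family
begin

abbreviation "avg \<equiv> avg_deriv f"

text \<open>The fundamental theorem of calculus along the segment from b to a: averaging over U
  makes the linearisation exact, with no Taylor remainder.\<close>

lemma avg_mult_diff: "avg a b z * (a - b) = f 0 0 a z - f 0 0 b z"
proof -
  have cont1: "continuous_on {0..1} (\<lambda>U. f 1 0 (U * a + (1 - U) * b) z * (a - b))"
  proof -
    have "continuous_on {0..1} (\<lambda>U. f 1 0 (fst (U * a + (1 - U) * b, z)) (snd (U * a + (1 - U) * b, z)))"
      by (rule continuous_on_compose2[OF cont[of 1 0], where f = "\<lambda>U. (U * a + (1 - U) * b, z)"])
        (auto intro!: continuous_intros)
    then show ?thesis by (auto intro!: continuous_intros)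
  qed
  have der: "((\<lambda>U. f 0 0 (U * a + (1 - U) * b) z) has_vector_derivative f 1 0 (U * a + (1 - U) * b) z * (a - b))
      (at U within {0..1})" for U
  proof -
    have "((\<lambda>U. U * a + (1 - U) * b) has_real_derivative (a - b)) (at U within {0..1})"
      by (auto intro!: derivative_eq_intros)
    from DERIV_chain2[OF deriv1[of 0 0] this]
    show ?thesis by (simp add: has_real_derivative_iff_has_vector_derivative)
  qed
  have "(\<integral>U. indicator {0..1} U *\<^sub>R (f 1 0 (U * a + (1 - U) * b) z * (a - b)) \<partial>lborel)
      = f 0 0 (1 * a + (1 - 1) * b) z - f 0 0 (0 * a + (1 - 0) * b) z"
    by (rule integral_FTC_atLeastAtMost[OF _ der cont1]) simp
  then show ?thesis by (simp add: avg_deriv_def set_lebesgue_integral_def mult.assoc[symmetric])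
qed

lemma avg_same: "avg a a z = f 1 0 a z"
  by (simp add: avg_deriv_def set_lebesgue_integral_def algebra_simps)

text \<open>Eliminating the integral over U makes measurability in the three arguments immediate and
  lets the mean value theorem bound the growth.\<close>

lemma avg_eq: "avg a b z = (if a = b then f 1 0 a z else (f 0 0 a z - f 0 0 b z) / (a - b))"
  using avg_mult_diff[of a b z] by (auto simp: avg_same nonzero_eq_divide_eq)

text \<open>The average is a value of \<open>f 1 0\<close> at a point between a and b. The majorant
  is kept as a sum of two brackets so that each can be absorbed by its own weight
  \<open>V\<close>.\<close>

lemma avg_growth: "\<bar>avg a b z\<bar> \<le> B * ((1 + \<bar>a\<bar> + \<bar>z\<bar>) + (1 + \<bar>b\<bar> + \<bar>z\<bar>)) ^ P"
proof -
  have "\<exists>c. \<bar>c\<bar> \<le> \<bar>a\<bar> + \<bar>b\<bar> \<and> avg a b z = f 1 0 c z"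
  proof (cases "a < b \<or> b < a")
    case True
    have mvt: "\<exists>c. x \<le> c \<and> c \<le> y \<and> f 0 0 y z - f 0 0 x z = (y - x) * f 1 0 c z" if "x < y" for x y
      using MVT2[OF that, of "\<lambda>x. f 0 0 x z" "\<lambda>x. f 1 0 x z"] deriv1[of 0 0] by (auto intro: less_imp_le)
    from True show ?thesis
    proof
      assume "a < b"
      then obtain c where c: "a \<le> c" "c \<le> b" "f 0 0 b z - f 0 0 a z = (b - a) * f 1 0 c z" using mvt by blast
      then have "avg a b z = f 1 0 c z" using \<open>a < b\<close> by (simp add: avg_eq field_simps)
      then show ?thesis using c by (intro exI[of _ c]) auto
    next
      assume "b < a"
      then obtain c where c: "b \<le> c" "c \<le> a" "f 0 0 a z - f 0 0 b z = (a - b) * f 1 0 c z" using mvt by blast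
      then have "avg a b z = f 1 0 c z" using \<open>b < a\<close> by (simp add: avg_eq)
      then show ?thesis using c by (intro exI[of _ c]) auto
    qed
  next
    case False
    then show ?thesis by (intro exI[of _ a]) (simp add: avg_eq)
  qed
  then obtain c where c: "\<bar>c\<bar> \<le> \<bar>a\<bar> + \<bar>b\<bar>" "avg a b z = f 1 0 c z" by blast
  have "\<bar>f 1 0 c z\<bar> \<le> B * (1 + \<bar>c\<bar> + \<bar>z\<bar>) ^ P" by (rule growth) simp
  also have "\<dots> \<le> B * ((1 + \<bar>a\<bar> + \<bar>z\<bar>) + (1 + \<bar>b\<bar> + \<bar>z\<bar>)) ^ P"
    using c B_nonneg by (intro mult_left_mono power_mono) auto
  finally show ?thesis using c by simp
qed

lemma avg_measurable:
  assumes [measurable]: "g \<in> borel_measurable M" "h \<in> borel_measurable M" "l \<in> borel_measurable M"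
  shows "(\<lambda>w. avg (g w) (h w) (l w)) \<in> borel_measurable M"
proof -
  have [measurable]: "(\<lambda>w. f 1 0 (g w) (l w)) \<in> borel_measurable M" "(\<lambda>w. f 0 0 (g w) (l w)) \<in> borel_measurable M"
    "(\<lambda>w. f 0 0 (h w) (l w)) \<in> borel_measurable M"
    by (rule f_measurable; simp)+
  show ?thesis unfolding avg_eq by measurable
qed

end

subsection \<open>Random matrices with independent sub-Gaussian entries\<close>

lemma vinner_restrict: "vinner n (restrict z {..<n}) u = vinner n z u"
  by (simp add: vinner_def)

lemma vinner_interpolate:
  "vinner n z (\<lambda>l. U * u l + (1 - U) * v l) = U * vinner n z u + (1 - U) * vinner n z v"
  by (simp add: vinner_def algebra_simps sum.distrib sum_subtractf sum_distrib_left)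

lemma vinner_diff: "vinner n z u - vinner n z v = (\<Sum>k<n. z k * (u k - v k))"
  by (simp add: vinner_def algebra_simps sum_subtractf)

locale subg_matrix =
  fixes m n :: nat and s :: real and D :: "nat \<Rightarrow> nat \<Rightarrow> real measure"
  assumes s_ge_1: "1 \<le> s" and subgD: "\<And>i j. subg s (D i j)"
begin

abbreviation "XP \<equiv> XLaw m n D"
abbreviation "rowlaw i \<equiv> Pi\<^sub>M {..<n} (D i)"

lemma subg_product_row: "subg_product s (D i)"
  using s_ge_1 subgD by unfold_locales auto

lemma prob_space_entry: "prob_space (case ij of (i, j) \<Rightarrow> D i j)"
  using subgD by (cases ij) (simp add: subg_def)

sublocale XP: prob_space XP
  unfolding XLaw_def by (intro prob_space_PiM prob_space_entry)

lemma measurable_entry [measurable]: "i < m \<Longrightarrow> j < n \<Longrightarrow> (\<lambda>w. w (i, j)) \<in> borel_measurable XP"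
proof -
  assume "i < m" "j < n"
  then have "(\<lambda>w. w (i, j)) \<in> measurable XP (case (i, j) of (i, j) \<Rightarrow> D i j)"
    unfolding XLaw_def by (intro measurable_component_singleton) auto
  then show ?thesis using subgD by (simp add: subg_def cong: measurable_cong_sets)
qed

lemma measurable_row_vinner [measurable]:
  "i < m \<Longrightarrow> (\<And>l. l < n \<Longrightarrow> (\<lambda>w. u w l) \<in> borel_measurable XP) \<Longrightarrow> (\<lambda>w. vinner n (row w i) (u w)) \<in> borel_measurable XP"
  unfolding vinner_def row_def by (intro borel_measurable_sum borel_measurable_times measurable_entry) auto

lemma measurable_row: "i < m \<Longrightarrow> (\<lambda>w. \<lambda>j\<in>{..<n}. w (i, j)) \<in> measurable XP (rowlaw i)"
proof (rule measurable_restrict)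
  fix j assume "i < m" "j \<in> {..<n}"
  then show "(\<lambda>w. w (i, j)) \<in> measurable XP (D i j)"
    using measurable_component_singleton[of "(i, j)" "{..<m} \<times> {..<n}" "\<lambda>(i, j). D i j"]
    by (simp add: XLaw_def)
qed

lemma distr_row: "i < m \<Longrightarrow> distr XP (rowlaw i) (\<lambda>w. \<lambda>j\<in>{..<n}. w (i, j)) = rowlaw i"
  unfolding XLaw_def
  using distr_PiM_reindex[of "{..<m} \<times> {..<n}" "\<lambda>(i, j). D i j" "\<lambda>j. (i, j)" "{..<n}"] prob_space_entry
  by (auto simp: inj_on_def)

lemma row_restrict: "(\<lambda>j\<in>{..<n}. w (i, j)) = restrict (row w i) {..<n}"
  by (simp add: row_def)

lemma integral_row:
  fixes F :: "(nat \<Rightarrow> real) \<Rightarrow> real"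
  assumes i: "i < m" and F: "F \<in> borel_measurable (rowlaw i)" and ext: "\<And>z. F (restrict z {..<n}) = F z"
  shows "(\<integral>w. F (row w i) \<partial>XP) = integral\<^sup>L (rowlaw i) F"
  using integral_distr[OF measurable_row[OF i] F] unfolding distr_row[OF i] by (simp add: row_restrict ext)

lemma integrable_row:
  fixes F :: "(nat \<Rightarrow> real) \<Rightarrow> real"
  assumes i: "i < m" and F: "integrable (rowlaw i) F" and ext: "\<And>z. F (restrict z {..<n}) = F z"
  shows "integrable XP (\<lambda>w. F (row w i))"
  using integrable_distr[OF measurable_row[OF i], of F] F unfolding distr_row[OF i] by (simp add: row_restrict ext)

lemma indep_rows:
  fixes F :: "nat \<Rightarrow> (nat \<Rightarrow> real) \<Rightarrow> real"
  assumes m: "0 < m" and n: "0 < n"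
    and F: "\<And>i. i < m \<Longrightarrow> F i \<in> borel_measurable (rowlaw i)"
    and ext: "\<And>i z. i < m \<Longrightarrow> F i (restrict z {..<n}) = F i z"
  shows "XP.indep_vars (\<lambda>_. borel) (\<lambda>i w. F i (row w i)) {..<m}"
proof -
  let ?I = "{..<m} \<times> {..<n}" and ?M = "\<lambda>(i, j). D i j"
  have "XP.indep_vars ?M (\<lambda>ij w. w ij) ?I"
  proof (subst XP.indep_vars_iff_distr_eq_PiM')
    show "?I \<noteq> {}" using m n by auto
    show "(\<lambda>w. w ij) \<in> measurable XP (?M ij)" if "ij \<in> ?I" for ij
      unfolding XLaw_def using that by (rule measurable_component_singleton)
    have "distr XP (Pi\<^sub>M ?I ?M) (\<lambda>w. restrict w ?I) = distr XP XP (\<lambda>w. w)"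
      by (intro distr_cong) (auto simp: XLaw_def space_PiM)
    also have "\<dots> = Pi\<^sub>M ?I ?M" by (simp add: XLaw_def)
    also have "\<dots> = Pi\<^sub>M ?I (\<lambda>ij. distr XP (?M ij) (\<lambda>w. w ij))"
      unfolding XLaw_def using distr_PiM_component[of ?I ?M] prob_space_entry by (intro PiM_cong) auto
    finally show "distr XP (Pi\<^sub>M ?I ?M) (\<lambda>w. \<lambda>ij\<in>?I. w ij) = Pi\<^sub>M ?I (\<lambda>ij. distr XP (?M ij) (\<lambda>w. w ij))" .
  qed
  \<comment> \<open>Independence of the entries passes to disjoint blocks of indices, here the
    rows.\<close>
  then have "XP.indep_vars (\<lambda>i. Pi\<^sub>M ({i} \<times> {..<n}) ?M) (\<lambda>i w. restrict (\<lambda>ij. w ij) ({i} \<times> {..<n})) {..<m}"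
    by (rule XP.indep_vars_restrict) (auto simp: disjoint_family_on_def)
  then have "XP.indep_vars (\<lambda>_. borel)
      (\<lambda>i w. F i (\<lambda>j\<in>{..<n}. restrict (\<lambda>ij. w ij) ({i} \<times> {..<n}) (i, j))) {..<m}"
  proof (rule XP.indep_vars_compose2)
    fix i assume i: "i \<in> {..<m}"
    have "(\<lambda>w. \<lambda>j\<in>{..<n}. w (i, j)) \<in> measurable (Pi\<^sub>M ({i} \<times> {..<n}) ?M) (rowlaw i)"
    proof (rule measurable_restrict)
      fix j assume "j \<in> {..<n}"
      then show "(\<lambda>w. w (i, j)) \<in> measurable (Pi\<^sub>M ({i} \<times> {..<n}) ?M) (D i j)"
        using measurable_component_singleton[of "(i, j)" "{i} \<times> {..<n}" ?M] by simp
    qed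
    then show "(\<lambda>w. F i (\<lambda>j\<in>{..<n}. w (i, j))) \<in> borel_measurable (Pi\<^sub>M ({i} \<times> {..<n}) ?M)"
      using F i by (auto intro: measurable_compose)
  qed
  moreover have "F i (\<lambda>j\<in>{..<n}. restrict (\<lambda>ij. w ij) ({i} \<times> {..<n}) (i, j)) = F i (row w i)" if "i < m" for i w
  proof -
    have "(\<lambda>j\<in>{..<n}. restrict (\<lambda>ij. w ij) ({i} \<times> {..<n}) (i, j)) = restrict (row w i) {..<n}"
      by (auto simp: row_def restrict_def fun_eq_iff)
    then show ?thesis using ext[OF that] by simp
  qed
  ultimately show ?thesis by (subst XP.indep_vars_cong) auto
qed

end

locale gradient_model = subg_matrix m n s D for m n s D +
  fixes f :: "nat \<Rightarrow> nat \<Rightarrow> nat \<Rightarrow> real \<Rightarrow> real \<Rightarrow> real" and B :: real and P :: nat and v :: "nat \<Rightarrow> real"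
  assumes f: "\<And>i. i < m \<Longrightarrow> smooth_family (f i) B P" and mpos: "0 < m" and npos: "0 < n" and Bpos: "0 < B"
begin

abbreviation "grad_term i j u w \<equiv> w (i, j) * f i 0 0 (vinner n (row w i) u) (vinner n (row w i) v)"

lemma subg_smooth_row:
  "i < m \<Longrightarrow> j < n \<Longrightarrow> vnorm n u \<le> N \<Longrightarrow> vnorm n v \<le> N \<Longrightarrow> 1 \<le> N \<Longrightarrow>
    subg_smooth n s (D i) (f i) B P j u v N"
  using f subg_product_row by (simp add: subg_smooth_def subg_smooth_axioms_def)

lemma grad_term_row:
  assumes i: "i < m" and j: "j < n"
  shows "integrable XP (\<lambda>w. grad_term i j u w)"
    and "(\<integral>w. grad_term i j u w \<partial>XP) = (\<integral>z. z j * f i 0 0 (vinner n z u) (vinner n z v) \<partial>rowlaw i)"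
proof -
  define N where "N = 1 + vnorm n u + vnorm n v"
  interpret r: subg_smooth n s "D i" "f i" B P j u v N
    using i j by (intro subg_smooth_row) (auto simp: N_def)
  let ?F = "\<lambda>z. z j * f i 0 0 (vinner n z u) (vinner n z v)"
  have int: "integrable (rowlaw i) ?F"
    using r.integrable_polynomial_mult(2)[of "\<lambda>y. y", OF r.measurable_polynomials(1), of 1 0 0 0]
      r.coordinate_le_W(1) by auto
  have ext: "?F (restrict z {..<n}) = ?F z" for z using j by (simp add: vinner_restrict)
  show "integrable XP (\<lambda>w. grad_term i j u w)"
    using integrable_row[OF i int ext] by (simp add: row_def)
  show "(\<integral>w. grad_term i j u w \<partial>XP) = integral\<^sup>L (rowlaw i) ?F"
    using integral_row[OF i borel_measurable_integrable[OF int] ext] by (simp add: row_def)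
qed

text \<open>The vector u does not depend on w. This is essential: the summands are independent
  across rows only for a deterministic u.\<close>

definition noise :: "nat \<Rightarrow> (nat \<Rightarrow> real) \<Rightarrow> (nat \<times> nat \<Rightarrow> real) \<Rightarrow> real" where
  "noise j u w = (1 / real m) * (\<Sum>i<m. grad_term i j u w - (\<integral>w. grad_term i j u w \<partial>XP))"

lemma measurable_noise: "j < n \<Longrightarrow> noise j u \<in> borel_measurable XP"
  unfolding noise_def
  by (intro borel_measurable_times borel_measurable_sum borel_measurable_diff borel_measurable_const
      borel_measurable_integrable[OF grad_term_row(1)]) auto

lemma noise_tail:
  assumes j: "j < n" and u: "vnorm n u \<le> N" and v: "vnorm n v \<le> N" and N: "1 \<le> N"
    and q: "even q" "0 < q"
  shows "XP.prob {w \<in> space XP.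
      exp 2 * real q * (24 * (B * (4 * s * N * (real (P + 1) * real q)) ^ (P + 1))) / sqrt (real m)
      \<le> \<bar>noise j u w\<bar>} \<le> exp (- real q)"
proof -
  define b where "b = 24 * (B * (4 * s * N * (real (P + 1) * real q)) ^ (P + 1))"
  have b: "0 < b" using Bpos s_ge_1 N q by (simp add: b_def)
  let ?F = "\<lambda>i z. z j * f i 0 0 (vinner n z u) (vinner n z v)"
  let ?c = "\<lambda>i. integral\<^sup>L (rowlaw i) (?F i)"
  let ?Z = "\<lambda>i w. ?F i (row w i) - ?c i"
  have ext: "?F i (restrict z {..<n}) = ?F i z" for i z using j by (simp add: vinner_restrict)
  have loc: "subg_smooth n s (D i) (f i) B P j u v N" if "i < m" for i
    by (rule subg_smooth_row[OF that j u v N])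
  have mom: "integrable XP (\<lambda>w. ?Z i w ^ l) \<and> \<bar>\<integral>w. ?Z i w ^ l \<partial>XP\<bar> \<le> b ^ l" if i: "i < m" and l: "l \<le> q" for i l
  proof -
    note rm = subg_smooth.row_term_moments[OF loc[OF i] l q(2)]
    have "integrable XP (\<lambda>w. ?Z i w ^ l)"
      by (rule integrable_row[OF i rm(1)]) (simp only: ext)
    moreover have "(\<integral>w. ?Z i w ^ l \<partial>XP) = (\<integral>z. (?F i z - ?c i) ^ l \<partial>rowlaw i)"
      by (rule integral_row[OF i borel_measurable_integrable[OF rm(1)]]) (simp only: ext)
    ultimately show ?thesis using rm(2) unfolding b_def by simp
  qed
  have rowmeas: "?F i \<in> borel_measurable (rowlaw i)" if i: "i < m" for i
  proof -
    interpret r: subg_smooth n s "D i" "f i" B P j u v N by (rule loc[OF i])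
    show ?thesis using j by (intro borel_measurable_times r.f_measurable r.measurable_vinner) auto
  qed
  have ind: "XP.indep_vars (\<lambda>_. borel) ?Z {..<m}"
  proof (rule indep_rows[OF mpos npos])
    show "(\<lambda>z. ?F i z - ?c i) \<in> borel_measurable (rowlaw i)" if "i < m" for i
      by (intro borel_measurable_diff borel_measurable_const rowmeas that)
  qed (simp only: ext)
  have mean: "(\<integral>w. ?Z i w \<partial>XP) = 0" if i: "i < m" for i
  proof -
    have "(\<integral>w. ?F i (row w i) \<partial>XP) = ?c i" by (rule integral_row[OF i rowmeas[OF i]]) (simp only: ext)
    then show ?thesis using grad_term_row(1)[OF i j, of u] by (simp add: row_def XP.prob_space)
  qed
  have noise: "noise j u w = (1 / real m) * (\<Sum>i<m. ?Z i w)" for w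
    unfolding noise_def using grad_term_row(2)[OF _ j, of _ u] by (simp add: row_def)
  have "XP.prob {w \<in> space XP. exp 2 * real q * b * sqrt (card {..<m}) \<le> \<bar>\<Sum>i<m. ?Z i w\<bar>} \<le> exp (- real q)"
    by (rule XP.independent_sum_tail[OF _ _ ind _ _ _ b q]) (use mpos mean mom in auto)
  \<comment> \<open>Averaging divides the threshold of order sqrt m by m, which leaves the rate 1 /
    sqrt m.\<close>
  moreover have "exp 2 * real q * b / sqrt (real m) \<le> \<bar>noise j u w\<bar>
     \<longleftrightarrow> exp 2 * real q * b * sqrt (card {..<m}) \<le> \<bar>\<Sum>i<m. ?Z i w\<bar>" for w
  proof -
    have m: "real m = sqrt (real m) * sqrt (real m)" "0 < sqrt (real m)" using mpos by auto
    have "exp 2 * real q * b / sqrt (real m) = (1 / real m) * (exp 2 * real q * b * sqrt (real m))"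
      using m by (simp add: field_simps)
    then show ?thesis unfolding noise abs_mult using mpos by (simp add: divide_le_cancel)
  qed
  ultimately show ?thesis unfolding b_def[symmetric] by simp
qed

end

subsection \<open>Gradient descent against its two deterministic approximations\<close>

lemma pd_0_0 [simp]: "pd g 0 0 = g" by (simp add: pd_def)

lemma measurable_vnorm:
  assumes "\<And>j. j < n \<Longrightarrow> (\<lambda>w. g w j) \<in> borel_measurable M"
  shows "(\<lambda>w. vnorm n (g w)) \<in> borel_measurable M"
  unfolding vnorm_def
  by (intro borel_measurable_continuous_on[OF continuous_on_real_sqrt[OF continuous_on_id]]
      borel_measurable_sum borel_measurable_power assms) auto

locale gd_model =
  gradient_model m n s D "\<lambda>i. pd (\<lambda>a b. S a b (xi i))" B P mus
  for m n :: nat and s :: real and D and S :: "real \<Rightarrow> real \<Rightarrow> real \<Rightarrow> real" and xi :: "nat \<Rightarrow> real"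
  and B :: real and P :: nat and mus :: "nat \<Rightarrow> real" +
  fixes mu0 eta :: "nat \<Rightarrow> real"
begin

abbreviation "F i \<equiv> pd (\<lambda>a b. S a b (xi i))"
abbreviation "mu w r \<equiv> gd S m n xi mu0 mus eta w r"
abbreviation "uX \<equiv> theo_gd S m n XP xi mu0 mus eta"
abbreviation "us \<equiv> state_evo S m n xi mu0 mus eta"
abbreviation "MX u u' w \<equiv> Mmat S m n xi mus u u' w"
abbreviation "MXE u u' \<equiv> MmatE S m n XP xi mus u u'"

lemma Mmat_avg: "MX u u' w j k = (1 / real m) *
   (\<Sum>i<m. avg_deriv (F i) (vinner n (row w i) u) (vinner n (row w i) u') (vinner n (row w i) mus) * w (i, j) * w (i, k))"
  by (simp only: Mmat_def avg_deriv_def vinner_interpolate)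

lemma Mmat_mult_diff:
  "(\<Sum>k<n. MX u u' w j k * (u k - u' k)) = (1 / real m) * (\<Sum>i<m. grad_term i j u w - grad_term i j u' w)"
proof -
  let ?a = "\<lambda>i. avg_deriv (F i) (vinner n (row w i) u) (vinner n (row w i) u') (vinner n (row w i) mus)"
  have "(\<Sum>k<n. MX u u' w j k * (u k - u' k)) = (1 / real m) * (\<Sum>k<n. \<Sum>i<m. ?a i * w (i, j) * w (i, k) * (u k - u' k))"
    unfolding Mmat_avg by (simp only: sum_distrib_left sum_distrib_right mult.assoc)
  also have "(\<Sum>k<n. \<Sum>i<m. ?a i * w (i, j) * w (i, k) * (u k - u' k))
      = (\<Sum>i<m. \<Sum>k<n. ?a i * w (i, j) * w (i, k) * (u k - u' k))" by (rule sum.swap)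
  also have "\<dots> = (\<Sum>i<m. grad_term i j u w - grad_term i j u' w)"
  proof (rule sum.cong[OF refl])
    fix i assume "i \<in> {..<m}"
    then interpret r: smooth_family "F i" B P using f by simp
    have "(\<Sum>k<n. ?a i * w (i, j) * w (i, k) * (u k - u' k)) = w (i, j) * (?a i * (\<Sum>k<n. row w i k * (u k - u' k)))"
      unfolding sum_distrib_left row_def by (intro sum.cong refl) (simp only: mult_ac)
    also have "\<dots> = w (i, j) * (F i 0 0 (vinner n (row w i) u) (vinner n (row w i) mus) - F i 0 0 (vinner n (row w i) u') (vinner n (row w i) mus))"
      by (simp only: vinner_diff[symmetric] r.avg_mult_diff)
    finally show "(\<Sum>k<n. ?a i * w (i, j) * w (i, k) * (u k - u' k)) = grad_term i j u w - grad_term i j u' w"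
      by (simp add: right_diff_distrib)
  qed
  finally show ?thesis .
qed

lemma measurable_Mmat:
  assumes "\<And>l. l < n \<Longrightarrow> (\<lambda>w. u w l) \<in> borel_measurable XP" "\<And>l. l < n \<Longrightarrow> (\<lambda>w. u' w l) \<in> borel_measurable XP"
    and "j < n" "k < n"
  shows "(\<lambda>w. MX (u w) (u' w) w j k) \<in> borel_measurable XP"
  unfolding Mmat_avg
proof (intro borel_measurable_times borel_measurable_const borel_measurable_sum)
  fix i assume "i \<in> {..<m}"
  then have i: "i < m" by simp
  interpret r: smooth_family "F i" B P using f[OF i] .
  show "(\<lambda>w. avg_deriv (F i) (vinner n (row w i) (u w)) (vinner n (row w i) (u' w)) (vinner n (row w i) mus)) \<in> borel_measurable XP"
    by (intro r.avg_measurable measurable_row_vinner i assms borel_measurable_const)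
  show "(\<lambda>w. w (i, j)) \<in> borel_measurable XP" "(\<lambda>w. w (i, k)) \<in> borel_measurable XP"
    using i assms by (auto intro: measurable_entry)
qed

lemma integrable_Mmat:
  assumes j: "j < n" and k: "k < n"
  shows "integrable XP (\<lambda>w. MX u u' w j k)"
  unfolding Mmat_avg
proof (intro integrable_mult_right Bochner_Integration.integrable_sum)
  fix i assume "i \<in> {..<m}"
  then have i: "i < m" by simp
  define N where "N = 1 + vnorm n u + vnorm n u' + vnorm n mus"
  have N: "vnorm n u \<le> N" "vnorm n u' \<le> N" "vnorm n mus \<le> N" "1 \<le> N" by (auto simp: N_def add_increasing)
  interpret r: subg_smooth n s "D i" "F i" B P j u mus N by (rule subg_smooth_row[OF i j N(1,3,4)])
  \<comment> \<open>A weight holds one coordinate and two vectors, but here two coordinates and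
    three vectors occur; two weights sharing \<open>mus\<close> cover them.\<close>
  let ?V = "r.V j u mus" and ?V' = "r.V k u' mus"
  let ?F = "\<lambda>z. avg_deriv (F i) (vinner n z u) (vinner n z u') (vinner n z mus) * z j * z k"
  let ?G = "\<lambda>z. B * (2 ^ (P + 2) * (?V z ^ (P + 2) + ?V' z ^ (P + 2)))"
  have G: "integrable (rowlaw i) ?G"
    by (intro integrable_mult_right Bochner_Integration.integrable_add r.V_moment(1)[OF j N(1,3,4)] r.V_moment(1)[OF k N(2,3,4)])
  have le: "\<bar>?F z\<bar> \<le> ?G z" for z
  proof -
    have V: "1 \<le> ?V z" "1 \<le> ?V' z" by (rule r.V_ge_1)+
    have "\<bar>avg_deriv (F i) (vinner n z u) (vinner n z u') (vinner n z mus)\<bar>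
        \<le> B * ((1 + \<bar>vinner n z u\<bar> + \<bar>vinner n z mus\<bar>) + (1 + \<bar>vinner n z u'\<bar> + \<bar>vinner n z mus\<bar>)) ^ P"
      by (rule r.avg_growth)
    also have "\<dots> \<le> B * (?V z + ?V' z) ^ P"
      using r.B_nonneg by (intro mult_left_mono power_mono) (auto simp: r.V_def)
    finally have A: "\<bar>avg_deriv (F i) (vinner n z u) (vinner n z u') (vinner n z mus)\<bar> \<le> B * (?V z + ?V' z) ^ P" .
    have jk: "\<bar>z j\<bar> \<le> ?V z + ?V' z" "\<bar>z k\<bar> \<le> ?V z + ?V' z" by (simp_all add: r.V_def)
    have S0: "0 \<le> ?V z + ?V' z" using V by linarith
    have "\<bar>?F z\<bar> \<le> B * (?V z + ?V' z) ^ P * (?V z + ?V' z) * (?V z + ?V' z)"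
      unfolding abs_mult by (intro mult_mono A jk mult_nonneg_nonneg abs_ge_zero r.B_nonneg zero_le_power S0)
    also have "\<dots> = B * (?V z + ?V' z) ^ (P + 2)" by (simp add: power_add power2_eq_square)
    also have "\<dots> \<le> B * (2 * max (?V z) (?V' z)) ^ (P + 2)"
      using r.B_nonneg V by (intro mult_left_mono power_mono) auto
    also have "(2 * max (?V z) (?V' z)) ^ (P + 2) = 2 ^ (P + 2) * max (?V z) (?V' z) ^ (P + 2)"
      by (rule power_mult_distrib)
    also have "max (?V z) (?V' z) ^ (P + 2) \<le> ?V z ^ (P + 2) + ?V' z ^ (P + 2)"
      using V by (simp add: max_def)
    finally show ?thesis using r.B_nonneg by (simp add: mult_left_mono)
  qed
  have "integrable (rowlaw i) ?F"
  proof (rule Bochner_Integration.integrable_bound[OF G])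
    show "?F \<in> borel_measurable (rowlaw i)"
      using j k by (intro borel_measurable_times r.avg_measurable r.measurable_vinner r.measurable_component) auto
    show "AE z in rowlaw i. norm (?F z) \<le> norm (?G z)"
      using le by (intro AE_I2) (simp only: real_norm_def, meson abs_ge_self order_trans)
  qed
  from integrable_row[OF i this]
  show "integrable XP (\<lambda>w. avg_deriv (F i) (vinner n (row w i) u) (vinner n (row w i) u') (vinner n (row w i) mus) * w (i, j) * w (i, k))"
    using j k by (simp add: vinner_restrict row_def)
qed

text \<open>Both vectors are deterministic, so their difference comes out of the expectation and the
  pathwise identity can be integrated entrywise.\<close>

lemma MmatE_mult_diff:
  assumes j: "j < n"
  shows "(\<Sum>k<n. MXE u u' j k * (u k - u' k))
    = (1 / real m) * (\<Sum>i<m. (\<integral>w. grad_term i j u w \<partial>XP) - (\<integral>w. grad_term i j u' w \<partial>XP))"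
proof -
  have "(\<Sum>k<n. MXE u u' j k * (u k - u' k)) = (\<integral>w. (\<Sum>k<n. MX u u' w j k * (u k - u' k)) \<partial>XP)"
    using integrable_Mmat[OF j] by (simp add: MmatE_def)
  also have "\<dots> = (1 / real m) * (\<Sum>i<m. (\<integral>w. grad_term i j u w \<partial>XP) - (\<integral>w. grad_term i j u' w \<partial>XP))"
    unfolding Mmat_mult_diff using grad_term_row(1)[OF _ j] by simp
  finally show ?thesis .
qed

lemma gd_step: "mu w (Suc r) j = mu w r j - eta r * ((1 / real m) * (\<Sum>i<m. grad_term i j (mu w r) w))"
  by simp

lemma theo_step: "uX (Suc r) j = uX r j - eta r * ((1 / real m) * (\<Sum>i<m. \<integral>w. grad_term i j (uX r) w \<partial>XP))"
  by simp

lemma measurable_gd: "j < n \<Longrightarrow> (\<lambda>w. mu w r j) \<in> borel_measurable XP"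
proof (induction r arbitrary: j)
  case (Suc r)
  show ?case
    unfolding gd_step
  proof (intro borel_measurable_diff Suc borel_measurable_times borel_measurable_const borel_measurable_sum)
    fix i assume "i \<in> {..<m}"
    then have i: "i < m" by simp
    interpret g: smooth_family "F i" B P using f[OF i] .
    show "(\<lambda>w. w (i, j)) \<in> borel_measurable XP" using i Suc.prems by (rule measurable_entry)
    show "(\<lambda>w. F i 0 0 (vinner n (row w i) (mu w r)) (vinner n (row w i) mus)) \<in> borel_measurable XP"
      by (rule g.f_measurable) (auto intro!: measurable_row_vinner i Suc.IH)
  qed
qed simp

lemma gd_theo_recursion:
  assumes j: "j < n"
  shows "mu w (Suc r) j - uX (Suc r) j
    = (\<Sum>k<n. id_minus (eta r) (MX (mu w r) (uX r) w) j k * (mu w r k - uX r k)) - eta r * noise j (uX r) w"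
proof -
  have "(\<Sum>k<n. MX (mu w r) (uX r) w j k * (mu w r k - uX r k)) + noise j (uX r) w
     = (1 / real m) * (\<Sum>i<m. grad_term i j (mu w r) w) - (1 / real m) * (\<Sum>i<m. \<integral>w. grad_term i j (uX r) w \<partial>XP)"
    unfolding Mmat_mult_diff noise_def by (simp add: sum_subtractf diff_divide_distrib)
  then have e: "(1 / real m) * (\<Sum>i<m. grad_term i j (mu w r) w)
      = (\<Sum>k<n. MX (mu w r) (uX r) w j k * (mu w r k - uX r k)) + noise j (uX r) w
        + (1 / real m) * (\<Sum>i<m. \<integral>w. grad_term i j (uX r) w \<partial>XP)"
    by linarith
  show ?thesis
    unfolding sum_id_minus[OF j] gd_step theo_step e by (simp only: algebra_simps)
qed

text \<open>The defect of the state evolution in the theoretical recursion: at \<open>us r\<close>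
  the row averages of the two Gaussian integrals are tau and minus delta.\<close>

definition bias :: "nat \<Rightarrow> (nat \<Rightarrow> real) \<Rightarrow> real" where
  "bias j u = (1 / real m) * (\<Sum>i<m. (\<integral>w. grad_term i j u w \<partial>XP)
      - u j * (\<integral>z. F i 1 0 (vinner n z u) (vinner n z mus) \<partial>GaussLaw n)
      - mus j * (\<integral>z. F i 0 1 (vinner n z u) (vinner n z mus) \<partial>GaussLaw n))"

text \<open>The defect is taken at \<open>us r\<close> and not at \<open>uX r\<close>, so that
  smallness of coordinates is required of the state evolution only.\<close>

lemma theo_state_evo_recursion:
  assumes j: "j < n"
  shows "uX (Suc r) j - us (Suc r) j
    = (\<Sum>k<n. id_minus (eta r) (MXE (uX r) (us r)) j k * (uX r k - us r k)) - eta r * bias j (us r)"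
proof -
  define tau where "tau = (1 / real m) * (\<Sum>i<m. \<integral>z. F i 1 0 (vinner n z (us r)) (vinner n z mus) \<partial>GaussLaw n)"
  define del where "del = (1 / real m) * (\<Sum>i<m. \<integral>z. F i 0 1 (vinner n z (us r)) (vinner n z mus) \<partial>GaussLaw n)"
  have se: "us (Suc r) j = us r j - eta r * (us r j * tau + mus j * del)"
    by (simp add: Let_def tau_def del_def algebra_simps)
  have "bias j (us r) = (1 / real m) * (\<Sum>i<m. \<integral>w. grad_term i j (us r) w \<partial>XP) - us r j * tau - mus j * del"
    unfolding bias_def tau_def del_def
    by (simp add: sum_subtractf right_diff_distrib sum_distrib_left[symmetric] diff_divide_distrib)
  then have "(\<Sum>k<n. MXE (uX r) (us r) j k * (uX r k - us r k)) + bias j (us r)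
     = (1 / real m) * (\<Sum>i<m. \<integral>w. grad_term i j (uX r) w \<partial>XP) - us r j * tau - mus j * del"
    unfolding MmatE_mult_diff[OF j] by (simp add: sum_subtractf diff_divide_distrib)
  then have e: "(1 / real m) * (\<Sum>i<m. \<integral>w. grad_term i j (uX r) w \<partial>XP)
     = (\<Sum>k<n. MXE (uX r) (us r) j k * (uX r k - us r k)) + bias j (us r) + us r j * tau + mus j * del"
    by linarith
  show ?thesis
    unfolding sum_id_minus[OF j] theo_step se e by (simp only: algebra_simps)
qed

text \<open>With a = N / sqrt n both vectors have coordinates at most a. The Stein error is then of
  order a^2, giving 8 N^2 / n. The replacement error is n terms of order a^3, multiplied by a
  coordinate, giving 32 N^4 / n; the two add up to at most 40 N^4 / n.\<close>

lemma bias_bound: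
  assumes j: "j < n" and N: "1 \<le> N" and s2: "2 \<le> s"
    and u: "\<And>k. k < n \<Longrightarrow> \<bar>u k\<bar> \<le> N / sqrt (real n)" and mus: "\<And>k. k < n \<Longrightarrow> \<bar>mus k\<bar> \<le> N / sqrt (real n)"
  shows "\<bar>bias j u\<bar> \<le> 40 * N ^ 4 * (B * (4 * N) ^ P * (6 * fact (P + 3) * (4 * s * N) ^ (P + 3))) / real n"
proof -
  define C where "C = B * (4 * N) ^ P * (6 * fact (P + 3) * (4 * s * N) ^ (P + 3))"
  define a where "a = N / sqrt (real n)"
  have n: "0 < sqrt (real n)" using npos by simp
  have a: "0 \<le> a" using N n by (simp add: a_def)
  have C: "0 \<le> C" using Bpos N s_ge_1 by (simp add: C_def)
  have vu: "vnorm n u \<le> N" "vnorm n mus \<le> N"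
    using vnorm_le_sqrt_mult[of n u a] vnorm_le_sqrt_mult[of n mus a] u mus a n by (auto simp: a_def)
  let ?d = "\<lambda>k. \<bar>u k\<bar> + \<bar>mus k\<bar>"
  have d: "?d k \<le> 2 * a" if "k < n" for k using u[OF that] mus[OF that] by (simp add: a_def)
  have G: "subg s (density lborel std_normal_density)" by (rule subg_std_normal[OF s2])
  let ?I = "\<lambda>i p q M. \<integral>z. F i p q (vinner n z u) (vinner n z mus) \<partial>M"
  let ?L = "\<Sum>k<n. 2 * ?d k ^ 3 * C"
  have one: "\<bar>(\<integral>w. grad_term i j u w \<partial>XP) - u j * ?I i 1 0 (GaussLaw n) - mus j * ?I i 0 1 (GaussLaw n)\<bar>
     \<le> 2 * (?d j)\<^sup>2 * C + ?d j * ?L" if i: "i < m" for i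
  proof -
    note loc = subg_smooth_row[OF i j vu N]
    have st: "\<bar>(\<integral>w. grad_term i j u w \<partial>XP) - u j * ?I i 1 0 (rowlaw i) - mus j * ?I i 0 1 (rowlaw i)\<bar> \<le> 2 * (?d j)\<^sup>2 * C"
      using subg_smooth.approximate_stein[OF loc] unfolding grad_term_row(2)[OF i j] C_def .
    have li: "\<bar>?I i p q (rowlaw i) - ?I i p q (GaussLaw n)\<bar> \<le> ?L" if "p + q \<le> 1" for p q
      using lindeberg_replacement[OF subgD[of i] G s_ge_1 f[OF i] that vu N] unfolding C_def GaussLaw_def .
    have "\<bar>u j * (?I i 1 0 (rowlaw i) - ?I i 1 0 (GaussLaw n))\<bar> \<le> \<bar>u j\<bar> * ?L"
      unfolding abs_mult by (intro mult_left_mono li) auto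
    moreover have "\<bar>mus j * (?I i 0 1 (rowlaw i) - ?I i 0 1 (GaussLaw n))\<bar> \<le> \<bar>mus j\<bar> * ?L"
      unfolding abs_mult by (intro mult_left_mono li) auto
    ultimately show ?thesis using st by (simp only: algebra_simps) linarith
  qed
  have L: "?L \<le> real n * (2 * (2 * a) ^ 3 * C)"
  proof -
    have "?L \<le> (\<Sum>k<n. 2 * (2 * a) ^ 3 * C)"
      using d C by (intro sum_mono mult_right_mono mult_left_mono power_mono) auto
    then show ?thesis by simp
  qed
  have L0: "0 \<le> ?L" using C by (intro sum_nonneg) auto
  have "2 * (?d j)\<^sup>2 * C + ?d j * ?L \<le> 2 * (2 * a)\<^sup>2 * C + 2 * a * (real n * (2 * (2 * a) ^ 3 * C))"
    using d[OF j] L L0 C a by (intro add_mono mult_mono power_mono) auto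
  also have "\<dots> = (8 * N\<^sup>2 + 32 * N ^ 4) * C / real n"
  proof -
    have "real n * (a * a) = N\<^sup>2" using npos by (simp add: a_def power2_eq_square)
    moreover have "real n * (2 * (2 * a)\<^sup>2 * C + 2 * a * (real n * (2 * (2 * a) ^ 3 * C)))
        = 8 * (real n * (a * a)) * C + 32 * (real n * (a * a)) * (real n * (a * a)) * C"
      by (simp add: power2_eq_square power3_eq_cube algebra_simps)
    ultimately have "real n * (2 * (2 * a)\<^sup>2 * C + 2 * a * (real n * (2 * (2 * a) ^ 3 * C)))
        = (8 * N\<^sup>2 + 32 * N ^ 4) * C"
      by (simp add: power2_eq_square power4_eq_xxxx algebra_simps)
    then show ?thesis using npos by (simp add: eq_divide_eq mult.commute)
  qed
  also have "\<dots> \<le> 40 * N ^ 4 * C / real n"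
    using power_increasing[of 2 4 N] N C by (intro divide_right_mono mult_right_mono) auto
  finally have tot: "2 * (?d j)\<^sup>2 * C + ?d j * ?L \<le> 40 * N ^ 4 * C / real n" .
  have "\<bar>bias j u\<bar> \<le> (1 / real m) * (\<Sum>i<m. 2 * (?d j)\<^sup>2 * C + ?d j * ?L)"
    unfolding bias_def abs_mult using one by (intro mult_mono order_trans[OF sum_abs] sum_mono) (auto intro: sum_nonneg)
  also have "\<dots> = 2 * (?d j)\<^sup>2 * C + ?d j * ?L" using mpos by simp
  finally show ?thesis using tot unfolding C_def by linarith
qed

section \<open>High-probability distance to the state evolution\<close>

abbreviation "frakM w \<equiv> Mfun n eta (\<lambda>r. MX (mu w r) (uX r) w)"
abbreviation "scrM \<equiv> Mfun n eta (\<lambda>r. MXE (uX r) (us r))"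

lemma gd_state_evo_deviation:
  assumes t: "1 \<le> t" and N: "1 \<le> N" and s2: "2 \<le> s"
    and eta: "\<And>r. r < t \<Longrightarrow> 0 \<le> eta r \<and> eta r \<le> h"
    and uX: "\<And>r. r < t \<Longrightarrow> vnorm n (uX r) \<le> N"
    and us: "\<And>r k. r < t \<Longrightarrow> k < n \<Longrightarrow> \<bar>us r k\<bar> \<le> N / sqrt (real n)"
    and mus: "\<And>k. k < n \<Longrightarrow> \<bar>mus k\<bar> \<le> N / sqrt (real n)"
    and q: "even q" "0 < q"
    and b1: "h * (exp 2 * real q * (24 * (B * (4 * s * N * (real (P + 1) * real q)) ^ (P + 1)))) * (sqrt (real n) / sqrt (real m)) \<le> b1"
    and b2: "h * (40 * N ^ 4 * (B * (4 * N) ^ P * (6 * fact (P + 3) * (4 * s * N) ^ (P + 3)))) / sqrt (real n) \<le> b2"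
  shows "1 - real n * real t * exp (- real q)
     \<le> XP.prob {w \<in> space XP. vnorm n (\<lambda>j. mu w t j - us t j) \<le> b1 * frakM w (t - 1) + b2 * scrM (t - 1)}"
proof -
  define T1 where "T1 = exp 2 * real q * (24 * (B * (4 * s * N * (real (P + 1) * real q)) ^ (P + 1))) / sqrt (real m)"
  define T2 where "T2 = 40 * N ^ 4 * (B * (4 * N) ^ P * (6 * fact (P + 3) * (4 * s * N) ^ (P + 3))) / real n"
  \<comment> \<open>One exceptional event for each time and coordinate; off their union the first
    recursion is estimated pathwise.\<close>
  define Bad where "Bad = (\<lambda>(r, j). {w \<in> space XP. T1 \<le> \<bar>noise j (uX r) w\<bar>})"
  let ?E = "{w \<in> space XP. vnorm n (\<lambda>j. mu w t j - us t j) \<le> b1 * frakM w (t - 1) + b2 * scrM (t - 1)}"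
  let ?J = "{..<t} \<times> {..<n}"
  have n: "0 < sqrt (real n)" "sqrt (real n) * sqrt (real n) = real n" using npos by auto
  have T: "0 \<le> T1" "0 \<le> T2" using Bpos s_ge_1 N by (auto simp: T1_def T2_def)
  have vmus: "vnorm n mus \<le> N"
    using vnorm_le_sqrt_mult[of n mus "N / sqrt (real n)"] mus N n by simp
  have [measurable]: "noise j (uX r) \<in> borel_measurable XP" if "j < n" for j r
    using that by (rule measurable_noise)
  have BadS: "Bad rj \<in> XP.events" if "rj \<in> ?J" for rj
    using that unfolding Bad_def by (cases rj) (auto intro!: measurable_noise)
  have Badp: "XP.prob (Bad rj) \<le> exp (- real q)" if "rj \<in> ?J" for rj
    using that noise_tail[OF _ uX vmus N q] unfolding Bad_def T1_def by (cases rj) auto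
  have "XP.prob (\<Union>(Bad ` ?J)) \<le> (\<Sum>rj\<in>?J. XP.prob (Bad rj))"
    by (rule XP.finite_measure_subadditive_finite) (use BadS in auto)
  also have "\<dots> \<le> (\<Sum>rj\<in>?J. exp (- real q))" by (intro sum_mono Badp)
  also have "\<dots> = real n * real t * exp (- real q)" by simp
  finally have bad: "XP.prob (\<Union>(Bad ` ?J)) \<le> real n * real t * exp (- real q)" .
  have UB: "\<Union>(Bad ` ?J) \<in> XP.events" using BadS by (intro sets.finite_UN) auto
  have m1: "(\<lambda>w. frakM w (t - 1)) \<in> borel_measurable XP"
    by (intro measurable_Mfun measurable_Mmat measurable_gd borel_measurable_const)
  have m2: "(\<lambda>w. vnorm n (\<lambda>j. mu w t j - us t j)) \<in> borel_measurable XP"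
    by (intro measurable_vnorm borel_measurable_diff measurable_gd borel_measurable_const)
  \<comment> \<open>A non-measurable set would have measure 0, so monotonicity needs this; it is the
    reason for all the measurability of iterates and operator norms.\<close>
  have E: "?E \<in> XP.events"
    by (intro borel_measurable_le borel_measurable_add borel_measurable_times borel_measurable_const m1 m2)
  have second: "vnorm n (\<lambda>j. uX t j - us t j) \<le> b2 * scrM (t - 1)"
  proof -
    have "vnorm n (\<lambda>j. uX t j - us t j) \<le> h * (sqrt (real n) * T2) * scrM (t - 1)"
    proof (rule linear_recursion_bound[where \<Delta> = "\<lambda>r j. uX r j - us r j" and e = "\<lambda>r j. bias j (us r)"])
      show "vnorm n (\<lambda>j. bias j (us r)) \<le> sqrt (real n) * T2" if "r < t" for r
        using T bias_bound[OF _ N s2 us[OF that] mus] unfolding T2_def by (intro vnorm_le_sqrt_mult) auto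
    qed (use t eta in \<open>auto intro: theo_state_evo_recursion simp del: theo_gd.simps(2) state_evo.simps(2)\<close>)
    also have "h * (sqrt (real n) * T2) \<le> b2"
    proof -
      have "sqrt (real n) * (X / real n) = X / sqrt (real n)" for X
      proof -
        have "sqrt (real n) * (X / real n) = sqrt (real n) * X / (sqrt (real n) * sqrt (real n))"
          unfolding n(2) by simp
        also have "\<dots> = X / sqrt (real n)"
          using n(1) by (intro nonzero_mult_divide_mult_cancel_left) linarith
        finally show ?thesis .
      qed
      then show ?thesis using b2 by (simp add: T2_def)
    qed
    then have "h * (sqrt (real n) * T2) * scrM (t - 1) \<le> b2 * scrM (t - 1)"
      using Mfun_ge_1[of n eta _ "t - 1"] by (intro mult_right_mono) (auto intro: order_trans[OF zero_le_one])
    finally show ?thesis .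
  qed
  have sub: "space XP - \<Union>(Bad ` ?J) \<subseteq> ?E"
  proof safe
    fix w assume w: "w \<in> space XP" "w \<notin> \<Union>(Bad ` ?J)"
    have nz: "\<bar>noise j (uX r) w\<bar> \<le> T1" if "r < t" "j < n" for r j
      using w that unfolding Bad_def by force
    have "vnorm n (\<lambda>j. mu w t j - uX t j) \<le> h * (sqrt (real n) * T1) * frakM w (t - 1)"
    proof (rule linear_recursion_bound[where \<Delta> = "\<lambda>r j. mu w r j - uX r j" and e = "\<lambda>r j. noise j (uX r) w"])
      show "vnorm n (\<lambda>j. noise j (uX r) w) \<le> sqrt (real n) * T1" if "r < t" for r
        using T nz that by (intro vnorm_le_sqrt_mult) auto
    qed (use t eta in \<open>auto intro: gd_theo_recursion simp del: theo_gd.simps(2) gd.simps(2)\<close>)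
    also have "\<dots> \<le> b1 * frakM w (t - 1)"
      using b1 Mfun_ge_1[of n eta _ "t - 1"]
      by (intro mult_right_mono) (auto simp: T1_def mult_ac intro: order_trans[OF zero_le_one])
    finally have "vnorm n (\<lambda>j. mu w t j - uX t j) \<le> b1 * frakM w (t - 1)" .
    moreover have "vnorm n (\<lambda>j. mu w t j - us t j) \<le> vnorm n (\<lambda>j. mu w t j - uX t j) + vnorm n (\<lambda>j. uX t j - us t j)"
      using vnorm_triangle[of n "\<lambda>j. mu w t j - uX t j" "\<lambda>j. uX t j - us t j"] by simp
    ultimately show "vnorm n (\<lambda>j. mu w t j - us t j) \<le> b1 * frakM w (t - 1) + b2 * scrM (t - 1)"
      using second by linarith
  qed
  have "1 - real n * real t * exp (- real q) \<le> 1 - XP.prob (\<Union>(Bad ` ?J))" using bad by linarith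
  also have "\<dots> = XP.prob (space XP - \<Union>(Bad ` ?J))" by (rule XP.prob_compl[OF UB, symmetric])
  also have "\<dots> \<le> XP.prob ?E" by (rule XP.finite_measure_mono[OF sub E])
  finally show ?thesis .
qed

end

subsection \<open>Bookkeeping of constants\<close>

text \<open>Each of x, \<Lambda> and K N x is at most the product H, which yields 2 + (P + 1) powers
  of H. The numbers are 1728 = 9 * 4 * 24 * 2, with exp 2 <= 9 and q <= 4 x, and 32 = 4 * 2 *
  4.\<close>

lemma noise_constant:
  fixes K \<Lambda> N x :: real
  assumes K: "1 \<le> K" and \<Lambda>: "1 \<le> \<Lambda>" and N: "1 \<le> N" and x: "1 \<le> x" and q: "real q \<le> 4 * x"
  shows "exp 2 * real q * (24 * (2 * \<Lambda> * (4 * (2 * K) * N * (real (P + 1) * real q)) ^ (P + 1)))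
    \<le> 1728 * (32 * real (P + 1)) ^ (P + 1) * (K * \<Lambda> * N * x) ^ (P + 3)"
proof -
  define H where "H = K * \<Lambda> * N * x"
  have "exp 2 = exp (1::real) * exp 1" by (simp flip: exp_add)
  also have "\<dots> \<le> 3 * 3" using exp_le by (intro mult_mono) auto
  finally have e: "exp (2::real) \<le> 9" by simp
  have le: "x \<le> H" "\<Lambda> \<le> H" "K * N * x \<le> H"
  proof -
    have "1 * 1 * 1 * x \<le> K * \<Lambda> * N * x" using assms by (intro mult_mono) auto
    then show "x \<le> H" by (simp add: H_def)
    have "1 * \<Lambda> * 1 * 1 \<le> K * \<Lambda> * N * x" using assms by (intro mult_mono) auto
    then show "\<Lambda> \<le> H" by (simp add: H_def)
    have "K * 1 * N * x \<le> K * \<Lambda> * N * x" using assms by (intro mult_mono) auto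
    then show "K * N * x \<le> H" by (simp add: H_def)
  qed
  have "exp 2 * real q * (24 * (2 * \<Lambda> * (4 * (2 * K) * N * (real (P + 1) * real q)) ^ (P + 1)))
     \<le> 9 * (4 * x) * (24 * (2 * \<Lambda> * (4 * (2 * K) * N * (real (P + 1) * (4 * x))) ^ (P + 1)))"
    using assms e by (intro mult_mono power_mono mult_nonneg_nonneg) auto
  also have "4 * (2 * K) * N * (real (P + 1) * (4 * x)) = 32 * real (P + 1) * (K * N * x)" by simp
  also have "9 * (4 * x) * (24 * (2 * \<Lambda> * (32 * real (P + 1) * (K * N * x)) ^ (P + 1)))
     = 1728 * (32 * real (P + 1)) ^ (P + 1) * (x * \<Lambda> * (K * N * x) ^ (P + 1))"
    by (simp only: power_mult_distrib) simp
  also have "\<dots> \<le> 1728 * (32 * real (P + 1)) ^ (P + 1) * (H * H * H ^ (P + 1))"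
    using le assms by (intro mult_left_mono mult_mono power_mono) auto
  also have "H * H * H ^ (P + 1) = H ^ (P + 3)" by (simp add: power_add power3_eq_cube)
  finally show ?thesis by (simp only: H_def)
qed

text \<open>The exponent counts 4 + 1 + P + (P + 3) factors, each at most H; the number 480 is 40 *
  2 * 6.\<close>

lemma bias_constant:
  fixes K \<Lambda> N x :: real
  assumes K: "1 \<le> K" and \<Lambda>: "1 \<le> \<Lambda>" and N: "1 \<le> N" and x: "1 \<le> x"
  shows "40 * N ^ 4 * (2 * \<Lambda> * (4 * N) ^ P * (6 * fact (P + 3) * (4 * (2 * K) * N) ^ (P + 3)))
    \<le> 480 * 4 ^ P * fact (P + 3) * 8 ^ (P + 3) * (K * \<Lambda> * N * x) ^ (2 * P + 8)"
proof -
  define H where "H = K * \<Lambda> * N * x"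
  have le: "N \<le> H" "\<Lambda> \<le> H" "K * N \<le> H"
  proof -
    have "1 * 1 * N * 1 \<le> K * \<Lambda> * N * x" using assms by (intro mult_mono) auto
    then show "N \<le> H" by (simp add: H_def)
    have "1 * \<Lambda> * 1 * 1 \<le> K * \<Lambda> * N * x" using assms by (intro mult_mono) auto
    then show "\<Lambda> \<le> H" by (simp add: H_def)
    have "K * 1 * N * 1 \<le> K * \<Lambda> * N * x" using assms by (intro mult_mono) auto
    then show "K * N \<le> H" by (simp add: H_def)
  qed
  have eq: "4 * (2 * K) * N = 8 * (K * N)" by simp
  have "40 * N ^ 4 * (2 * \<Lambda> * (4 * N) ^ P * (6 * fact (P + 3) * (4 * (2 * K) * N) ^ (P + 3)))
     = 480 * 4 ^ P * fact (P + 3) * 8 ^ (P + 3) * (N ^ 4 * \<Lambda> * N ^ P * (K * N) ^ (P + 3))"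
    unfolding eq by (simp only: power_mult_distrib[of 4 N] power_mult_distrib[of 8 "K * N"]) simp
  also have "\<dots> \<le> 480 * 4 ^ P * fact (P + 3) * 8 ^ (P + 3) * (H ^ 4 * H * H ^ P * H ^ (P + 3))"
    using le assms by (intro mult_left_mono mult_mono power_mono mult_nonneg_nonneg) auto
  also have "H ^ 4 * H * H ^ P * H ^ (P + 3) = H ^ (2 * P + 8)"
    by (simp add: mult_2 power_add power4_eq_xxxx power3_eq_cube eval_nat_numeral)
  finally show ?thesis by (simp only: H_def)
qed

text \<open>Since H >= 4, a constant of size at most 4^a is paid for by a further powers of H. Since
  h >= 1, the lone factor h may be raised to the same power c.\<close>

lemma absorb_constant:
  fixes C H h :: real
  assumes "C \<le> 4 ^ a" "4 \<le> H" "1 \<le> h" "d + a \<le> c" "1 \<le> c" "0 \<le> C"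
  shows "h * (C * H ^ d) \<le> (H * h) ^ c"
proof -
  have "C * H ^ d \<le> H ^ a * H ^ d"
    using assms power_mono[of 4 H a] by (intro mult_right_mono) auto
  also have "\<dots> = H ^ (d + a)" by (simp add: power_add)
  also have "\<dots> \<le> H ^ c" using assms by (intro power_increasing) auto
  finally have "h * (C * H ^ d) \<le> h ^ c * H ^ c"
    using assms self_le_power[of h c] by (intro mult_mono[of h "h ^ c"]) (auto intro: mult_mono order_trans)
  then show ?thesis by (simp add: power_mult_distrib mult.commute)
qed

theorem mainTheorem1:
  shows "\<exists>c0::real. c0 > 1 \<and> (\<forall>p::real. p \<ge> 1 \<longrightarrow> (\<exists>cp::real. cp > 1 \<and>
   (\<forall>(m::nat) (n::nat) (K::real) (\<Lambda>::real) (D::nat \<Rightarrow> nat \<Rightarrow> real measure)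
      (L::real \<Rightarrow> real \<Rightarrow> real) (F::real \<Rightarrow> real \<Rightarrow> real) (xi::nat \<Rightarrow> real)
      (mu0::nat \<Rightarrow> real) (mus::nat \<Rightarrow> real) (eta::nat \<Rightarrow> real) (t::nat) (x::real).
     m \<ge> 16 \<longrightarrow> n \<ge> 16 \<longrightarrow> K \<ge> 2 \<longrightarrow> \<Lambda> \<ge> 2 \<longrightarrow>
     (\<forall>s. eta s > 0) \<longrightarrow>
     \<comment> \<open>(A1): independent entries (product law), mean 0, variance 1, psi_2 norm at most K\<close>
     (\<forall>i<m. \<forall>j<n. prob_space (D i j) \<and> sets (D i j) = sets borel \<and>
        integrable (D i j) (\<lambda>y. y) \<and> integral\<^sup>L (D i j) (\<lambda>y. y) = 0 \<and>
        integrable (D i j) (\<lambda>y. y\<^sup>2) \<and> integral\<^sup>L (D i j) (\<lambda>y. y\<^sup>2) = 1 \<and>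
        psi2_norm (D i j) \<le> ereal K) \<longrightarrow>
     \<comment> \<open>(A2)\<close>
     (\<forall>i<m. partials_exist 4 (\<lambda>a b. frakS L F a b (xi i)) \<and>
        (\<forall>a b. a + b \<le> 4 \<longrightarrow>
           pseudo_lipschitz \<Lambda> p (\<lambda>(y, z). pd (\<lambda>a' b'. frakS L F a' b' (xi i)) a b y z) \<and>
           \<bar>pd (\<lambda>a' b'. frakS L F a' b' (xi i)) a b 0 0\<bar> \<le> \<Lambda>)) \<longrightarrow>
     t \<ge> 1 \<longrightarrow> x \<ge> 1 \<longrightarrow>
     (let S = frakS L F;
          P = XLaw m n D;
          phi = real m / real n;
          mu = (\<lambda>w. gd S m n xi mu0 mus eta w);
          uX = theo_gd S m n P xi mu0 mus eta;
          us = state_evo S m n xi mu0 mus eta;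
          Lstar = 1 + sqrt (real n) * vnorm_inf n mu0 + sqrt (real n) * vnorm_inf n mus;
          etamax = Max (eta ` {0..<t});
          umax = Max (insert 0 ((\<lambda>s. max (sqrt (real n) * vnorm_inf n (us s)) (vnorm n (uX s))) ` {1..t-1}));
          frakM = (\<lambda>w. Mfun n eta (\<lambda>r. Mmat S m n xi mus (mu w r) (uX r) w) (t - 1));
          scrM = Mfun n eta (\<lambda>r. MmatE S m n P xi mus (uX r) (us r)) (t - 1);
          bound = (\<lambda>w. (K * \<Lambda> * Lstar * max 1 etamax * x) powr cp * (1 + umax) powr cp
                        * (phi powr (-1/2) * frakM w + real n powr (-1/2) * scrM))
      in measure P {w \<in> space P. vnorm n (\<lambda>j. mu w t j - us t j) \<le> bound w}
           \<ge> 1 - c0 * real n * real t * exp (- x)))))"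
\<comment> \<open>The union bound gives the factor 1; the value 2 is chosen because the constant
  must exceed 1.\<close>
proof (rule exI[of _ 2], intro conjI allI impI, goal_cases)
  case 1
  show ?case by simp
next
  case (2 p)
  define P where "P = nat \<lceil>p\<rceil>"
  have p: "1 \<le> p" "p \<le> real P" using 2 by (auto simp: P_def)
  define C1 :: real where "C1 = 1728 * (32 * real (P + 1)) ^ (P + 1)"
  define C2 :: real where "C2 = 480 * 4 ^ P * fact (P + 3) * 8 ^ (P + 3)"
  \<comment> \<open>\<open>C1\<close> and \<open>C2\<close> are functions of \<open>P\<close> alone,
    so a depends only on p.\<close>
  obtain a where "max C1 C2 < 4 ^ a" using real_arch_pow[of 4 "max C1 C2"] by auto
  then have a: "C1 \<le> 4 ^ a" "C2 \<le> 4 ^ a" by auto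
  define c where "c = 2 * P + 8 + a"
  show ?case
  proof (rule exI[of _ "real c"], intro conjI allI impI, goal_cases)
    case 1
    show ?case by (simp add: c_def)
  next
    case (2 m n K \<Lambda> D L F xi mu0 mus eta t x)
    \<comment> \<open>Only the laws inside the m by n block are constrained, while the locales ask
      for all indices. Filling up with Gaussians leaves \<open>XLaw\<close> unchanged.\<close>
    define D' where "D' i j = (if i < m \<and> j < n then D i j else density lborel std_normal_density)" for i j
    have XD: "XLaw m n D = XLaw m n D'"
      unfolding XLaw_def by (rule PiM_cong) (auto simp: D'_def)
    have K: "2 \<le> K" and \<Lambda>: "2 \<le> \<Lambda>" and t: "1 \<le> t" and x: "1 \<le> x" using 2 by auto
    have nm: "0 < m" "0 < n" using 2(1,2) by auto
    have subg: "subg (2 * K) (D' i j)" for i j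
      using 2(6) K by (auto simp: D'_def intro!: subg_of_psi2_norm subg_std_normal)
    have fam: "smooth_family (pd (\<lambda>a b. frakS L F a b (xi i))) (2 * \<Lambda>) P" if "i < m" for i
      by (rule smooth_family_pd[where p = p]) (use 2(7) that p \<Lambda> in auto)
    interpret gd_model m n "2 * K" D' "frakS L F" xi "2 * \<Lambda>" P mus mu0 eta
      using K \<Lambda> nm subg fam
      by (simp add: gd_model_def gradient_model_def subg_matrix_def gradient_model_axioms_def)
    define Lstar where "Lstar = 1 + sqrt (real n) * vnorm_inf n mu0 + sqrt (real n) * vnorm_inf n mus"
    define h where "h = max 1 (Max (eta ` {0..<t}))"
    define umax where "umax = Max (insert 0 ((\<lambda>s. max (sqrt (real n) * vnorm_inf n (us s)) (vnorm n (uX s))) ` {1..t-1}))"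
    \<comment> \<open>A product, so that it dominates both factors. \<open>Lstar\<close> covers
      \<open>mus\<close> and the starting vector, \<open>1 + umax\<close> the times from 1 on, as
      the maximum in \<open>umax\<close> omits time 0.\<close>
    define N where "N = Lstar * (1 + umax)"
    define H where "H = K * \<Lambda> * N * x"
    \<comment> \<open>An even order between x and 4 x: the lower bound gives exp (- q) <= exp (- x),
      and the upper one, valid for x >= 1, lets q be absorbed into powers of x.\<close>
    define q where "q = 2 * nat \<lceil>x\<rceil>"
    have inf0: "0 \<le> sqrt (real n) * vnorm_inf n u" for u using vnorm_inf_nonneg[OF nm(2)] by simp
    have umax0: "0 \<le> umax" unfolding umax_def by (intro Max_ge) auto
    have umax: "sqrt (real n) * vnorm_inf n (us r) \<le> umax \<and> vnorm n (uX r) \<le> umax" if "1 \<le> r" "r < t" for r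
    proof -
      have "max (sqrt (real n) * vnorm_inf n (us r)) (vnorm n (uX r)) \<le> umax"
        unfolding umax_def using that by (intro Max_ge) auto
      then show ?thesis by simp
    qed
    have Ls: "1 \<le> Lstar" using inf0[of mu0] inf0[of mus] by (simp add: Lstar_def)
    have NL: "Lstar \<le> N" "1 + umax \<le> N"
      using mult_left_mono[of 1 "1 + umax" Lstar] mult_right_mono[of 1 Lstar "1 + umax"] Ls umax0 by (auto simp: N_def)
    have N1: "1 \<le> N" using NL Ls by linarith
    have h: "1 \<le> h" by (simp add: h_def)
    have etah: "0 \<le> eta r \<and> eta r \<le> h" if "r < t" for r
    proof -
      have "eta r \<le> Max (eta ` {0..<t})" using that by (intro Max_ge) auto
      then show ?thesis using 2(5) by (auto simp: h_def intro: less_imp_le)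
    qed
    have uXN: "vnorm n (uX r) \<le> N" if "r < t" for r
    proof (cases "r = 0")
      case True
      have "vnorm n mu0 \<le> sqrt (real n) * vnorm_inf n mu0" by (rule vnorm_le_vnorm_inf[OF nm(2)])
      then show ?thesis using True NL inf0[of mus] by (simp add: Lstar_def)
    qed (use umax[of r] that NL in auto)
    have div: "\<bar>u k\<bar> \<le> N / sqrt (real n)" if "sqrt (real n) * vnorm_inf n u \<le> N" "k < n" for u k
    proof -
      have "sqrt (real n) * \<bar>u k\<bar> \<le> sqrt (real n) * vnorm_inf n u"
        using component_le_vnorm_inf[OF that(2)] by (intro mult_left_mono) auto
      then have "sqrt (real n) * \<bar>u k\<bar> \<le> N" using that(1) by linarith
      then show ?thesis using nm by (simp add: pos_le_divide_eq mult.commute)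
    qed
    have usN: "\<bar>us r k\<bar> \<le> N / sqrt (real n)" if "r < t" "k < n" for r k
    proof (rule div[OF _ that(2)], cases "r = 0")
      case True
      then show "sqrt (real n) * vnorm_inf n (us r) \<le> N" using NL inf0[of mus] by (simp add: Lstar_def)
    qed (use umax[of r] that NL in auto)
    have musN: "\<bar>mus k\<bar> \<le> N / sqrt (real n)" if "k < n" for k
      by (rule div[OF _ that]) (use NL inf0[of mu0] in \<open>simp add: Lstar_def\<close>)
    have H4: "4 \<le> H"
    proof -
      have "2 * 2 * 1 * 1 \<le> K * \<Lambda> * N * x" using K \<Lambda> N1 x by (intro mult_mono) auto
      then show ?thesis by (simp add: H_def)
    qed
    have q: "even q" "0 < q" "x \<le> real q" "real q \<le> 4 * x"
    proof -
      obtain k where "q = 2 * k" "x \<le> real k" "real k \<le> x + 1" "0 < k"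
      proof
        show "q = 2 * nat \<lceil>x\<rceil>" by (rule q_def)
        show "x \<le> real (nat \<lceil>x\<rceil>)" "real (nat \<lceil>x\<rceil>) \<le> x + 1" "0 < nat \<lceil>x\<rceil>" using x by linarith+
      qed
      then show "even q" "0 < q" "x \<le> real q" "real q \<le> 4 * x" using x by auto
    qed
    define X where "X = (H * h) ^ c"
    have c1: "h * (exp 2 * real q * (24 * (2 * \<Lambda> * (4 * (2 * K) * N * (real (P + 1) * real q)) ^ (P + 1)))) \<le> X"
    proof -
      have "h * (exp 2 * real q * (24 * (2 * \<Lambda> * (4 * (2 * K) * N * (real (P + 1) * real q)) ^ (P + 1))))
          \<le> h * (C1 * H ^ (P + 3))"
        unfolding C1_def H_def using K \<Lambda> N1 x q h by (intro mult_left_mono noise_constant) auto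
      also have "\<dots> \<le> X"
        unfolding X_def by (rule absorb_constant[OF a(1) H4 h]) (auto simp: c_def C1_def)
      finally show ?thesis .
    qed
    have c2: "h * (40 * N ^ 4 * (2 * \<Lambda> * (4 * N) ^ P * (6 * fact (P + 3) * (4 * (2 * K) * N) ^ (P + 3)))) \<le> X"
    proof -
      have "h * (40 * N ^ 4 * (2 * \<Lambda> * (4 * N) ^ P * (6 * fact (P + 3) * (4 * (2 * K) * N) ^ (P + 3))))
          \<le> h * (C2 * H ^ (2 * P + 8))"
        unfolding C2_def H_def using K \<Lambda> N1 x h by (intro mult_left_mono bias_constant) auto
      also have "\<dots> \<le> X"
        unfolding X_def by (rule absorb_constant[OF a(2) H4 h]) (auto simp: c_def C2_def)
      finally show ?thesis .
    qed
    have "1 - real n * real t * exp (- real q) \<le> XP.prob {w \<in> space XP. vnorm n (\<lambda>j. mu w t j - us t j)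
        \<le> X * (sqrt (real n) / sqrt (real m)) * frakM w (t - 1) + X / sqrt (real n) * scrM (t - 1)}"
    proof (rule gd_state_evo_deviation[OF t N1 _ etah uXN usN musN q(1,2)])
      show "2 \<le> 2 * K" using K by simp
    qed (assumption | intro mult_right_mono divide_right_mono c1 c2; simp)+
    moreover have "1 - 2 * real n * real t * exp (- x) \<le> 1 - real n * real t * exp (- real q)"
    proof -
      have "real n * real t * exp (- real q) \<le> real n * real t * exp (- x)"
        using q(3) by (intro mult_left_mono) auto
      moreover have "0 \<le> real n * real t * exp (- x)" by simp
      ultimately show ?thesis by linarith
    qed
    moreover have "(K * \<Lambda> * Lstar * h * x) powr real c * (1 + umax) powr real c
        * ((real m / real n) powr (-1/2) * y + real n powr (-1/2) * z)
      = X * (sqrt (real n) / sqrt (real m)) * y + X / sqrt (real n) * z" for y z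
    proof -
      \<comment> \<open>The exponent is a natural number and the bases are positive, so the two real
        powers merge into the single integer power \<open>X\<close>.\<close>
      have "(K * \<Lambda> * Lstar * h * x) powr real c * (1 + umax) powr real c = X"
      proof -
        have "0 < K * \<Lambda> * Lstar * h * x" "0 < 1 + umax" using K \<Lambda> Ls h x umax0 by auto
        then have "(K * \<Lambda> * Lstar * h * x) powr real c * (1 + umax) powr real c
           = ((K * \<Lambda> * Lstar * h * x) * (1 + umax)) ^ c"
          by (simp add: powr_realpow power_mult_distrib)
        also have "(K * \<Lambda> * Lstar * h * x) * (1 + umax) = H * h" by (simp add: H_def N_def)
        finally show ?thesis by (simp add: X_def)
      qed
      moreover have half: "y powr (-1/2) = 1 / sqrt y" if "0 < y" for y :: real
        using powr_minus_divide[of y "1/2"] that by (simp add: powr_half_sqrt)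
      ultimately show ?thesis
        using nm by (simp add: half real_sqrt_divide algebra_simps)
    qed
    ultimately show ?case
      unfolding Let_def XD Lstar_def h_def umax_def by simp
  qed
qed

end
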